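(* Let $q=p^e$ be a power of an odd prime $p$ with $q\equiv 1\pmod 5$, let $t=\frac{q-1}{5}$, and let $T$ be a generator of the group of multiplicative characters of $\mathbb{F}_q^\times$. Let $\lambda\in\mathbb{F}_q$, $\lambda\neq 0$, and let $X_\lambda^5$ be the Dwork threefold $x_1^5+x_2^5+x_3^5+x_4^5+x_5^5=5\lambda\, x_1x_2x_3x_4x_5$ in $\mathbb{P}^4$. Then \begin{align*} \#X_{\lambda}^5(\mathbb F_q)&=\frac{q^{4}-1}{q-1}+ 24 q^2\delta(1-\lambda^5)+ q^{3}\,{}_{4}F_{3}\left(\left.\begin{array}{cccc} T^t&T^{2t}&T^{3t} &T^{4t}\\ {} &\epsilon&\epsilon&\epsilon \end{array}\right|\frac{1}{\lambda^5}\right)_q\\ &\quad+20q^2\,{}_{2}F_{1}\left(\left.\begin{array}{cc} T^{2t}&T^{3t}\\ {} &\epsilon \end{array}\right|\frac{1}{\lambda^5}\right)_q+20q^2\,{}_{2}F_{1}\left(\left.\begin{array}{cc} T^{t}&T^{4t}\\ {} &\epsilon \end{array}\right|\frac{1}{\lambda^5}\right)_q\\ &\quad+30q^2\,{}_{2}F_{1}\left(\left.\begin{array}{cc} T^{t}&T^{3t}\\ {} &T^{4t} \end{array}\right|\frac{1}{\lambda^5}\right)_q+30q^2\,{}_{2}F_{1}\left(\left.\begin{array}{cc} T^{t}&T^{2t}\\ {} &T^{3t} \end{array}\right|\frac{1}{\lambda^5}\right)_q, \end{align*} where $\delta(x)=1$ if $x=0$ and $\delta(x)=0$ otherwise.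
   Context: $\#X_\lambda^5(\mathbb{F}_q)$ is the number of points of $\mathbb{P}^4(\mathbb{F}_q)$ on the hypersurface. Multiplicative characters $\chi$ of $\mathbb{F}_q^\times$ are extended to $\mathbb{F}_q$ by $\chi(0)=0$ (including the trivial character $\epsilon$); powers $T^k$ are taken in the character group. For characters $A,B$, $\binom{A}{B}=\frac{B(-1)}{q}\sum_{x\in\mathbb{F}_q}A(x)\overline{B}(1-x)$. Greene's hypergeometric function is ${}_{n+1}F_n\left(\begin{array}{cccc}A_0&A_1&\ldots&A_n\\ &B_1&\ldots&B_n\end{array}\Big| x\right)_q=\frac{q}{q-1}\sum_{\chi}\binom{A_0\chi}{\chi}\binom{A_1\chi}{B_1\chi}\cdots\binom{A_n\chi}{B_n\chi}\chi(x)$, the sum over all multiplicative characters $\chi$ of $\mathbb{F}_q^\times$. *)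

theory Defs
  imports
    "HOL-Analysis.Finite_Cartesian_Product"
    "HOL-Library.Numeral_Type"
    "HOL-Algebra.Generated_Groups"
    "HOL-Number_Theory.Cong"
begin

text \<open>
  A multiplicative character of \<open>F\<^sub>q\<^sup>\<times>\<close> is represented by its extension by \<open>0\<close> to the whole
  field \<open>F\<^sub>q = 'a\<close>. In particular the trivial character also vanishes at \<open>0\<close>, and this
  is the unit of the character group.
\<close>

definition mult_char :: "('a::{field,finite} \<Rightarrow> complex) \<Rightarrow> bool" where
  "mult_char \<psi> \<longleftrightarrow>
     \<psi> 0 = 0 \<and> (\<forall>x. x \<noteq> 0 \<longrightarrow> \<psi> x \<noteq> 0) \<and>
     (\<forall>x y. x \<noteq> 0 \<longrightarrow> y \<noteq> 0 \<longrightarrow> \<psi> (x * y) = \<psi> x * \<psi> y)"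

definition trivial_char :: "'a::{field,finite} \<Rightarrow> complex" where
  "trivial_char x = (if x = 0 then 0 else 1)"

definition char_group :: "('a::{field,finite} \<Rightarrow> complex) monoid" where
  "char_group =
     \<lparr> carrier = {\<psi>. mult_char \<psi>},
       monoid.mult = (\<lambda>\<psi> \<phi> x. \<psi> x * \<phi> x),
       one = trivial_char \<rparr>"

definition char_generator :: "('a::{field,finite} \<Rightarrow> complex) \<Rightarrow> bool" where
  "char_generator T \<longleftrightarrow>
     T \<in> carrier char_group \<and> generate char_group {T} = carrier char_group"

definition char_binom ::
    "('a::{field,finite} \<Rightarrow> complex) \<Rightarrow> ('a \<Rightarrow> complex) \<Rightarrow> complex" where
  "char_binom A B = B (- 1) / of_nat CARD('a) * (\<Sum>x\<in>UNIV. A x * cnj (B (1 - x)))"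

text \<open>
  Greene's function with upper parameters \<open>A0 # As\<close> and lower parameters \<open>Bs\<close>. It is meant
  for \<open>length As = length Bs\<close>; otherwise \<open>map2\<close> truncates the longer list.
\<close>

definition greene_F ::
    "('a::{field,finite} \<Rightarrow> complex) \<Rightarrow> ('a \<Rightarrow> complex) list \<Rightarrow> ('a \<Rightarrow> complex) list
      \<Rightarrow> 'a \<Rightarrow> complex" where
  "greene_F A0 As Bs x =
     of_nat CARD('a) / (of_nat CARD('a) - 1) *
     (\<Sum>\<psi> \<in> carrier char_group.
        char_binom (A0 \<otimes>\<^bsub>char_group\<^esub> \<psi>) \<psi> *
        prod_list (map2 (\<lambda>A B. char_binom (A \<otimes>\<^bsub>char_group\<^esub> \<psi>) (B \<otimes>\<^bsub>char_group\<^esub> \<psi>)) As Bs) *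
        \<psi> x)"

definition proj_rel :: "(('a::field ^ 'n) \<times> ('a ^ 'n)) set" where
  "proj_rel = {(v, w). v \<noteq> 0 \<and> w \<noteq> 0 \<and> (\<exists>c. c \<noteq> 0 \<and> w = c *s v)}"

definition proj_points :: "('a::field ^ 'n) set set" where
  "proj_points = {v. v \<noteq> 0} // proj_rel"

text \<open>
  The coordinates \<open>x\<^sub>1, \<dots>, x\<^sub>5\<close> are indexed by the five-element type \<open>5\<close> (where \<open>5 = 0\<close>).
  The equation is homogeneous, so it holds for all representatives of a point or for none.
\<close>

definition dwork_threefold :: "'a::{field,finite} \<Rightarrow> ('a ^ 5) set set" where
  "dwork_threefold lam =
     {P \<in> proj_points. \<forall>x\<in>P.
        x $ 1 ^ 5 + x $ 2 ^ 5 + x $ 3 ^ 5 + x $ 4 ^ 5 + x $ 5 ^ 5 =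
        5 * lam * x $ 1 * x $ 2 * x $ 3 * x $ 4 * x $ 5}"

definition delta :: "'a::zero \<Rightarrow> complex" where
  "delta x = (if x = 0 then 1 else 0)"

end

theory Submission
  imports Defs "HOL-Number_Theory.Residues" "HOL-Computational_Algebra.Polynomial_Factorial"
begin

text \<open>
  Detecting the equation with additive characters and expanding the mixed monomial in multiplicative
  characters \<open>\<eta>\<close> turns the affine count into a sum over \<open>\<eta>\<close> of \<open>g(\<eta>\<^sup>-\<^sup>5)\<close> times products of five Gauss sums
  \<open>g(\<eta> \<psi>\<^sup>i)\<close>, where \<open>\<psi> = T\<^sup>t\<close> has order 5 and the five indices add up to \<open>0\<close> modulo 5. The
  Hasse-Davenport product formula replaces \<open>g(\<eta>\<^sup>-\<^sup>5)\<close> by \<open>\<Prod>\<^sub>i g(\<eta>\<^sup>-\<^sup>1 \<psi>\<^sup>i)\<close>. After cancelling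
  \<open>g(\<chi>) g(\<chi>\<^sup>-\<^sup>1) = \<chi>(-1) q\<close> the index vectors fall into six classes under permutation and rotation, five of which
  are the five hypergeometric sums, while \<open>(0, 1, 2, 3, 4)\<close> gives the term with \<open>\<delta>\<close>.

  The product formula itself is proved by comparing \<open>L\<close>-functions on \<open>F\<^sub>q[x]\<close>: the one of \<open>\<eta>(x\<^sup>5 - 1)\<close> is
  the product of those of \<open>\<psi>\<^sup>i(u) \<eta>(u - 1)\<close> for \<open>u = x\<^sup>5\<close>, and its top coefficient is found by Lagrange
  interpolation at the fifth roots of unity.
\<close>

section \<open>Multiplicative and additive characters\<close>

text \<open>The obstacle is the five characters \<eta> whose fifth power is trivial, the powers of
  \<psi>: for them one of the products of a Gauss sum with that of the inverse character is 1
  instead of q up to sign. They are evaluated separately, and their defect cancels the contribution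
  of the vectors with a zero coordinate, where the mixed monomial has no expansion in multiplicative
  characters. The multiplicities count arrangements: 20 = 5!/3!, 30 = 5!/(2! 2!), while the 120
  arrangements of (0, 1, 2, 3, 4) are shared by five rotations, hence 24. Rotating the indices
  amounts to multiplying \<eta> by a power of \<psi>; the factor 5 gained in this way cancels the
  1/5 that comes from writing the characters that occur as fifth powers, each in five ways. In the
  product formula only the coefficient of degree 4 is needed, so that only primes P of degree below
  5 are compared. For these the five polynomials obtained from P by scaling the variable with powers
  of \<zeta> are distinct, the ramified prime x excepted, and the comparison needs no extension of
  the field.\<close>

lemma card_field_ge_2: "CARD('a::{field,finite}) \<ge> 2"
proof -
  have "card {0, 1 :: 'a} \<le> CARD('a)" by (intro card_mono) auto
  then show ?thesis by simp
qed

lemma field_power_card_minus_1: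
  fixes x :: "'a::{field,finite}"
  assumes "x \<noteq> 0"
  shows "x ^ (CARD('a) - 1) = 1"
proof -
  have "(\<Prod>y\<in>UNIV-{0}. x * y) = (\<Prod>y\<in>UNIV-{0}. y)"
    by (rule prod.reindex_bij_witness[of _ "\<lambda>y. y / x" "\<lambda>y. x * y"]) (use assms in auto)
  moreover have "(\<Prod>y\<in>UNIV-{0}. x * y) = x ^ (CARD('a) - 1) * (\<Prod>y\<in>UNIV-{0}. y)"
    by (simp add: prod.distrib card_Diff_subset)
  ultimately show ?thesis by simp
qed

lemma field_power_card: "x ^ CARD('a) = (x :: 'a::{field,finite})"
proof (cases "x = 0")
  case False
  have "x ^ CARD('a) = x * x ^ (CARD('a) - 1)"
    using card_field_ge_2[where 'a = 'a] by (metis One_nat_def Suc_diff_1 less_le_trans pos2 power_Suc)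
  with field_power_card_minus_1[OF False] show ?thesis by simp
qed (use card_field_ge_2[where 'a = 'a] in simp)

text \<open>Cyclicity of the unit group is a theorem about ring records, so the type is repackaged
  as such a record.\<close>

lemma field_units_cyclic:
  obtains \<gamma> :: "'a::{field,finite}" where "\<gamma> \<noteq> 0" "\<And>x. x \<noteq> 0 \<Longrightarrow> \<exists>k. x = \<gamma> ^ k"
proof -
  define R :: "'a ring" where "R = \<lparr>carrier = UNIV, monoid.mult = (*), one = 1, zero = 0, add = (+)\<rparr>"
  have "cring R"
  proof (rule cringI)
    show "abelian_group R"
    proof (rule abelian_groupI)
      show "\<exists>y\<in>carrier R. y \<oplus>\<^bsub>R\<^esub> x = \<zero>\<^bsub>R\<^esub>" if "x \<in> carrier R" for x
        by (intro bexI[of _ "-x"]) (auto simp: R_def)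
    qed (auto simp: R_def)
    show "Group.comm_monoid R"
      by (rule comm_monoidI) (auto simp: R_def)
  qed (auto simp: R_def algebra_simps)
  then interpret R: field R
  proof (rule cring.cring_fieldI)
    have "x \<in> Units R" if "x \<noteq> 0" for x
      using that by (auto simp: R_def Units_def intro!: exI[of _ "inverse x"])
    then show "Units R = carrier R - {\<zero>\<^bsub>R\<^esub>}" by (auto simp: R_def Units_def)
  qed
  have fin: "finite (carrier R)" by (simp add: R_def)
  from R.finite_field_mult_group_has_gen[OF fin]
  obtain a where a: "a \<in> carrier (mult_of R)" "carrier (mult_of R) = {a [^]\<^bsub>R\<^esub> i | i :: nat. i \<in> UNIV}"
    by (rule bexE)
  have pow: "b [^]\<^bsub>R\<^esub> i = b ^ i" for b and i :: nat
    by (induction i) (auto simp: R_def nat_pow_def)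
  show ?thesis
  proof
    show "a \<noteq> 0" using a(1) by (simp add: R_def)
    show "\<exists>k. x = a ^ k" if "x \<noteq> 0" for x
    proof -
      have "x \<in> carrier (mult_of R)" using that by (simp add: R_def)
      then show ?thesis using a(2) by (auto simp: pow)
    qed
  qed
qed

lemma mult_char_mult: "mult_char \<alpha> \<Longrightarrow> \<alpha> (x * y) = \<alpha> x * \<alpha> y"
  by (cases "x = 0 \<or> y = 0") (auto simp: mult_char_def)

lemma mult_char_0: "mult_char \<alpha> \<Longrightarrow> \<alpha> 0 = 0"
  by (simp add: mult_char_def)

lemma mult_char_eq_0_iff: "mult_char \<alpha> \<Longrightarrow> \<alpha> x = 0 \<longleftrightarrow> x = 0"
  by (auto simp: mult_char_def)

lemma mult_char_1: "mult_char \<alpha> \<Longrightarrow> \<alpha> 1 = 1"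
  using mult_char_mult[of \<alpha> 1 1] mult_char_eq_0_iff[of \<alpha> 1] by auto

lemma mult_char_power: "mult_char \<alpha> \<Longrightarrow> \<alpha> (x ^ n) = \<alpha> x ^ n"
  by (induction n) (auto simp: mult_char_1 mult_char_mult)

lemma mult_char_prod: "mult_char \<alpha> \<Longrightarrow> \<alpha> (prod f A) = (\<Prod>a\<in>A. \<alpha> (f a))"
  by (induction A rule: infinite_finite_induct) (auto simp: mult_char_1 mult_char_mult)

text \<open>The values at units are roots of unity of order dividing q - 1. This is what makes
  conjugation the inverse in the character group.\<close>

lemma mult_char_norm:
  fixes \<alpha> :: "'a::{field,finite} \<Rightarrow> complex"
  assumes "mult_char \<alpha>" "x \<noteq> 0"
  shows "cmod (\<alpha> x) = 1"
proof -
  have "\<alpha> x ^ (CARD('a) - 1) = 1"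
    using assms by (metis mult_char_power mult_char_1 field_power_card_minus_1)
  then have "cmod (\<alpha> x) ^ (CARD('a) - 1) = 1"
    by (metis norm_one norm_power)
  moreover have "CARD('a) - 1 > 0" using card_field_ge_2[where 'a = 'a] by simp
  ultimately show ?thesis
    using power_eq_1_iff by (metis norm_ge_zero power_eq_imp_eq_base power_one zero_le_one)
qed

lemma mult_char_cnj_self:
  assumes "mult_char \<alpha>" "x \<noteq> 0"
  shows "\<alpha> x * cnj (\<alpha> x) = 1"
  using mult_char_norm[OF assms] by (simp add: complex_norm_square[symmetric])

lemma mult_char_inverse:
  assumes "mult_char \<alpha>"
  shows "\<alpha> (inverse x) = cnj (\<alpha> x)"
proof (cases "x = 0")
  case False
  have "\<alpha> x * \<alpha> (inverse x) = \<alpha> x * cnj (\<alpha> x)"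
    using False assms by (simp add: mult_char_cnj_self mult_char_mult[symmetric] mult_char_1)
  then show ?thesis using False assms by (simp add: mult_char_eq_0_iff)
qed (use assms in \<open>simp add: mult_char_0\<close>)

lemma mult_char_divide: "mult_char \<alpha> \<Longrightarrow> \<alpha> (x / y) = \<alpha> x * cnj (\<alpha> y)"
  by (simp add: divide_inverse mult_char_mult mult_char_inverse)

lemma mult_char_minus1_square: "mult_char \<alpha> \<Longrightarrow> \<alpha> (-1) * \<alpha> (-1) = 1"
  by (simp add: mult_char_mult[symmetric] mult_char_1)

lemma mult_char_minus1_cnj: "mult_char \<alpha> \<Longrightarrow> cnj (\<alpha> (-1)) = \<alpha> (-1)"
  using mult_char_inverse[of \<alpha> "-1"] by simp

lemma mult_char_trivial [simp]: "mult_char trivial_char"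
  by (simp add: mult_char_def trivial_char_def)

lemma mult_char_times: "mult_char \<alpha> \<Longrightarrow> mult_char \<phi> \<Longrightarrow> mult_char (\<lambda>x. \<alpha> x * \<phi> x)"
  by (simp add: mult_char_def)

lemma mult_char_cnj: "mult_char \<alpha> \<Longrightarrow> mult_char (\<lambda>x. cnj (\<alpha> x))"
  by (simp add: mult_char_def)

lemma mult_char_trivial_absorb: "mult_char \<alpha> \<Longrightarrow> trivial_char x * \<alpha> x = \<alpha> x"
  by (simp add: mult_char_def trivial_char_def)

lemma mult_char_times_cnj: "mult_char \<alpha> \<Longrightarrow> (\<lambda>x. \<alpha> x * cnj (\<alpha> x)) = trivial_char"
  by (rule ext) (simp add: trivial_char_def mult_char_0 mult_char_cnj_self)

lemma sum_mult_char:
  fixes \<alpha> :: "'a::{field,finite} \<Rightarrow> complex"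
  assumes "mult_char \<alpha>" "\<alpha> \<noteq> trivial_char"
  shows "(\<Sum>x\<in>UNIV. \<alpha> x) = 0"
proof -
  obtain a where a: "a \<noteq> 0" "\<alpha> a \<noteq> 1"
    using assms by (auto simp: fun_eq_iff trivial_char_def mult_char_0 split: if_splits)
  have "(\<Sum>x\<in>UNIV. \<alpha> x) = (\<Sum>x\<in>UNIV. \<alpha> (a * x))"
    by (rule sum.reindex_bij_witness[of _ "\<lambda>x. a * x" "\<lambda>x. x / a"]) (use a in auto)
  also have "\<dots> = \<alpha> a * (\<Sum>x\<in>UNIV. \<alpha> x)" by (simp add: mult_char_mult assms sum_distrib_left)
  finally have "(1 - \<alpha> a) * (\<Sum>x\<in>UNIV. \<alpha> x) = 0" by (simp add: algebra_simps)
  with a show ?thesis by simp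
qed

lemma sum_trivial_char: "(\<Sum>x\<in>UNIV. trivial_char (x :: 'a::{field,finite})) = of_nat CARD('a) - 1"
proof -
  have "(\<Sum>x\<in>UNIV. trivial_char (x :: 'a)) = (\<Sum>x\<in>UNIV - {0 :: 'a}. 1)"
    by (rule sum.mono_neutral_cong_right) (auto simp: trivial_char_def)
  then show ?thesis using card_field_ge_2[where 'a = 'a] by (simp add: card_Diff_subset of_nat_diff)
qed

section \<open>Nontrivial additive characters and their existence\<close>

locale additive_char =
  fixes \<theta> :: "'a::{field,finite} \<Rightarrow> complex" and q :: complex
  assumes q_eq: "q = of_nat CARD('a)"
    and add: "\<theta> (x + y) = \<theta> x * \<theta> y"
    and zero: "\<theta> 0 = 1"
    and nontrivial: "\<exists>x. \<theta> x \<noteq> 1"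

text \<open>The character is \<open>exp(2 \<pi> i Tr(x) / p)\<close>, where \<open>Tr\<close> is the trace to the prime field.\<close>

lemma additive_char_exists:
  assumes p: "prime p" and e: "e \<ge> 1" and card: "CARD('a::{field,finite}) = p ^ e"
  obtains \<theta> :: "'a::{field,finite} \<Rightarrow> complex" where "additive_char \<theta> (of_nat CARD('a))"
proof -
  have "prime CHAR('a)"
    using prime_CHAR_semidom[where 'a = 'a] finite_imp_CHAR_pos[where 'a = 'a] by simp
  moreover have "CHAR('a) dvd p ^ e" using CHAR_dvd_CARD[where 'a = 'a] card by simp
  ultimately have pc: "p = CHAR('a)"
    using p by (metis prime_dvd_power primes_dvd_imp_eq)
  have pp: "prime CHAR('a)" using p pc by simp
  define Tr :: "'a \<Rightarrow> 'a" where "Tr x = (\<Sum>i<e. x ^ (p ^ i))" for x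
  have Tr_add: "Tr (x + y) = Tr x + Tr y" for x y
    using freshmans_dream'[OF pp] by (simp add: Tr_def pc sum.distrib)
  have p1: "p > 1" using p prime_gt_1_nat by blast
  \<comment> \<open>Frobenius permutes the summands cyclically, since the power of x with exponent
    \<open>p ^ e\<close> is x again.\<close>
  have Tr_p: "Tr x ^ p = Tr x" for x
  proof -
    have "Tr x ^ p = (\<Sum>i<e. x ^ (p ^ Suc i))"
      unfolding Tr_def pc by (subst freshmans_dream_sum[OF pp]) (simp_all add: power_mult[symmetric] mult.commute)
    also have "\<dots> = (\<Sum>i\<in>{1..<Suc e}. x ^ (p ^ i))"
      by (rule sum.reindex_bij_witness[of _ "\<lambda>i. i - 1" Suc]) auto
    also have "\<dots> = (\<Sum>i\<in>{1..<e}. x ^ (p ^ i)) + x ^ (p ^ e)" using e by simp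
    also have "x ^ (p ^ e) = x ^ (p ^ 0)" using field_power_card[of x] card by simp
    also have "(\<Sum>i\<in>{1..<e}. x ^ (p ^ i)) + x ^ (p ^ 0) = Tr x"
      using e by (simp add: Tr_def lessThan_atLeast0 sum.atLeast_Suc_lessThan)
    finally show ?thesis .
  qed
  have inj: "inj_on (of_nat :: nat \<Rightarrow> 'a) {..<p}"
    by (auto simp: inj_on_def of_nat_eq_iff_cong_CHAR pc cong_def)
  \<comment> \<open>The fixed points of Frobenius are the roots of a polynomial of degree p, and the
    p residues are already that many roots.\<close>
  have prime_field: "y \<in> of_nat ` {..<p}" if "y ^ p = y" for y :: 'a
  proof -
    define P :: "'a poly" where "P = monom 1 p - monom 1 1"
    have deg: "degree P = p"
      unfolding P_def diff_conv_add_uminus using p1 by (subst degree_add_eq_left) (auto simp: degree_monom_eq)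
    then have "P \<noteq> 0" using p1 by auto
    have roots: "{x. poly P x = 0} = {x. x ^ p = x}" by (simp add: P_def poly_monom)
    have fin: "finite {x :: 'a. x ^ p = x}" by simp
    have "of_nat n ^ p = (of_nat n :: 'a)" for n
      unfolding pc by (induction n) (use p1 pc in \<open>auto simp: freshmans_dream[OF pp] power_0_left\<close>)
    then have "of_nat ` {..<p} \<subseteq> {x :: 'a. x ^ p = x}" by auto
    moreover have "card {x :: 'a. x ^ p = x} \<le> card (of_nat ` {..<p} :: 'a set)"
      using card_poly_roots_bound[OF \<open>P \<noteq> 0\<close>] inj by (simp add: roots deg card_image)
    ultimately have "of_nat ` {..<p} = {x :: 'a. x ^ p = x}"
      using fin card_seteq by blast
    with that show ?thesis by blast
  qed
  \<comment> \<open>The representative of the trace among 0, ..., p - 1, used as an exponent of a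
    p-th root of unity. It is additive only modulo p, which \<open>cis_cong\<close> absorbs.\<close>
  define N where "N x = the_inv_into {..<p} (of_nat :: nat \<Rightarrow> 'a) (Tr x)" for x
  have N: "of_nat (N x) = Tr x" for x
    unfolding N_def using f_the_inv_into_f[OF inj] prime_field[OF Tr_p] by blast
  define \<theta> where "\<theta> x = cis (2 * pi * real (N x) / real p)" for x
  have cis_cong: "cis (2 * pi * real m / real p) = cis (2 * pi * real n / real p)" if "[m = n] (mod p)" for m n
  proof -
    have *: "cis (2 * pi * real m / real p) = cis (2 * pi * real (m mod p) / real p)" for m
    proof -
      have "real m = real p * real (m div p) + real (m mod p)"
        by (metis mult_div_mod_eq of_nat_add of_nat_mult)
      then have "2 * pi * real m / real p = 2 * pi * real (m div p) + 2 * pi * real (m mod p) / real p"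
        using p1 by (simp add: field_simps)
      then show ?thesis by (simp add: cis_mult[symmetric] cis_multiple_2pi)
    qed
    show ?thesis using that *[of m] *[of n] by (simp add: cong_def)
  qed
  have "additive_char \<theta> (of_nat CARD('a))"
  proof (unfold_locales, rule refl)
    fix x y
    have "of_nat (N (x + y)) = (of_nat (N x + N y) :: 'a)" by (simp add: N Tr_add)
    then have "[N (x + y) = N x + N y] (mod p)" by (simp only: of_nat_eq_iff_cong_CHAR pc)
    from cis_cong[OF this] show "\<theta> (x + y) = \<theta> x * \<theta> y"
      by (simp add: \<theta>_def cis_mult add_divide_distrib distrib_left)
  next
    have "Tr 0 = 0" using p1 by (auto simp: Tr_def power_0_left)
    then have "of_nat (N 0) = (of_nat 0 :: 'a)" by (simp add: N)
    then have "[N 0 = 0] (mod p)" by (simp only: of_nat_eq_iff_cong_CHAR pc)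
    from cis_cong[OF this] show "\<theta> 0 = 1" by (simp add: \<theta>_def)
  next
    \<comment> \<open>The trace is a nonzero polynomial of degree less than the size of the field,
      so it cannot vanish everywhere.\<close>
    define P :: "'a poly" where "P = (\<Sum>i<e. monom 1 (p ^ i))"
    have "coeff P (p ^ (e - 1)) = (\<Sum>i<e. if i = e - 1 then 1 else 0)"
      using p1 by (auto simp: P_def coeff_sum intro!: sum.cong)
    then have "coeff P (p ^ (e - 1)) \<noteq> 0" using e by simp
    then have "P \<noteq> 0" by auto
    have "degree P \<le> p ^ (e - 1)"
      unfolding P_def using p1 by (intro degree_sum_le) (auto simp: degree_monom_eq intro!: power_increasing)
    also have "p ^ (e - 1) < p ^ e" using p1 e by simp
    finally have "degree P < CARD('a)" by (simp add: card)
    then have "{x. poly P x = 0} \<noteq> UNIV"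
      using card_poly_roots_bound[OF \<open>P \<noteq> 0\<close>] by auto
    moreover have "poly P x = Tr x" for x by (simp add: P_def Tr_def poly_sum poly_monom)
    ultimately obtain x where x: "Tr x \<noteq> 0" by auto
    have "N x < p" unfolding N_def
      using the_inv_into_into[OF inj prime_field[OF Tr_p] subset_refl] by blast
    moreover have "N x \<noteq> 0" using x N[of x] by (metis of_nat_0)
    ultimately have r: "0 < real (N x) / real p" "real (N x) / real p < 1" by auto
    have "\<theta> x \<noteq> 1"
    proof
      assume "\<theta> x = 1"
      then have "cos (2 * pi * real (N x) / real p) = 1" by (simp add: \<theta>_def complex_eq_iff)
      then obtain n :: int where "2 * pi * real (N x) / real p = of_int n * 2 * pi"
        by (auto simp: cos_one_2pi_int)
      then have "2 * pi * (real (N x) / real p) = 2 * pi * of_int n" by (simp add: mult_ac)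
      then have "real (N x) / real p = of_int n" by (subst (asm) mult_cancel_left) simp
      with r have "0 < n" "n < 1" by auto
      then show False by simp
    qed
    then show "\<exists>x. \<theta> x \<noteq> 1" by blast
  qed
  then show ?thesis using that by blast
qed

section \<open>Gauss and Jacobi sums\<close>

definition gauss_sum :: "('a::{field,finite} \<Rightarrow> complex) \<Rightarrow> ('a \<Rightarrow> complex) \<Rightarrow> complex" where
  "gauss_sum \<theta> \<alpha> = (\<Sum>x\<in>UNIV. \<alpha> x * \<theta> x)"

definition jacobi_sum :: "('a::{field,finite} \<Rightarrow> complex) \<Rightarrow> ('a \<Rightarrow> complex) \<Rightarrow> complex" where
  "jacobi_sum \<alpha> \<beta> = (\<Sum>x\<in>UNIV. \<alpha> x * \<beta> (1 - x))"

context additive_char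
begin

abbreviation g :: "('a \<Rightarrow> complex) \<Rightarrow> complex" where
  "g \<equiv> gauss_sum \<theta>"

lemma q_neq_0: "q \<noteq> 0" and q_neq_1: "q - 1 \<noteq> 0"
  using card_field_ge_2[where 'a = 'a] by (auto simp: q_eq)

lemma sum_additive: "(\<Sum>x\<in>UNIV. \<theta> (a * x)) = (if a = 0 then q else 0)"
proof (cases "a = 0")
  case False
  obtain b where b: "\<theta> b \<noteq> 1" using nontrivial by blast
  have "(\<Sum>x\<in>UNIV. \<theta> (a * x)) = (\<Sum>x\<in>UNIV. \<theta> (a * (x + b / a)))"
    by (rule sum.reindex_bij_witness[of _ "\<lambda>x. x + b / a" "\<lambda>x. x - b / a"]) auto
  also have "\<dots> = \<theta> b * (\<Sum>x\<in>UNIV. \<theta> (a * x))"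
    using False by (simp add: distrib_left add sum_distrib_left mult.commute)
  finally have "(1 - \<theta> b) * (\<Sum>x\<in>UNIV. \<theta> (a * x)) = 0" by (simp add: algebra_simps)
  with b False show ?thesis by simp
qed (simp add: zero q_eq)

lemma gauss_trivial: "g trivial_char = -1"
proof -
  have "(\<Sum>x\<in>UNIV. \<theta> x) = \<theta> 0 + (\<Sum>x\<in>UNIV - {0}. \<theta> x)" by (simp add: sum.remove)
  also have "(\<Sum>x\<in>UNIV - {0}. \<theta> x) = g trivial_char"
    unfolding gauss_sum_def by (rule sum.mono_neutral_cong_left) (auto simp: trivial_char_def)
  finally show ?thesis using sum_additive[of 1] by (simp add: zero eq_neg_iff_add_eq_0 add.commute)
qed

lemma gauss_scale:
  assumes \<alpha>: "mult_char \<alpha>" and z: "z \<noteq> 0"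
  shows "(\<Sum>x\<in>UNIV. \<alpha> x * \<theta> (z * x)) = cnj (\<alpha> z) * g \<alpha>"
proof -
  have "(\<Sum>x\<in>UNIV. \<alpha> x * \<theta> (z * x)) = (\<Sum>x\<in>UNIV. \<alpha> (x / z) * \<theta> x)"
    by (rule sum.reindex_bij_witness[of _ "\<lambda>x. x / z" "\<lambda>x. z * x"]) (use z in auto)
  then show ?thesis
    by (simp add: gauss_sum_def mult_char_divide[OF \<alpha>] sum_distrib_left mult_ac)
qed

text \<open>Substituting x = u y turns the double sum into a sum over u of \<alpha>(u) times the sum
  of \<theta>((u + 1) y) over nonzero y. The inner sum is -1 except at u = -1, where it is q - 1.
  The factor \<open>trivial_char y\<close> encodes the restriction to nonzero y.\<close>

lemma gauss_mult_cnj: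
  assumes \<alpha>: "mult_char \<alpha>" "\<alpha> \<noteq> trivial_char"
  shows "g \<alpha> * g (\<lambda>x. cnj (\<alpha> x)) = \<alpha> (-1) * q"
proof -
  have inner: "cnj (\<alpha> y) * (\<Sum>x\<in>UNIV. \<alpha> x * \<theta> (x + y)) =
      (\<Sum>u\<in>UNIV. \<alpha> u * (trivial_char y * \<theta> ((u + 1) * y)))" for y
  proof (cases "y = 0")
    case True
    then show ?thesis by (simp add: mult_char_0[OF \<alpha>(1)] trivial_char_def)
  next
    case False
    have "(\<Sum>x\<in>UNIV. \<alpha> x * \<theta> (x + y)) = (\<Sum>u\<in>UNIV. \<alpha> (u * y) * \<theta> (u * y + y))"
      by (rule sum.reindex_bij_witness[of _ "\<lambda>u. u * y" "\<lambda>x. x / y"]) (use False in auto)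
    also have "\<dots> = \<alpha> y * (\<Sum>u\<in>UNIV. \<alpha> u * \<theta> ((u + 1) * y))"
      by (simp add: mult_char_mult[OF \<alpha>(1)] sum_distrib_left algebra_simps)
    finally show ?thesis
      using False mult_char_cnj_self[OF \<alpha>(1) False]
      by (simp add: trivial_char_def mult.assoc[symmetric] mult.commute[of "cnj _"])
  qed
  have triv: "(\<Sum>y\<in>UNIV. trivial_char y * \<theta> (a * y)) = (if a = 0 then q else 0) - 1" for a
  proof -
    have "(\<Sum>y\<in>UNIV. \<theta> (a * y)) = \<theta> (a * 0) + (\<Sum>y\<in>UNIV - {0}. \<theta> (a * y))"
      by (rule sum.remove) auto
    also have "(\<Sum>y\<in>UNIV - {0}. \<theta> (a * y)) = (\<Sum>y\<in>UNIV. trivial_char y * \<theta> (a * y))"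
      by (rule sum.mono_neutral_cong_left) (auto simp: trivial_char_def)
    finally show ?thesis by (simp add: sum_additive zero)
  qed
  have "g \<alpha> * g (\<lambda>x. cnj (\<alpha> x)) = (\<Sum>y\<in>UNIV. cnj (\<alpha> y) * (\<Sum>x\<in>UNIV. \<alpha> x * \<theta> (x + y)))"
    unfolding gauss_sum_def sum_product by (subst sum.swap) (simp add: sum_distrib_left add mult_ac)
  also have "\<dots> = (\<Sum>u\<in>UNIV. \<alpha> u * (\<Sum>y\<in>UNIV. trivial_char y * \<theta> ((u + 1) * y)))"
    unfolding inner by (subst sum.swap) (simp add: sum_distrib_left)
  also have "\<dots> = (\<Sum>u\<in>UNIV. (if u = -1 then \<alpha> u * q else 0) - \<alpha> u)"
    unfolding triv by (intro sum.cong) (auto simp: algebra_simps eq_neg_iff_add_eq_0)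
  also have "\<dots> = \<alpha> (-1) * q"
    by (simp add: sum_subtractf sum_mult_char[OF \<alpha>])
  finally show ?thesis .
qed

text \<open>The pairs (x, y) are grouped by s = x + y. For nonzero s the inner sum scales to a
  Jacobi sum; the last summand is the term s = 0, which survives only if \<alpha> and \<beta> are
  inverse to each other.\<close>

lemma gauss_mult:
  assumes \<alpha>: "mult_char \<alpha>" and \<beta>: "mult_char \<beta>"
  shows "g \<alpha> * g \<beta> = jacobi_sum \<alpha> \<beta> * g (\<lambda>x. \<alpha> x * \<beta> x) + \<beta> (-1) * (\<Sum>x\<in>UNIV. \<alpha> x * \<beta> x)"
proof -
  define K where "K s = (\<Sum>x\<in>UNIV. \<alpha> x * \<beta> (s - x))" for s
  have "g \<alpha> * g \<beta> = (\<Sum>x\<in>UNIV. \<Sum>y\<in>UNIV. \<alpha> x * \<beta> y * \<theta> (x + y))"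
    by (simp add: gauss_sum_def sum_product add mult_ac)
  also have "\<dots> = (\<Sum>x\<in>UNIV. \<Sum>s\<in>UNIV. \<alpha> x * \<beta> (s - x) * \<theta> s)"
  proof (rule sum.cong[OF refl])
    fix x
    show "(\<Sum>y\<in>UNIV. \<alpha> x * \<beta> y * \<theta> (x + y)) = (\<Sum>s\<in>UNIV. \<alpha> x * \<beta> (s - x) * \<theta> s)"
      by (rule sum.reindex_bij_witness[of _ "\<lambda>s. s - x" "\<lambda>y. x + y"]) auto
  qed
  also have "\<dots> = (\<Sum>s\<in>UNIV. K s * \<theta> s)"
    unfolding K_def by (subst sum.swap) (simp add: sum_distrib_right)
  also have "\<dots> = K 0 + (\<Sum>s\<in>UNIV - {0}. K s * \<theta> s)" by (simp add: sum.remove[of _ 0] zero)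
  also have "K s = jacobi_sum \<alpha> \<beta> * (\<alpha> s * \<beta> s)" if "s \<noteq> 0" for s
  proof -
    have "K s = (\<Sum>x\<in>UNIV. \<alpha> (s * x) * \<beta> (s - s * x))"
      unfolding K_def by (rule sum.reindex_bij_witness[of _ "\<lambda>x. s * x" "\<lambda>x. x / s"]) (use that in auto)
    also have "\<dots> = (\<Sum>x\<in>UNIV. \<alpha> (s * x) * \<beta> (s * (1 - x)))"
      by (simp add: right_diff_distrib)
    finally show ?thesis
      by (simp add: jacobi_sum_def mult_char_mult[OF \<alpha>] mult_char_mult[OF \<beta>] sum_distrib_left mult_ac)
  qed
  then have "(\<Sum>s\<in>UNIV - {0}. K s * \<theta> s) = (\<Sum>s\<in>UNIV - {0}. jacobi_sum \<alpha> \<beta> * (\<alpha> s * \<beta> s * \<theta> s))"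
    by (intro sum.cong) auto
  also have "\<dots> = jacobi_sum \<alpha> \<beta> * g (\<lambda>x. \<alpha> x * \<beta> x)"
    unfolding gauss_sum_def sum_distrib_left
    by (rule sum.mono_neutral_left) (auto simp: mult_char_0[OF \<alpha>])
  also have "K 0 = \<beta> (-1) * (\<Sum>x\<in>UNIV. \<alpha> x * \<beta> x)"
  proof -
    have "\<beta> (0 - x) = \<beta> (-1) * \<beta> x" for x
      unfolding mult_char_mult[OF \<beta>, symmetric] by simp
    then show ?thesis unfolding K_def by (simp only: sum_distrib_left mult_ac)
  qed
  finally show ?thesis by simp
qed

text \<open>Multiplying by the Gauss sum of the inverse character, rather than dividing by that of
  the product, gives one formula that also covers a trivial product; there the Jacobi sum is
  -\<alpha>(-1) and the extra Gauss sum is -1. All binomials can then be treated alike.\<close>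

lemma jacobi_gauss:
  assumes \<alpha>: "mult_char \<alpha>" and \<beta>: "mult_char \<beta>"
    and nontriv: "\<alpha> \<noteq> trivial_char \<or> \<beta> \<noteq> trivial_char"
  shows "q * jacobi_sum \<alpha> \<beta> = g \<alpha> * g \<beta> * (\<alpha> (-1) * \<beta> (-1)) * g (\<lambda>x. cnj (\<alpha> x * \<beta> x))"
proof (cases "(\<lambda>x. \<alpha> x * \<beta> x) = trivial_char")
  case False
  define c where "c = \<alpha> (-1) * \<beta> (-1)"
  have "g (\<lambda>x. \<alpha> x * \<beta> x) * g (\<lambda>x. cnj (\<alpha> x * \<beta> x)) = c * q" unfolding c_def
    using gauss_mult_cnj[OF mult_char_times[OF \<alpha> \<beta>] False] by simp
  moreover have "g \<alpha> * g \<beta> = jacobi_sum \<alpha> \<beta> * g (\<lambda>x. \<alpha> x * \<beta> x)"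
    using gauss_mult[OF \<alpha> \<beta>] sum_mult_char[OF mult_char_times[OF \<alpha> \<beta>] False] by simp
  moreover have "c * c = 1" unfolding c_def
    using mult_char_minus1_square[OF mult_char_times[OF \<alpha> \<beta>]] .
  ultimately have "g \<alpha> * g \<beta> * c * g (\<lambda>x. cnj (\<alpha> x * \<beta> x)) = q * jacobi_sum \<alpha> \<beta>"
    by (metis (no_types, lifting) mult.assoc mult.commute mult.left_neutral)
  then show ?thesis by (simp add: c_def)
next
  case True
  have \<beta>_eq: "\<beta> = (\<lambda>x. cnj (\<alpha> x))"
  proof
    fix x
    show "\<beta> x = cnj (\<alpha> x)"
    proof (cases "x = 0")
      case False
      have "\<alpha> x * \<beta> x = \<alpha> x * cnj (\<alpha> x)"
        using False fun_cong[OF True, of x] mult_char_cnj_self[OF \<alpha> False] by (simp add: trivial_char_def)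
      then show ?thesis using False by (simp add: mult_char_eq_0_iff[OF \<alpha>])
    qed (simp add: mult_char_0[OF \<alpha>] mult_char_0[OF \<beta>])
  qed
  have "\<alpha> \<noteq> trivial_char"
  proof
    assume "\<alpha> = trivial_char"
    moreover from this have "\<beta> = trivial_char" by (simp add: \<beta>_eq fun_eq_iff trivial_char_def)
    ultimately show False using nontriv by blast
  qed
  then have gg: "g \<alpha> * g \<beta> = \<alpha> (-1) * q" using gauss_mult_cnj[OF \<alpha>] \<beta>_eq by simp
  have "(\<lambda>x. cnj (\<alpha> x * \<beta> x)) = trivial_char"
    using True by (auto simp: fun_eq_iff trivial_char_def split: if_splits)
  moreover have "\<alpha> (-1) * \<beta> (-1) = 1" using fun_cong[OF True, of "-1"] by (simp add: trivial_char_def)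
  moreover have "\<beta> (-1) = \<alpha> (-1)" using mult_char_minus1_cnj[OF \<alpha>] \<beta>_eq by simp
  moreover have s: "(\<Sum>x\<in>UNIV. \<alpha> x * \<beta> x) = q - 1"
    using fun_cong[OF True] by (simp add: q_eq sum_trivial_char)
  then have "g \<alpha> * g \<beta> = - jacobi_sum \<alpha> \<beta> + \<beta> (-1) * (q - 1)"
    using gauss_mult[OF \<alpha> \<beta>] s by (simp add: True gauss_trivial)
  ultimately have "jacobi_sum \<alpha> \<beta> = - \<alpha> (-1)"
    using gg by (simp add: algebra_simps eq_neg_iff_add_eq_0)
  with gg show ?thesis
    using \<open>(\<lambda>x. cnj (\<alpha> x * \<beta> x)) = trivial_char\<close> \<open>\<alpha> (-1) * \<beta> (-1) = 1\<close> by (simp add: gauss_trivial)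
qed

end

section \<open>The dual group: finiteness, orthogonality, generators\<close>

lemma finite_mult_chars: "finite {\<alpha> :: 'a::{field,finite} \<Rightarrow> complex. mult_char \<alpha>}"
proof (rule finite_subset)
  let ?S = "{z :: complex. z ^ CARD('a) = z}"
  define P :: "complex poly" where "P = monom 1 CARD('a) - monom 1 1"
  have "coeff P 1 = -1" using card_field_ge_2[where 'a = 'a] by (simp add: P_def)
  then have "P \<noteq> 0" by auto
  then have "finite {z. poly P z = 0}" by (rule poly_roots_finite)
  then have "finite ?S" by (simp add: P_def poly_monom)
  then show "finite (PiE (UNIV :: 'a set) (\<lambda>_. ?S))" by (intro finite_PiE) auto
  show "{\<alpha> :: 'a \<Rightarrow> complex. mult_char \<alpha>} \<subseteq> PiE UNIV (\<lambda>_. ?S)"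
    by (auto simp: mult_char_power[symmetric] field_power_card)
qed

text \<open>A generator of the unit group is sent to a primitive root of unity of order q - 1. One
  faithful character suffices to separate points in the orthogonality relation over
  characters.\<close>

lemma faithful_mult_char_exists:
  obtains \<alpha> :: "'a::{field,finite} \<Rightarrow> complex"
  where "mult_char \<alpha>" "\<And>x. x \<noteq> 0 \<Longrightarrow> \<alpha> x = 1 \<Longrightarrow> x = 1"
proof -
  obtain \<gamma> :: 'a where \<gamma>: "\<gamma> \<noteq> 0" "\<And>x. x \<noteq> 0 \<Longrightarrow> \<exists>k. x = \<gamma> ^ k"
    using field_units_cyclic by blast
  define n where "n = CARD('a) - 1"
  have n: "n > 0" using card_field_ge_2[where 'a = 'a] by (simp add: n_def)
  \<comment> \<open>A nonzero remainder r would already satisfy \<open>\<gamma> ^ r = 1\<close>, and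
    the powers of \<gamma> would exhaust the n units with only r < n elements.\<close>
  have ord: "n dvd m" if "\<gamma> ^ m = 1" for m
  proof (rule ccontr)
    assume "\<not> n dvd m"
    define r where "r = m mod n"
    have r: "0 < r" "r < n" using \<open>\<not> n dvd m\<close> n by (auto simp: r_def dvd_eq_mod_eq_0)
    have "\<gamma> ^ m = (\<gamma> ^ n) ^ (m div n) * \<gamma> ^ r"
      by (simp add: r_def power_mult[symmetric] power_add[symmetric])
    then have "\<gamma> ^ r = 1" using that field_power_card_minus_1[OF \<gamma>(1)] by (simp add: n_def)
    have "x \<in> (\<lambda>k. \<gamma> ^ k) ` {..<r}" if x: "x \<noteq> 0" for x
    proof -
      obtain k where "x = \<gamma> ^ k" using \<gamma>(2)[OF x] by blast
      also have "\<gamma> ^ k = (\<gamma> ^ r) ^ (k div r) * \<gamma> ^ (k mod r)"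
        by (simp add: power_mult[symmetric] power_add[symmetric])
      finally show ?thesis using \<open>\<gamma> ^ r = 1\<close> r by auto
    qed
    then have "UNIV - {0} \<subseteq> (\<lambda>k. \<gamma> ^ k) ` {..<r}" by auto
    then have "n \<le> r"
      using card_mono[of "(\<lambda>k. \<gamma> ^ k) ` {..<r}" "UNIV - {0}"] card_image_le[of "{..<r}" "\<lambda>k. \<gamma> ^ k"]
      by (simp add: n_def card_Diff_subset)
    with r show False by simp
  qed
  define e where "e k = cis (2 * pi * real k / real n)" for k
  have e_add: "e (k + l) = e k * e l" for k l
    by (simp add: e_def cis_mult distrib_left add_divide_distrib)
  have e_1: "e k = 1 \<longleftrightarrow> n dvd k" for k
  proof
    assume "n dvd k"
    then obtain m where "k = n * m" by blast
    then have "2 * pi * real k / real n = 2 * pi * real m" using n by simp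
    then show "e k = 1" by (simp add: e_def cis_multiple_2pi)
  next
    assume "e k = 1"
    then have "cos (2 * pi * real k / real n) = 1" by (simp add: e_def complex_eq_iff)
    then obtain m :: int where "2 * pi * real k / real n = of_int m * 2 * pi"
      by (auto simp: cos_one_2pi_int)
    then have "2 * pi * (real k / real n) = 2 * pi * of_int m" by (simp add: mult_ac)
    then have "real k / real n = of_int m" by (subst (asm) mult_cancel_left) simp
    then have "real_of_int (int k) = real_of_int (m * int n)" using n by (simp add: field_simps)
    then have "int k = m * int n" by (simp only: of_int_eq_iff)
    then have "int n dvd int k" by simp
    then show "n dvd k" by simp
  qed
  \<comment> \<open>A discrete logarithm to the base \<gamma>. It is determined only modulo n, and
    \<open>e_cong\<close> shows that \<open>e\<close> does not see the difference.\<close>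
  define d where "d x = (SOME k. x = \<gamma> ^ k)" for x
  have d: "\<gamma> ^ d x = x" if "x \<noteq> 0" for x
    unfolding d_def using someI_ex[OF \<gamma>(2)[OF that]] by simp
  have e_cong: "e k = e l" if "\<gamma> ^ k = \<gamma> ^ l" for k l
  proof -
    have *: "e k = e l" if "\<gamma> ^ k = \<gamma> ^ l" "k \<le> l" for k l
    proof -
      have "\<gamma> ^ k * \<gamma> ^ (l - k) = \<gamma> ^ k * 1"
        unfolding power_add[symmetric] using that by simp
      then have "\<gamma> ^ (l - k) = 1" using \<gamma>(1) by simp
      then have "e (l - k) = 1" using ord e_1 by blast
      then show ?thesis using e_add[of k "l - k"] that by simp
    qed
    show ?thesis
      using *[OF that] *[OF that[symmetric]] by (metis nat_le_linear)
  qed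
  define \<alpha> where "\<alpha> x = (if x = 0 then 0 else e (d x))" for x
  show ?thesis
  proof
    have "e (d (x * y)) = e (d x) * e (d y)" if "x \<noteq> 0" "y \<noteq> 0" for x y
      unfolding e_add[symmetric] by (rule e_cong) (simp add: power_add d that)
    then show "mult_char \<alpha>" by (simp add: mult_char_def \<alpha>_def e_def)
    show "x = 1" if "x \<noteq> 0" "\<alpha> x = 1" for x
    proof -
      have "n dvd d x" using that by (simp add: \<alpha>_def e_1)
      then obtain m where "d x = n * m" by blast
      then have "x = (\<gamma> ^ n) ^ m" using d[OF that(1)] by (simp add: power_mult)
      then show ?thesis using field_power_card_minus_1[OF \<gamma>(1)] by (simp add: n_def)
    qed
  qed
qed

lemma sum_over_mult_chars_times:
  fixes \<beta> :: "'a::{field,finite} \<Rightarrow> complex"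
  assumes "mult_char \<beta>"
  shows "(\<Sum>\<alpha> | mult_char \<alpha>. F (\<lambda>x. \<alpha> x * \<beta> x)) = (\<Sum>\<alpha> | mult_char \<alpha>. F \<alpha>)"
proof (rule sum.reindex_bij_witness[of _ "\<lambda>\<alpha> x. \<alpha> x * cnj (\<beta> x)" "\<lambda>\<alpha> x. \<alpha> x * \<beta> x"])
  have *: "\<alpha> x * \<beta> x * cnj (\<beta> x) = \<alpha> x" "\<alpha> x * cnj (\<beta> x) * \<beta> x = \<alpha> x" if "mult_char \<alpha>" for \<alpha> and x :: 'a
    using mult_char_cnj_self[OF assms, of x] mult_char_0[OF that]
    by (cases "x = 0"; simp add: mult.assoc mult.commute[of "cnj _"])+
  fix \<alpha> :: "'a \<Rightarrow> complex" assume "\<alpha> \<in> {\<alpha>. mult_char \<alpha>}"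
  then show "(\<lambda>x. \<alpha> x * \<beta> x * cnj (\<beta> x)) = \<alpha>" "(\<lambda>x. \<alpha> x * cnj (\<beta> x) * \<beta> x) = \<alpha>"
    "(\<lambda>x. \<alpha> x * \<beta> x) \<in> {\<alpha>. mult_char \<alpha>}" "(\<lambda>x. \<alpha> x * cnj (\<beta> x)) \<in> {\<alpha>. mult_char \<alpha>}"
    using assms * by (auto intro!: mult_char_times mult_char_cnj)
qed simp_all

lemma sum_over_mult_chars_cnj:
  "(\<Sum>\<alpha> | mult_char \<alpha>. F (\<lambda>x. cnj (\<alpha> x))) = (\<Sum>\<alpha> | mult_char \<alpha>. F \<alpha>)"
  by (rule sum.reindex_bij_witness[of _ "\<lambda>\<alpha> x. cnj (\<alpha> x)" "\<lambda>\<alpha> x. cnj (\<alpha> x)"])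
     (auto simp: mult_char_cnj)

lemma sum_over_mult_chars:
  fixes x :: "'a::{field,finite}"
  shows "(\<Sum>\<alpha> | mult_char \<alpha>. \<alpha> x) = (if x = 1 then of_nat CARD('a) - 1 else 0)"
proof -
  obtain \<beta> :: "'a \<Rightarrow> complex" where \<beta>: "mult_char \<beta>" "\<And>x. x \<noteq> 0 \<Longrightarrow> \<beta> x = 1 \<Longrightarrow> x = 1"
    using faithful_mult_char_exists by blast
  have neq: "(\<Sum>\<alpha> | mult_char \<alpha>. \<alpha> x) = 0" if "x \<noteq> 1" for x :: 'a
  proof (cases "x = 0")
    case True
    then show ?thesis by (simp add: mult_char_0)
  next
    case False
    have "(\<Sum>\<alpha> | mult_char \<alpha>. \<alpha> x) = (\<Sum>\<alpha> | mult_char \<alpha>. \<alpha> x * \<beta> x)"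
      using sum_over_mult_chars_times[OF \<beta>(1), of "\<lambda>\<alpha>. \<alpha> x"] by simp
    then have "(1 - \<beta> x) * (\<Sum>\<alpha> | mult_char \<alpha>. \<alpha> x) = 0"
      by (simp add: sum_distrib_right[symmetric] algebra_simps)
    then show ?thesis using \<beta>(2) False that by auto
  qed
  \<comment> \<open>The value at 1 is the number of characters. It comes from evaluating the sum
    over all characters and all points in both orders: one order leaves only y = 1, the other only
    the trivial character.\<close>
  have "(\<Sum>y\<in>UNIV. \<Sum>\<alpha> | mult_char \<alpha>. \<alpha> (y :: 'a)) = (\<Sum>y\<in>{1 :: 'a}. \<Sum>\<alpha> | mult_char \<alpha>. \<alpha> y)"
    by (rule sum.mono_neutral_right) (auto simp: neq)
  then have "(\<Sum>\<alpha> | mult_char \<alpha>. \<alpha> (1 :: 'a)) = (\<Sum>\<alpha> | mult_char \<alpha>. \<Sum>y\<in>UNIV. \<alpha> (y :: 'a))"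
    by (subst sum.swap) simp
  also have "\<dots> = (\<Sum>\<alpha>\<in>{trivial_char}. \<Sum>y\<in>UNIV. \<alpha> (y :: 'a))"
    by (rule sum.mono_neutral_right) (auto simp: finite_mult_chars sum_mult_char)
  finally show ?thesis using neq by (simp add: sum_trivial_char)
qed

text \<open>Fourier inversion on the unit group: the Gauss sums are the Fourier coefficients of
  \<theta>.\<close>

lemma (in additive_char) additive_char_expansion:
  assumes u: "u \<noteq> 0"
  shows "(q - 1) * \<theta> u = (\<Sum>\<alpha> | mult_char \<alpha>. g (\<lambda>x. cnj (\<alpha> x)) * \<alpha> u)"
proof -
  have "(\<Sum>\<alpha> | mult_char \<alpha>. g (\<lambda>x. cnj (\<alpha> x)) * \<alpha> u) = (\<Sum>\<alpha> | mult_char \<alpha>. \<Sum>x\<in>UNIV. \<theta> x * \<alpha> (u / x))"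
    by (intro sum.cong) (auto simp: gauss_sum_def mult_char_divide sum_distrib_left mult_ac)
  also have "\<dots> = (\<Sum>x\<in>UNIV. \<theta> x * (\<Sum>\<alpha> | mult_char \<alpha>. \<alpha> (u / x)))"
    by (subst sum.swap) (simp add: sum_distrib_left)
  also have "\<dots> = (\<Sum>x\<in>UNIV. if x = u then (q - 1) * \<theta> u else 0)"
    using u by (intro sum.cong) (auto simp: sum_over_mult_chars q_eq)
  finally show ?thesis by simp
qed

lemma char_group_simps [simp]:
  "carrier char_group = {\<alpha>. mult_char \<alpha>}"
  "\<alpha> \<otimes>\<^bsub>char_group\<^esub> \<beta> = (\<lambda>x. \<alpha> x * \<beta> x)"
  "\<one>\<^bsub>char_group\<^esub> = trivial_char"
  by (simp_all add: char_group_def)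

lemma group_char_group: "group char_group"
proof (rule groupI)
  fix \<alpha> :: "'a \<Rightarrow> complex" assume "\<alpha> \<in> carrier char_group"
  then show "\<exists>\<beta>\<in>carrier char_group. \<beta> \<otimes>\<^bsub>char_group\<^esub> \<alpha> = \<one>\<^bsub>char_group\<^esub>"
    by (intro bexI[of _ "\<lambda>x. cnj (\<alpha> x)"])
       (auto simp: mult_char_cnj mult_char_times_cnj[symmetric] mult.commute)
qed (auto simp: mult_char_times mult_char_trivial_absorb mult.assoc mult.commute[of _ "trivial_char _"])

text \<open>The factor \<open>trivial_char x\<close> matters for k = 0, where
  \<open>\<alpha> 0 ^ 0\<close> would be 1.\<close>

lemma char_group_pow:
  assumes "mult_char \<alpha>"
  shows "\<alpha> [^]\<^bsub>char_group\<^esub> (k :: nat) = (\<lambda>x. trivial_char x * \<alpha> x ^ k)"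
proof -
  interpret group "char_group :: ('a \<Rightarrow> complex) monoid" by (rule group_char_group)
  show ?thesis
    using assms by (induction k) (auto simp: fun_eq_iff mult_ac)
qed

lemma char_generator_powers:
  assumes T: "char_generator T" and "mult_char \<alpha>"
  obtains k :: nat where "\<alpha> = (\<lambda>x. trivial_char x * T x ^ k)"
proof -
  interpret group "char_group :: ('a \<Rightarrow> complex) monoid" by (rule group_char_group)
  have T': "T \<in> carrier char_group" "mult_char T" using T by (simp_all add: char_generator_def)
  have "\<alpha> \<in> generate char_group {T}" using T assms(2) by (simp add: char_generator_def)
  also have "generate char_group {T} = {T [^]\<^bsub>char_group\<^esub> k | k :: nat. k \<in> UNIV}"
    by (rule generate_pow_on_finite_carrier[OF _ T'(1)]) (simp add: finite_mult_chars)
  finally show ?thesis using that T'(2) by (auto simp: char_group_pow)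
qed

text \<open>A faithful character is a power of T, so T cannot have a larger kernel.\<close>

lemma char_generator_faithful:
  assumes T: "char_generator T" and x: "x \<noteq> 0" "T x = 1"
  shows "x = 1"
proof -
  obtain \<alpha> :: "'a \<Rightarrow> complex" where \<alpha>: "mult_char \<alpha>" "\<And>x. x \<noteq> 0 \<Longrightarrow> \<alpha> x = 1 \<Longrightarrow> x = 1"
    using faithful_mult_char_exists by blast
  obtain k where "\<alpha> = (\<lambda>x. trivial_char x * T x ^ k)"
    using char_generator_powers[OF T \<alpha>(1)] .
  then have "\<alpha> x = 1" using x by (simp add: trivial_char_def)
  then show ?thesis using \<alpha>(2) x by blast
qed

section \<open>\<open>L\<close>-functions on the polynomial ring\<close>

definition monics :: "nat \<Rightarrow> 'a::field poly set" where
  "monics n = {f. degree f = n \<and> lead_coeff f = 1}"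

definition irreds :: "nat \<Rightarrow> 'a::field poly set" where
  "irreds d = {P \<in> monics d. irreducible P}"

lemma monics_iff: "f \<in> monics n \<longleftrightarrow> f \<noteq> 0 \<and> degree f = n \<and> lead_coeff f = 1"
  by (auto simp: monics_def)

lemma monics_mult: "f \<in> monics m \<Longrightarrow> h \<in> monics n \<Longrightarrow> f * h \<in> monics (m + n)"
  using lead_coeff_mult[of f h] by (auto simp: monics_iff degree_mult_eq)

lemma monics_power: "f \<in> monics m \<Longrightarrow> f ^ k \<in> monics (k * m)"
  using lead_coeff_power[of f k] by (auto simp: monics_iff degree_power_eq)

lemma monics_nonzero: "f \<in> monics n \<Longrightarrow> f \<noteq> 0"
  by (auto simp: monics_def)

lemma finite_polys_le: "finite {f :: 'a::{field,finite} poly. degree f \<le> n}"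
proof -
  have "inj_on coeffs {f :: 'a poly. degree f \<le> n}"
    by (rule inj_onI) (simp add: coeffs_eq_iff)
  moreover have "coeffs ` {f :: 'a poly. degree f \<le> n} \<subseteq> {xs. set xs \<subseteq> UNIV \<and> length xs \<le> Suc n}"
    by (auto simp: length_coeffs_degree) (metis length_coeffs_degree coeffs_eq_Nil le_SucI list.size(3) not_less_eq_eq zero_le)
  ultimately show ?thesis
    by (rule inj_on_finite) (rule finite_lists_length_le, simp)
qed

lemma finite_monics [simp]: "finite (monics n :: 'a::{field,finite} poly set)"
  by (rule finite_subset[OF _ finite_polys_le[of n]]) (auto simp: monics_def)

lemma finite_irreds [simp]: "finite (irreds n :: 'a::{field,finite} poly set)"
  by (simp add: irreds_def)

lemma monics_0: "monics 0 = {1 :: 'a::field poly}"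
  by (auto simp: monics_def one_pCons elim!: degree_eq_zeroE)

lemma monics_1: "monics 1 = range (\<lambda>c :: 'a::field. [:c, 1:])"
proof -
  have "f \<in> range (\<lambda>c. [:c, 1:])" if "f \<in> monics 1" for f :: "'a poly"
  proof -
    from that have "degree f = 1" by (simp add: monics_def)
    then obtain a b where "f = [:b, a:]" by (rule degree1_coeffs)
    with that show ?thesis by (auto simp: monics_def)
  qed
  then show ?thesis by (auto simp: monics_def)
qed

lemma irreds_degree: "P \<in> irreds d \<Longrightarrow> d \<ge> 1"
  by (auto simp: irreds_def monics_def irreducible_def is_unit_iff_degree)

lemma irreds_prime: "P \<in> irreds d \<Longrightarrow> prime_elem P"
  by (auto simp: irreds_def field_poly_irreducible_imp_prime)

lemma monics_dvd_eq:
  assumes "f \<in> monics m" "h \<in> monics n" "f dvd h" "n \<le> m"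
  shows "f = h"
proof -
  obtain k where k: "h = f * k" using assms(3) by blast
  with assms have "k \<noteq> 0" "degree k = 0" "lead_coeff k = 1"
    by (auto simp: monics_iff degree_mult_eq lead_coeff_mult)
  then have "k = 1" by (auto simp: one_pCons elim!: degree_eq_zeroE)
  with k show ?thesis by simp
qed

lemma irreds_dvd_eq:
  assumes "P \<in> irreds d" "Q \<in> irreds d'" "P dvd Q"
  shows "P = Q"
proof -
  obtain k where k: "Q = P * k" using assms(3) by blast
  have "\<not> is_unit P" using assms(1) by (auto simp: irreds_def irreducible_def)
  with k assms(2) have "is_unit k" by (auto simp: irreds_def dest: irreducibleD)
  moreover have "k \<noteq> 0" using k assms(2) by (auto simp: irreds_def)
  ultimately have "degree k = 0" using is_unit_iff_degree by blast
  with k have "degree Q \<le> degree P" by (metis add.right_neutral degree_mult_le)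
  with assms show ?thesis by (intro monics_dvd_eq[of P d Q d']) (auto simp: irreds_def monics_def)
qed

lemma monics_cofactor:
  assumes "f \<in> monics n" "h \<in> monics m" "f = h * k"
  shows "m \<le> n" "k \<in> monics (n - m)"
  using assms by (auto simp: monics_iff degree_mult_eq lead_coeff_mult)

lemma monics_irreducible_factor:
  assumes "f \<in> monics n" "n \<ge> 1"
  obtains P d where "P \<in> irreds d" "P dvd f"
  using assms
proof (induction n arbitrary: f thesis rule: less_induct)
  case (less n)
  show ?case
  proof (cases "irreducible f")
    case True
    with less.prems show ?thesis by (auto simp: irreds_def)
  next
    case False
    have f0: "f \<noteq> 0" using less.prems(2) by (rule monics_nonzero)
    moreover have "\<not> is_unit f" using less.prems f0 by (auto simp: monics_def is_unit_iff_degree)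
    ultimately obtain a b where ab: "f = a * b" "\<not> is_unit a" "\<not> is_unit b"
      using False by (auto simp: irreducible_def)
    define c where "c = lead_coeff a"
    have nz: "a \<noteq> 0" "b \<noteq> 0" using f0 ab(1) by auto
    then have c: "c \<noteq> 0" by (simp add: c_def)
    define a' where "a' = smult (inverse c) a"
    have "a' \<in> monics (degree a)" using c by (simp add: monics_def a'_def c_def)
    moreover have "degree a < n" "degree a \<ge> 1"
      using nz ab less.prems(2) by (auto simp: monics_iff degree_mult_eq is_unit_iff_degree)
    ultimately obtain P d where "P \<in> irreds d" "P dvd a'" using less.IH by metis
    moreover have "a' dvd f" using c ab(1) by (simp add: a'_def smult_dvd_iff)
    ultimately show ?thesis using less.prems(1) dvd_trans by blast
  qed
qed

section \<open>Prime power divisors and Newton's identities\<close>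

definition prime_power_divisors :: "'a::field poly \<Rightarrow> ('a poly \<times> nat) set" where
  "prime_power_divisors f = {(P, j). P \<in> irreds (degree P) \<and> j \<ge> 1 \<and> P ^ j dvd f}"

lemma irreds_self: "P \<in> irreds d \<Longrightarrow> P \<in> irreds (degree P) \<and> degree P = d"
  by (auto simp: irreds_def monics_def)

text \<open>One more factor P0 shifts the exponents at P0 by one and frees the exponent 1; powers of
  the other primes divide both polynomials or neither.\<close>

lemma prime_power_divisors_mult:
  fixes P0 :: "'a::field poly"
  assumes P0: "P0 \<in> irreds d"
  shows "prime_power_divisors (P0 * h) =
    insert (P0, 1) ((\<lambda>(P, j). (P, if P = P0 then Suc j else j)) ` prime_power_divisors h)"
    (is "?L = insert _ (?\<phi> ` ?A)")
proof (intro equalityI subsetI)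
  fix y assume "y \<in> ?L"
  then obtain P j where y: "y = (P, j)" and P: "P \<in> irreds (degree P)" "j \<ge> 1" "P ^ j dvd P0 * h"
    by (auto simp: prime_power_divisors_def)
  show "y \<in> insert (P0, 1) (?\<phi> ` ?A)"
  proof (cases "P = P0")
    case True
    obtain i where i: "j = Suc i" using P(2) by (cases j) auto
    have "P ^ i dvd h" using P(3) True P0 monics_nonzero[of P0 d] by (auto simp: i irreds_def)
    then have "i = 0 \<or> (P, i) \<in> ?A" using P(1) by (auto simp: prime_power_divisors_def)
    then consider "i = 0" | "(P, i) \<in> ?A" by blast
    then show ?thesis
    proof cases
      case 1
      then show ?thesis using True by (simp add: y i)
    next
      case 2
      then show ?thesis
        by (intro insertI2 image_eqI[of _ _ "(P, i)"]) (use True in \<open>simp_all add: y i\<close>)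
    qed
  next
    case False
    then have "\<not> P dvd P0" using irreds_dvd_eq[OF P(1) P0] by blast
    then have "P ^ j dvd h"
      using P(3) irreds_prime[OF P(1)]
    proof (induction j arbitrary: h)
      case (Suc j)
      have "P dvd P0 * h" using Suc.prems(2) dvd_mult_left[of P "P ^ j"] by simp
      then have "P dvd h" using Suc.prems(1,3) prime_elem_dvd_multD by blast
      then obtain k where k: "h = P * k" by blast
      have "P * P ^ j dvd P * (P0 * k)" using Suc.prems(2) by (simp add: k ac_simps)
      then have "P ^ j dvd P0 * k" using Suc.prems(3) by (auto simp: prime_elem_def)
      then have "P ^ j dvd k" using Suc.IH Suc.prems(1,3) by blast
      then show ?case by (simp add: k)
    qed simp
    then have "(P, j) \<in> ?A" using P by (auto simp: prime_power_divisors_def)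
    then show ?thesis
      by (intro insertI2 image_eqI[of _ _ "(P, j)"]) (use False in \<open>simp_all add: y\<close>)
  qed
next
  fix y assume "y \<in> insert (P0, 1) (?\<phi> ` ?A)"
  then consider "y = (P0, 1)" | P j where "y = ?\<phi> (P, j)" "(P, j) \<in> ?A" by fast
  then show "y \<in> ?L"
  proof cases
    case 1
    then show ?thesis using irreds_self[OF P0] P0 by (simp add: prime_power_divisors_def)
  next
    case 2
    then show ?thesis
      by (cases "P = P0") (simp_all add: prime_power_divisors_def mult_dvd_mono)
  qed
qed

text \<open>The polynomial analogue of writing the logarithm of an integer as a sum of von Mangoldt
  values over its divisors: each prime P is counted with weight deg P once for every power dividing
  f.\<close>

lemma degree_eq_sum_prime_power_divisors:
  fixes f :: "'a::field poly"
  assumes "f \<in> monics n"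
  shows "finite (prime_power_divisors f) \<and> (\<Sum>(P, j) \<in> prime_power_divisors f. degree P) = n"
  using assms
proof (induction n arbitrary: f rule: less_induct)
  case (less n)
  show ?case
  proof (cases "n = 0")
    case True
    then have "f = 1" using less.prems by (simp add: monics_0)
    then have "prime_power_divisors f = {}"
      by (auto simp: prime_power_divisors_def irreds_def is_unit_power_iff irreducible_def)
    then show ?thesis using True by simp
  next
    case False
    then obtain P0 d where P0: "P0 \<in> irreds d" "P0 dvd f"
      using monics_irreducible_factor less.prems by (metis One_nat_def Suc_leI gr0I)
    then obtain h where h: "f = P0 * h" by blast
    have d: "P0 \<in> monics d" "d \<ge> 1" using P0 irreds_degree by (auto simp: irreds_def)
    have hm: "d \<le> n" "h \<in> monics (n - d)" using monics_cofactor[OF less.prems d(1) h] by auto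
    define \<phi> where "\<phi> = (\<lambda>(P :: 'a poly, j). (P, if P = P0 then Suc j else j))"
    have IH: "finite (prime_power_divisors h)" "(\<Sum>(P, j) \<in> prime_power_divisors h. degree P) = n - d"
      using less.IH[OF _ hm(2)] d hm by auto
    have eq: "prime_power_divisors f = insert (P0, 1) (\<phi> ` prime_power_divisors h)"
      unfolding h \<phi>_def using prime_power_divisors_mult[OF P0(1)] by blast
    have inj: "inj_on \<phi> (prime_power_divisors h)"
      by (auto simp: inj_on_def \<phi>_def split: if_splits)
    have notin: "(P0, 1) \<notin> \<phi> ` prime_power_divisors h"
      by (auto simp: \<phi>_def prime_power_divisors_def split: if_splits)
    have "(\<Sum>(P, j) \<in> prime_power_divisors f. degree P)
        = degree P0 + (\<Sum>x \<in> prime_power_divisors h. degree (fst (\<phi> x)))"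
      unfolding eq using IH(1) notin by (simp add: sum.reindex[OF inj] case_prod_unfold)
    also have "(\<Sum>x \<in> prime_power_divisors h. degree (fst (\<phi> x))) = n - d"
      unfolding IH(2)[symmetric] by (simp add: \<phi>_def case_prod_unfold)
    finally show ?thesis using IH(1) hm(1) d by (simp add: eq monics_def)
  qed
qed

definition L_coeff :: "('a::field poly \<Rightarrow> complex) \<Rightarrow> nat \<Rightarrow> complex" where
  "L_coeff \<Lambda> n = (\<Sum>f \<in> monics n. \<Lambda> f)"

text \<open>The coefficient of degree k of u L'(u)/L(u), where L is the Euler product with factors
  1/(1 - \<Lambda>(P) u^(deg P)).\<close>

definition L_log :: "('a::field poly \<Rightarrow> complex) \<Rightarrow> nat \<Rightarrow> complex" where
  "L_log \<Lambda> k = (\<Sum>d | d dvd k. of_nat d * (\<Sum>P \<in> irreds d. \<Lambda> P ^ (k div d)))"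

lemma L_log_alt:
  fixes \<Lambda> :: "'a::{field,finite} poly \<Rightarrow> complex"
  assumes "k \<ge> 1"
  shows "L_log \<Lambda> k =
    (\<Sum>(P, j) \<in> {(P, j). P \<in> irreds (degree P) \<and> j * degree P = k}. of_nat (degree P) * \<Lambda> P ^ j)"
proof -
  have "L_log \<Lambda> k = (\<Sum>(d, P) \<in> (SIGMA d:{d. d dvd k}. irreds d). of_nat d * \<Lambda> P ^ (k div d))"
    unfolding L_log_def sum_distrib_left using assms by (intro sum.Sigma) auto
  also have "\<dots> = (\<Sum>(P, j) \<in> {(P, j). P \<in> irreds (degree P) \<and> j * degree P = k}. of_nat (degree P) * \<Lambda> P ^ j)"
  proof (rule sum.reindex_bij_witness[of _ "\<lambda>(P, j). (degree P, P)" "\<lambda>(d, P). (P, k div d)"], goal_cases)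
    case (1 x)
    then show ?case by (auto simp: irreds_def monics_def)
  next
    case (2 x)
    then show ?case by (auto simp: irreds_def monics_def)
  next
    case (3 x)
    then show ?case using assms by (auto simp: irreds_degree)
  next
    case (4 x)
    then show ?case using assms by auto
  next
    case (5 x)
    then show ?case by (auto simp: irreds_def monics_def)
  qed
  finally show ?thesis .
qed

text \<open>The coefficient form of u L' = L (u L'/L). Each monic f of degree n is weighted by n,
  the sum of deg P over the pairs (P, j) such that \<open>P ^ j\<close> divides f. After exchanging
  the sums, the cofactor of \<open>P ^ j\<close> runs over all monic polynomials of the remaining
  degree.\<close>

lemma L_coeff_Newton:
  fixes \<Lambda> :: "'a::{field,finite} poly \<Rightarrow> complex"
  assumes mult: "\<And>f h. \<Lambda> (f * h) = \<Lambda> f * \<Lambda> h" and one: "\<Lambda> 1 = 1"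
  shows "of_nat n * L_coeff \<Lambda> n = (\<Sum>k=1..n. L_log \<Lambda> k * L_coeff \<Lambda> (n - k))"
proof -
  have pow: "\<Lambda> (f ^ j) = \<Lambda> f ^ j" for f j by (induction j) (auto simp: mult one)
  \<comment> \<open>A finite index set that serves all f of degree n at once, so that the sums can
    be exchanged.\<close>
  define B :: "('a poly \<times> nat) set"
    where "B = {(P, j). P \<in> irreds (degree P) \<and> 1 \<le> j * degree P \<and> j * degree P \<le> n}"
  have sub: "prime_power_divisors f = {(P, j) \<in> B. P ^ j dvd f}" if "f \<in> monics n" for f
  proof -
    have "1 \<le> j * degree P \<and> j * degree P \<le> n"
      if P: "P \<in> irreds (degree P)" "P ^ j dvd f" "1 \<le> j" for P j
    proof -
      have "P ^ j \<in> monics (j * degree P)" using P(1) by (auto simp: irreds_def monics_power)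
      moreover obtain k where "f = P ^ j * k" using P(2) by blast
      ultimately show ?thesis
        using monics_cofactor(1)[OF \<open>f \<in> monics n\<close>] irreds_degree[OF P(1)] P(3) by auto
    qed
    then show ?thesis by (auto simp: prime_power_divisors_def B_def)
  qed
  have finB: "finite B"
  proof (rule finite_subset)
    show "B \<subseteq> (\<Union>d\<in>{..n}. irreds d) \<times> {..n}"
    proof
      fix x assume "x \<in> B"
      then obtain P j where x: "x = (P, j)" "P \<in> irreds (degree P)" "1 \<le> j * degree P" "j * degree P \<le> n"
        by (auto simp: B_def)
      then have "degree P \<noteq> 0" "j \<noteq> 0" by (metis mult_0_right mult_0 not_one_le_zero)+
      then have "degree P \<le> j * degree P" "j \<le> j * degree P" by simp_all
      then have "degree P \<le> n" "j \<le> n" using x(4) by linarith+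
      then show "x \<in> (\<Union>d\<in>{..n}. irreds d) \<times> {..n}" using x(1,2) by blast
    qed
  qed simp
  have "of_nat n * L_coeff \<Lambda> n = (\<Sum>f\<in>monics n. (\<Sum>(P, j) \<in> prime_power_divisors f. of_nat (degree P)) * \<Lambda> f)"
    unfolding L_coeff_def sum_distrib_left
  proof (rule sum.cong)
    fix f :: "'a poly" assume "f \<in> monics n"
    from degree_eq_sum_prime_power_divisors[OF this]
    have "(of_nat n :: complex) = of_nat (\<Sum>(P, j) \<in> prime_power_divisors f. degree P)" by simp
    then show "of_nat n * \<Lambda> f = (\<Sum>(P, j) \<in> prime_power_divisors f. of_nat (degree P)) * \<Lambda> f"
      by (simp add: case_prod_unfold)
  qed simp
  also have "\<dots> = (\<Sum>f\<in>monics n. \<Sum>(P, j) \<in> B. if P ^ j dvd f then of_nat (degree P) * \<Lambda> f else 0)"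
  proof (rule sum.cong)
    fix f :: "'a poly" assume f: "f \<in> monics n"
    show "(\<Sum>(P, j) \<in> prime_power_divisors f. of_nat (degree P)) * \<Lambda> f =
      (\<Sum>(P, j) \<in> B. if P ^ j dvd f then of_nat (degree P) * \<Lambda> f else 0)"
      unfolding sub[OF f] sum_distrib_right
      by (rule sum.mono_neutral_cong_left) (use finB in \<open>auto split: if_splits\<close>)
  qed simp
  also have "\<dots> = (\<Sum>(P, j) \<in> B. of_nat (degree P) * (\<Sum>f\<in>{f\<in>monics n. P ^ j dvd f}. \<Lambda> f))"
    unfolding case_prod_unfold
    by (subst sum.swap) (auto simp: sum_distrib_left sum.inter_filter intro!: sum.cong)
  also have "\<dots> = (\<Sum>(P, j) \<in> B. of_nat (degree P) * (\<Lambda> P ^ j * L_coeff \<Lambda> (n - j * degree P)))"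
  proof (rule sum.cong[OF refl], unfold split_paired_all prod.case)
    fix P j assume Pj: "(P, j) \<in> B"
    then have P: "P ^ j \<in> monics (j * degree P)" "j * degree P \<le> n"
      by (auto simp: B_def irreds_def monics_power)
    have nz: "P ^ j \<noteq> 0" using monics_nonzero[OF P(1)] .
    have "bij_betw ((*) (P ^ j)) (monics (n - j * degree P)) {f\<in>monics n. P ^ j dvd f}"
    proof (rule bij_betw_imageI)
      show "inj_on ((*) (P ^ j)) (monics (n - j * degree P))" using nz by (auto simp: inj_on_def)
      show "(*) (P ^ j) ` monics (n - j * degree P) = {f\<in>monics n. P ^ j dvd f}"
        using monics_mult[OF P(1)] P(2) monics_cofactor(2)[OF _ P(1)] by fastforce
    qed
    from sum.reindex_bij_betw[OF this, of \<Lambda>]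
    show "of_nat (degree P) * (\<Sum>f\<in>{f\<in>monics n. P ^ j dvd f}. \<Lambda> f) =
        of_nat (degree P) * (\<Lambda> P ^ j * L_coeff \<Lambda> (n - j * degree P))"
      by (simp add: mult pow L_coeff_def sum_distrib_left)
  qed
  also have "\<dots> = (\<Sum>k\<in>{1..n}. \<Sum>x\<in>{x\<in>B. snd x * degree (fst x) = k}.
      of_nat (degree (fst x)) * (\<Lambda> (fst x) ^ snd x * L_coeff \<Lambda> (n - snd x * degree (fst x))))"
    unfolding case_prod_unfold
    by (rule sum.group[symmetric]) (use finB in \<open>auto simp: B_def\<close>)
  also have "\<dots> = (\<Sum>k=1..n. L_log \<Lambda> k * L_coeff \<Lambda> (n - k))"
  proof (rule sum.cong)
    fix k assume k: "k \<in> {1..n}"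
    have "{x\<in>B. snd x * degree (fst x) = k} = {(P, j). P \<in> irreds (degree P) \<and> j * degree P = k}"
      using k by (auto simp: B_def)
    then show "(\<Sum>x\<in>{x\<in>B. snd x * degree (fst x) = k}.
      of_nat (degree (fst x)) * (\<Lambda> (fst x) ^ snd x * L_coeff \<Lambda> (n - snd x * degree (fst x))))
      = L_log \<Lambda> k * L_coeff \<Lambda> (n - k)"
      using k by (subst L_log_alt) (auto simp: sum_distrib_right case_prod_unfold intro!: sum.cong)
  qed simp
  finally show ?thesis .
qed

section \<open>The norm along the Kummer covering of degree 5\<close>

lemma irreds_1: "irreds 1 = monics 1"
proof (intro equalityI subsetI)
  fix f :: "'a::field poly" assume f: "f \<in> monics 1"
  then obtain P d where P: "P \<in> irreds d" "P dvd f"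
    using monics_irreducible_factor by blast
  have "P \<in> monics d" "1 \<le> d" using P irreds_degree by (auto simp: irreds_def)
  then have "P = f" using monics_dvd_eq[OF _ f P(2)] by blast
  then show "f \<in> irreds 1" using P f by (simp add: irreds_def)
qed (simp add: irreds_def)

lemma irreds_poly_0:
  assumes "P \<in> irreds d" "P \<noteq> [:0, 1:]"
  shows "poly P 0 \<noteq> 0"
proof
  assume "poly P 0 = 0"
  then have "[:0, 1:] dvd P" by (simp add: poly_eq_0_iff_dvd)
  moreover have "[:0, 1:] \<in> irreds 1" unfolding irreds_1 by (simp add: monics_def)
  ultimately show False using irreds_dvd_eq assms by metis
qed

locale fifth_root =
  fixes \<zeta> :: "'a::{field,finite}"
  assumes zeta5: "\<zeta> ^ 5 = 1" and zeta_neq_1: "\<zeta> \<noteq> 1"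
begin

lemma zeta_nonzero: "\<zeta> \<noteq> 0"
  using zeta5 by auto

lemma zeta_pow_mod: "\<zeta> ^ (m mod 5) = \<zeta> ^ m"
proof -
  have "\<zeta> ^ m = (\<zeta> ^ 5) ^ (m div 5) * \<zeta> ^ (m mod 5)"
    unfolding power_mult[symmetric] power_add[symmetric] by simp
  then show ?thesis by (simp add: zeta5)
qed

lemma zeta_pow_eq_1_iff: "\<zeta> ^ m = 1 \<longleftrightarrow> 5 dvd m"
proof
  assume "\<zeta> ^ m = 1"
  then have *: "\<zeta> ^ (m mod 5) = 1" by (simp add: zeta_pow_mod)
  \<comment> \<open>Each nonzero residue is inverted modulo 5 by hand: 2 * 3 = 6, and 4 is treated
    as -1.\<close>
  have "(\<zeta> ^ 2) ^ 3 = \<zeta>" "(\<zeta> ^ 3) ^ 2 = \<zeta>"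
    using zeta5 by (simp_all add: numeral_eq_Suc)
  then have "\<zeta> = 1" if "m mod 5 \<in> {1, 2, 3}"
    using that * by (elim insertE) (metis power_one power_one_right empty_iff)+
  moreover have "\<zeta> ^ 4 * \<zeta> = 1" using zeta5 by (simp add: numeral_eq_Suc mult_ac)
  then have "\<zeta> = 1" if "m mod 5 = 4" using that * by simp
  moreover have "m mod 5 = 0 \<or> m mod 5 = 1 \<or> m mod 5 = 2 \<or> m mod 5 = 3 \<or> m mod 5 = 4"
    by presburger
  ultimately show "5 dvd m" using zeta_neq_1 by auto
next
  assume "5 dvd m"
  then show "\<zeta> ^ m = 1" by (auto simp: power_mult zeta5)
qed

lemma zeta_pow_eq_iff: "\<zeta> ^ m = \<zeta> ^ n \<longleftrightarrow> m mod 5 = n mod 5"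
proof -
  have *: "\<zeta> ^ m = \<zeta> ^ n \<longleftrightarrow> m mod 5 = n mod 5" if "m \<le> n" for m n
  proof -
    have "\<zeta> ^ n = \<zeta> ^ m * \<zeta> ^ (n - m)" using that by (simp add: power_add[symmetric])
    then have "\<zeta> ^ m = \<zeta> ^ n \<longleftrightarrow> \<zeta> ^ (n - m) = 1" using zeta_nonzero by auto
    then show ?thesis using that by (auto simp: zeta_pow_eq_1_iff mod_eq_dvd_iff_nat[symmetric])
  qed
  show ?thesis using *[of m n] *[of n m] by (metis nat_le_linear)
qed

text \<open>The action on monic polynomials of the Galois group of the covering by fifth powers: the
  variable is scaled by a power of \<zeta>, and the result is made monic again.\<close>

definition twist :: "nat \<Rightarrow> 'a poly \<Rightarrow> 'a poly" where
  "twist i P = smult (inverse (\<zeta> ^ (i * degree P))) (pcompose P [:0, \<zeta> ^ i:])"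

lemma coeff_twist: "coeff (twist i P) n = inverse (\<zeta> ^ (i * degree P)) * (\<zeta> ^ (i * n) * coeff P n)"
  by (simp add: twist_def coeff_pcompose_linear power_mult)

lemma twist_monics: "P \<in> monics d \<Longrightarrow> twist i P \<in> monics d"
  using zeta_nonzero
  by (auto simp: monics_def coeff_twist) (simp_all add: twist_def degree_pcompose)

lemma poly_twist: "poly (twist i P) x = inverse (\<zeta> ^ (i * degree P)) * poly P (\<zeta> ^ i * x)"
  by (simp add: twist_def poly_pcompose mult.commute)

text \<open>Scaling the variable is an automorphism of the polynomial ring; factorisations are
  carried back by the inverse scaling.\<close>

lemma twist_irreds:
  assumes "P \<in> irreds d"
  shows "twist i P \<in> irreds d"
proof -
  let ?c = "\<zeta> ^ i"
  have c: "?c \<noteq> 0" using zeta_nonzero by simp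
  have P: "P \<in> monics d" "irreducible P" "degree P \<noteq> 0" "P \<noteq> 0"
    using assms irreds_degree[OF assms] by (auto simp: irreds_def monics_def)
  have inv: "pcompose (pcompose P [:0, ?c:]) [:0, inverse ?c:] = P"
    using c by (simp add: pcompose_assoc[symmetric] pcompose_pCons)
  have "irreducible (pcompose P [:0, ?c:])"
  proof (rule irreducibleI)
    show "pcompose P [:0, ?c:] \<noteq> 0" using inv P(4) by auto
    show "\<not> is_unit (pcompose P [:0, ?c:])" using c P(3,4)
      by (metis degree_pcompose degree_pCons_eq_if is_unit_iff_degree mult.right_neutral One_nat_def inv pcompose_0 pCons_eq_0_iff)
    fix a b assume "pcompose P [:0, ?c:] = a * b"
    then have *: "P = pcompose a [:0, inverse ?c:] * pcompose b [:0, inverse ?c:]"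
      using inv by (simp add: pcompose_mult)
    then have "is_unit (pcompose a [:0, inverse ?c:]) \<or> is_unit (pcompose b [:0, inverse ?c:])"
      using P(2) by (rule irreducibleD[rotated])
    moreover have "is_unit r" if "is_unit (pcompose r [:0, inverse ?c:])" for r
    proof -
      have "pcompose r [:0, inverse ?c:] \<noteq> 0" using that by auto
      then have "r \<noteq> 0" by auto
      moreover have "degree (pcompose r [:0, inverse ?c:]) = 0"
        using that \<open>pcompose r _ \<noteq> 0\<close> is_unit_iff_degree by blast
      moreover have "degree [:0, inverse ?c:] = 1" using c by simp
      ultimately show ?thesis by (simp add: degree_pcompose is_unit_iff_degree split: if_splits)
    qed
    ultimately show "is_unit a \<or> is_unit b" by blast
  qed
  then have "irreducible (twist i P)"
    using c irreducible_mult_unit_left[of "[:inverse (\<zeta> ^ (i * degree P)):]" "pcompose P [:0, ?c:]"] zeta_nonzero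
    by (simp add: twist_def is_unit_const_poly_iff dvd_field_iff)
  then show ?thesis using twist_monics[OF P(1)] by (simp add: irreds_def)
qed

text \<open>As \<open>degree P < 5\<close>, two equal twists force all coefficients of \<open>P\<close> but the leading one to vanish.\<close>

lemma twist_inj:
  assumes P: "P \<in> irreds d" "P \<noteq> [:0, 1:]" and d: "d < 5"
  shows "inj_on (\<lambda>i. twist i P) {..<5}"
proof (rule inj_onI, rule ccontr)
  fix i j :: nat
  assume ij: "i \<in> {..<5}" "j \<in> {..<5}" "twist i P = twist j P" "i \<noteq> j"
  have mP: "degree P = d" "lead_coeff P = 1" "P \<noteq> 0" using P(1) by (auto simp: irreds_def monics_def)
  have "coeff P n = 0" if "n < d" for n
  proof (rule ccontr)
    assume "coeff P n \<noteq> 0"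
    then have "\<zeta> ^ (j * d) * \<zeta> ^ (i * n) = \<zeta> ^ (i * d) * \<zeta> ^ (j * n)"
      using arg_cong[OF ij(3), of "\<lambda>p. coeff p n"] zeta_nonzero
      by (simp add: coeff_twist mP field_simps)
    then have eq: "(j * d + i * n) mod 5 = (i * d + j * n) mod 5"
      by (simp add: power_add[symmetric] zeta_pow_eq_iff)
    \<comment> \<open>The congruence says that 5 divides (j - i)(d - n), whose two factors both lie
      between 1 and 4. Here the bound on the degree enters.\<close>
    have *: False if H: "(j * d + i * n) mod 5 = (i * d + j * n) mod 5" "i < j" "j < 5" for i j
    proof -
      obtain a where a: "j = i + a" using H(2) less_imp_add_positive by blast
      obtain b where b: "d = n + b" using \<open>n < d\<close> less_imp_add_positive by blast
      have "j * d + i * n = (i * d + j * n) + (j - i) * (d - n)"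
        by (simp add: a b algebra_simps)
      then have "j * d + i * n - (i * d + j * n) = (j - i) * (d - n)" "i * d + j * n \<le> j * d + i * n"
        by simp_all
      then have "5 dvd (j - i) * (d - n)"
        using H(1) mod_eq_dvd_iff_nat by metis
      then have "5 dvd j - i \<or> 5 dvd d - n"
        using prime_dvd_mult_iff[of "5 :: nat"] by simp
      then show False using H(2,3) \<open>n < d\<close> d by (auto dest: dvd_imp_le)
    qed
    show False using *[of i j] *[of j i] eq ij by (cases "i < j") auto
  qed
  then have "P = monom 1 d"
    using mP by (intro poly_eqI) (metis coeff_eq_0 coeff_monom linorder_neqE_nat)
  then have "poly P 0 = 0" using irreds_degree[OF P(1)] by (cases d) (auto simp: poly_monom)
  then show False using irreds_poly_0[OF P] by contradiction
qed

lemma prime_elem_dvd_prodD: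
  fixes f :: "'b \<Rightarrow> 'c::comm_semiring_1"
  assumes "finite A" "prime_elem p" "p dvd prod f A"
  shows "\<exists>a\<in>A. p dvd f a"
  using assms(1,3)
proof (induction A)
  case empty
  then show ?case using assms(2) by (simp add: prime_elem_def)
next
  case (insert a A)
  then show ?case using assms(2) by (auto dest: prime_elem_dvd_multD)
qed

lemma prod_irreds_dvd:
  assumes "finite S" "S \<subseteq> irreds d" "\<And>P. P \<in> S \<Longrightarrow> P dvd h"
  shows "\<Prod>S dvd (h :: 'b::field poly)"
  using assms
proof (induction S)
  case (insert P S)
  then obtain k where k: "h = \<Prod>S * k" by auto
  have "\<not> P dvd \<Prod>S"
  proof
    assume "P dvd \<Prod>S"
    then obtain Q where "Q \<in> S" "P dvd Q"
      using prime_elem_dvd_prodD[OF insert.hyps(1), of P "\<lambda>x. x"] insert.prems(1) irreds_prime[of P d] by auto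
    then show False using insert.prems(1) insert.hyps(2) irreds_dvd_eq[of P d Q d] by auto
  qed
  then have "P dvd k"
    using insert.prems k irreds_prime[of P d] prime_elem_dvd_multD[of P "\<Prod>S" k] by auto
  then show ?case using insert.hyps k by (auto simp: mult.commute)
qed simp

text \<open>Scaling the variable by \<zeta> permutes the five twists cyclically, up to scalars with
  product 1. A polynomial that is invariant under this scaling has only exponents divisible by 5,
  hence is a polynomial in the fifth power of the variable.\<close>

lemma prod_twist_range:
  assumes P: "P \<in> monics d"
  shows "\<exists>Q \<in> monics d. pcompose Q (monom 1 5) = (\<Prod>i<5. twist i P)"
proof -
  define h where "h = (\<Prod>i<5. twist i P)"
  have dP: "degree P = d" using P by (simp add: monics_def)
  have h: "h \<in> monics (5 * d)"
  proof -
    have "(\<Prod>i<n. twist i P) \<in> monics (n * d)" for n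
      by (induction n) (use twist_monics[OF P] in \<open>auto simp: monics_0 mult.commute add.commute intro: monics_mult\<close>)
    then show ?thesis by (simp add: h_def)
  qed
  have step: "pcompose (twist i P) [:0, \<zeta>:] = smult (\<zeta> ^ d) (twist (Suc i) P)" for i
    using zeta_nonzero
    by (intro poly_eqI) (simp add: coeff_pcompose_linear coeff_twist dP power_add field_simps)
  have "pcompose h [:0, \<zeta>:] = (\<Prod>i<5. smult (\<zeta> ^ d) (twist (Suc i) P))"
    by (simp add: h_def pcompose_prod step)
  also have "\<dots> = smult ((\<zeta> ^ d) ^ 5) (\<Prod>i<5. twist (Suc i) P)"
    by (simp add: prod_smult)
  also have "(\<zeta> ^ d) ^ 5 = 1" by (simp add: power_mult[symmetric] zeta_pow_eq_1_iff)
  also have "twist 5 P = twist 0 P"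
    by (intro poly_eqI) (simp add: coeff_twist power_mult zeta5)
  then have "(\<Prod>i<5. twist (Suc i) P) = h"
    by (simp add: h_def numeral_eq_Suc lessThan_Suc mult_ac)
  finally have inv: "pcompose h [:0, \<zeta>:] = h" by simp
  have zero: "coeff h n = 0" if "\<not> 5 dvd n" for n
  proof -
    have "\<zeta> ^ n * coeff h n = coeff h n"
      using arg_cong[OF inv, of "\<lambda>p. coeff p n"] by (simp add: coeff_pcompose_linear)
    then show ?thesis using that by (simp add: zeta_pow_eq_1_iff)
  qed
  define Q where "Q = (\<Sum>k\<le>d. monom (coeff h (5 * k)) k)"
  have cQ: "coeff Q k = (if k \<le> d then coeff h (5 * k) else 0)" for k
    by (simp add: Q_def coeff_sum)
  have "h = (\<Sum>n\<le>5 * d. monom (coeff h n) n)"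
    using h by (intro poly_as_sum_of_monoms'[symmetric]) (simp add: monics_def)
  also have "\<dots> = (\<Sum>n\<in>(*) 5 ` {..d}. monom (coeff h n) n)"
  proof (rule sum.mono_neutral_right)
    show "\<forall>i\<in>{..5 * d} - (*) 5 ` {..d}. monom (coeff h i) i = 0"
    proof
      fix i assume "i \<in> {..5 * d} - (*) 5 ` {..d}"
      then have "\<not> 5 dvd i" by (force elim!: dvdE)
      then show "monom (coeff h i) i = 0" by (simp add: zero)
    qed
  qed auto
  also have "\<dots> = (\<Sum>k\<le>d. monom (coeff h (5 * k)) (5 * k))"
    by (subst sum.reindex) (auto simp: inj_on_def)
  also have "\<dots> = pcompose Q (monom 1 5)"
  proof -
    have "pcompose (monom c k) (monom 1 5) = monom c (5 * k)" for c :: 'a and k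
    proof -
      have "pcompose (monom c k) (monom 1 5) = smult c (monom 1 5 ^ k)"
        by (induction k) (simp_all add: monom_0 monom_Suc pcompose_pCons)
      then show ?thesis by (simp add: monom_power smult_monom)
    qed
    then show ?thesis by (simp add: Q_def pcompose_sum)
  qed
  finally have eq: "pcompose Q (monom 1 5) = h" ..
  have "coeff Q d = 1" using h unfolding monics_def cQ by force
  moreover have "degree Q \<le> d" by (rule degree_le) (simp add: cQ)
  ultimately have "Q \<in> monics d" by (metis (mono_tags, lifting) le_antisym le_degree monics_def mem_Collect_eq zero_neq_one)
  then show ?thesis using eq h_def by blast
qed

text \<open>The norm from the polynomials in x down to the polynomials in u = x^5, normalised to be
  monic.\<close>

definition kummer_norm :: "'a poly \<Rightarrow> 'a poly" where
  "kummer_norm P = (SOME Q. Q \<in> monics (degree P) \<and> pcompose Q (monom 1 5) = (\<Prod>i<5. twist i P))"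

lemma kummer_norm:
  assumes "P \<in> monics d"
  shows "kummer_norm P \<in> monics d" "pcompose (kummer_norm P) (monom 1 5) = (\<Prod>i<5. twist i P)"
proof -
  have "degree P = d" using assms by (simp add: monics_def)
  then show "kummer_norm P \<in> monics d" "pcompose (kummer_norm P) (monom 1 5) = (\<Prod>i<5. twist i P)"
    using someI_ex[OF prod_twist_range[OF assms, unfolded Bex_def]] by (simp_all add: kummer_norm_def)
qed

text \<open>The normalising factors multiply to a power of \<zeta> with exponent divisible by 0 + 1
  + 2 + 3 + 4 = 10, which is 1. The constant term of a norm is thus a fifth power, the condition by
  which norms are recognised later.\<close>

lemma poly_kummer_norm_0:
  assumes "P \<in> monics d"
  shows "poly (kummer_norm P) 0 = poly P 0 ^ 5"
proof -
  have "poly (kummer_norm P) 0 = (\<Prod>i<5. inverse (\<zeta> ^ (i * d))) * poly P 0 ^ 5"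
    using arg_cong[OF kummer_norm(2)[OF assms], of "\<lambda>p. poly p 0"] assms
    by (simp add: poly_pcompose poly_monom poly_prod poly_twist prod.distrib monics_def)
  also have "(\<Prod>i<5. inverse (\<zeta> ^ (i * d))) = inverse (\<zeta> ^ (10 * d))"
    by (simp add: numeral_eq_Suc lessThan_Suc power_add)
  finally show ?thesis by (simp add: zeta_pow_eq_1_iff)
qed

text \<open>The fibre of the covering over u = 1 consists of the fifth roots of unity. The
  normalising factors again multiply to 1.\<close>

lemma poly_kummer_norm_1:
  assumes "P \<in> monics d"
  shows "poly (kummer_norm P) 1 = (\<Prod>i<5. poly P (\<zeta> ^ i))"
proof -
  have "poly (kummer_norm P) 1 = (\<Prod>i<5. inverse (\<zeta> ^ (i * d))) * (\<Prod>i<5. poly P (\<zeta> ^ i))"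
    using arg_cong[OF kummer_norm(2)[OF assms], of "\<lambda>p. poly p 1"] assms
    by (simp add: poly_pcompose poly_monom poly_prod poly_twist prod.distrib monics_def)
  also have "(\<Prod>i<5. inverse (\<zeta> ^ (i * d))) = inverse (\<zeta> ^ (10 * d))"
    by (simp add: numeral_eq_Suc lessThan_Suc power_add)
  finally show ?thesis by (simp add: zeta_pow_eq_1_iff)
qed

text \<open>If P divides A(x^5), then so do all its twists, since A(x^5) is unchanged by scaling x
  with powers of \<zeta>. They are five distinct primes, so their product divides A(x^5), which
  forces A to have at least degree d. Hence one factor in any factorisation of the norm has full
  degree. The prime x is ramified and excluded, as its twists coincide.\<close>

lemma kummer_norm_irreds:
  assumes P: "P \<in> irreds d" "P \<noteq> [:0, 1:]" and d: "d < 5"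
  shows "kummer_norm P \<in> irreds d"
proof -
  have Pm: "P \<in> monics d" using P by (simp add: irreds_def)
  note N = kummer_norm[OF Pm]
  have d1: "d \<ge> 1" using irreds_degree P by blast
  have big: "degree A = d" if A: "A dvd kummer_norm P" "P dvd pcompose A (monom 1 5)" for A
  proof -
    have A0: "A \<noteq> 0" using A(1) monics_nonzero[OF N(1)] by auto
    have tw: "twist i P dvd pcompose A (monom 1 5)" for i
    proof -
      obtain k where k: "pcompose A (monom 1 5) = P * k" using A(2) by blast
      have "pcompose (pcompose A (monom 1 5)) [:0, \<zeta> ^ i:] = pcompose A (monom 1 5)"
      proof -
        have "pcompose (monom 1 5) [:0, \<zeta> ^ i:] = monom 1 5"
          by (intro poly_eqI) (simp add: coeff_pcompose_linear power_mult[symmetric] zeta_pow_eq_1_iff)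
        then show ?thesis by (simp add: pcompose_assoc[symmetric])
      qed
      then have "pcompose A (monom 1 5) = pcompose P [:0, \<zeta> ^ i:] * pcompose k [:0, \<zeta> ^ i:]"
        by (simp add: k pcompose_mult)
      then have "pcompose P [:0, \<zeta> ^ i:] dvd pcompose A (monom 1 5)" by simp
      then show ?thesis using zeta_nonzero by (simp add: twist_def smult_dvd_iff)
    qed
    have "\<Prod>((\<lambda>i. twist i P) ` {..<5}) dvd pcompose A (monom 1 5)"
      by (rule prod_irreds_dvd) (use tw twist_irreds[OF P(1)] in auto)
    then have "(\<Prod>i<5. twist i P) dvd pcompose A (monom 1 5)"
      using prod.reindex[OF twist_inj[OF P d], of id] by simp
    then have "pcompose (kummer_norm P) (monom 1 5) dvd pcompose A (monom 1 5)" by (simp add: N(2))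
    moreover have "pcompose A (monom 1 5) \<noteq> 0"
      using A0 by (simp add: pcompose_eq_0_iff degree_monom_eq)
    ultimately have "degree (pcompose (kummer_norm P) (monom 1 5)) \<le> degree (pcompose A (monom 1 5))"
      by (rule dvd_imp_degree_le)
    then have "d \<le> degree A" using N(1) by (simp add: degree_pcompose degree_monom_eq monics_def)
    moreover have "degree A \<le> d"
      using dvd_imp_degree_le[OF A(1) monics_nonzero[OF N(1)]] N(1) by (simp add: monics_def)
    ultimately show ?thesis by simp
  qed
  have "irreducible (kummer_norm P)"
  proof (rule irreducibleI)
    show "kummer_norm P \<noteq> 0" using monics_nonzero[OF N(1)] .
    show "\<not> is_unit (kummer_norm P)"
      using N(1) d1 monics_nonzero[OF N(1)] by (simp add: is_unit_iff_degree monics_def)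
    fix A B assume AB: "kummer_norm P = A * B"
    then have nz: "A \<noteq> 0" "B \<noteq> 0" using monics_nonzero[OF N(1)] by auto
    have deg: "degree A + degree B = d" using AB nz N(1) by (simp add: monics_def degree_mult_eq)
    have "twist 0 P = P" by (simp add: twist_def)
    then have "P dvd (\<Prod>i<5. twist i P)" by (metis dvd_prodI finite_lessThan lessThan_iff zero_less_numeral)
    then have "P dvd pcompose A (monom 1 5) * pcompose B (monom 1 5)"
      by (simp add: N(2)[symmetric] AB pcompose_mult)
    then have "P dvd pcompose A (monom 1 5) \<or> P dvd pcompose B (monom 1 5)"
      using irreds_prime[OF P(1)] prime_elem_dvd_mult_iff by blast
    then have "degree A = d \<or> degree B = d" using big AB by (metis dvd_triv_left dvd_triv_right)
    then show "is_unit A \<or> is_unit B" using deg nz by (auto simp: is_unit_iff_degree)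
  qed
  then show ?thesis using N(1) by (simp add: irreds_def)
qed

text \<open>P' divides the product of its own twists, which is the product of the twists of P; being
  prime it divides one of them, and both are monic of the same degree.\<close>

lemma kummer_norm_fibre:
  assumes P: "P \<in> irreds d" and P': "P' \<in> irreds d" and eq: "kummer_norm P' = kummer_norm P"
  shows "P' \<in> (\<lambda>i. twist i P) ` {..<5}"
proof -
  have m: "P \<in> monics d" "P' \<in> monics d" using P P' by (auto simp: irreds_def)
  have "twist 0 P' = P'" by (simp add: twist_def)
  then have "P' dvd (\<Prod>i<5. twist i P')" by (metis dvd_prodI finite_lessThan lessThan_iff zero_less_numeral)
  also have "\<dots> = (\<Prod>i<5. twist i P)" using kummer_norm(2)[OF m(1)] kummer_norm(2)[OF m(2)] eq by simp
  finally obtain i where "i < 5" "P' dvd twist i P"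
    using prime_elem_dvd_prodD[OF _ irreds_prime[OF P'], of "{..<5}"] by auto
  then show ?thesis
    using monics_dvd_eq[OF m(2) twist_monics[OF m(1)]] by auto
qed

end

section \<open>The product of the Jacobi sums\<close>

text \<open>The kernel condition expresses that \<psi> has order 5 in the form that is used: fifth
  powers give \<open>psi5\<close>, and the converse detects which elements are fifth powers.\<close>

locale quintic_char = fifth_root \<zeta> for \<zeta> :: "'a::{field,finite}" +
  fixes \<psi> :: "'a \<Rightarrow> complex"
  assumes psi: "mult_char \<psi>"
    and psi_nontrivial: "\<psi> \<noteq> trivial_char"
    and psi_eq_1_iff: "x \<noteq> 0 \<Longrightarrow> \<psi> x = 1 \<longleftrightarrow> (\<exists>y. x = y ^ 5)"
begin

lemma psi5: "x \<noteq> 0 \<Longrightarrow> \<psi> x ^ 5 = 1"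
  using psi_eq_1_iff[of "x ^ 5"] by (auto simp: mult_char_power[OF psi])

lemma psi_pow_mod: "x \<noteq> 0 \<Longrightarrow> \<psi> x ^ (m mod 5) = \<psi> x ^ m"
proof -
  assume x: "x \<noteq> 0"
  have "\<psi> x ^ m = (\<psi> x ^ 5) ^ (m div 5) * \<psi> x ^ (m mod 5)"
    unfolding power_mult[symmetric] power_add[symmetric] by simp
  then show ?thesis by (simp add: psi5 x)
qed

lemma psi_pow_eq_1:
  assumes "x \<noteq> 0" "\<not> 5 dvd m" "\<psi> x ^ m = 1"
  shows "\<psi> x = 1"
proof -
  have "\<psi> x ^ gcd m 5 = 1"
  proof -
    have "m \<noteq> 0" using assms(2) by (intro notI) simp
    then obtain a b where "m * a = 5 * b + gcd m 5" using bezout_nat[of m 5] by blast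
    then have "(\<psi> x ^ m) ^ a = (\<psi> x ^ 5) ^ b * \<psi> x ^ gcd m 5"
      unfolding power_mult[symmetric] power_add[symmetric] by simp
    then show ?thesis using assms by (simp add: psi5)
  qed
  moreover have "gcd m 5 = 1"
    using assms(2) prime_imp_coprime[of "5 :: nat" m] by (simp add: coprime_iff_gcd_eq_1 gcd.commute)
  ultimately show ?thesis by simp
qed

lemma mult_char_psi_pow: "i > 0 \<Longrightarrow> mult_char (\<lambda>x. \<psi> x ^ i)"
  using psi by (auto simp: mult_char_def power_mult_distrib)

lemma psi_pow_nontrivial: "\<not> 5 dvd i \<Longrightarrow> (\<lambda>x. \<psi> x ^ i) \<noteq> trivial_char"
proof
  assume i: "\<not> 5 dvd i" and eq: "(\<lambda>x. \<psi> x ^ i) = trivial_char"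
  have "\<psi> x = trivial_char x" for x
    using fun_cong[OF eq, of x] psi_pow_eq_1[OF _ i, of x] mult_char_0[OF psi]
    by (cases "x = 0") (auto simp: trivial_char_def)
  then show False using psi_nontrivial by blast
qed

lemma sum_psi_pow: "\<not> 5 dvd i \<Longrightarrow> (\<Sum>x\<in>UNIV. \<psi> x ^ i) = 0"
  by (rule sum_mult_char[OF mult_char_psi_pow psi_pow_nontrivial]) (auto intro!: Nat.gr0I)

text \<open>The value at \<open>x = 0\<close> is \<open>0 ^ 0 = 1\<close>.\<close>

lemma sum_psi_powers:
  assumes "\<not> 5 dvd j"
  shows "(\<Sum>i<5. \<psi> x ^ (i * j)) = (if x = 0 then 1 else if \<psi> x = 1 then 5 else 0)"
proof (cases "x = 0")
  case True
  have "j > 0" using assms by (auto intro!: Nat.gr0I)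
  then have "\<psi> x ^ (i * j) = (if i = 0 then 1 else 0)" for i
    using True by (simp add: mult_char_0[OF psi])
  then show ?thesis using True by simp
next
  case False
  show ?thesis
  proof (cases "\<psi> x = 1")
    case True
    then show ?thesis using False by simp
  next
    case neq: False
    let ?w = "\<psi> x ^ j"
    have w: "?w \<noteq> 1" using psi_pow_eq_1[OF False assms] neq by blast
    have "?w ^ 5 = 1" using psi5[OF False] by (metis mult.commute power_mult power_one)
    then have "(\<Sum>i<5. ?w ^ i) = 0" using w by (simp add: geometric_sum)
    then show ?thesis using False neq by (simp add: power_mult[symmetric] mult.commute)
  qed
qed

end

text \<open>The bound n on all fibres and the total count together force every fibre over I' to have
  exactly n elements. Surjectivity of N never has to be shown directly.\<close>

lemma sum_fibres:
  fixes F :: "'b \<Rightarrow> complex"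
  assumes fin: "finite I" "finite I'" and N: "\<And>x. x \<in> I \<Longrightarrow> N x \<in> I'"
    and le: "\<And>y. card {x \<in> I. N x = y} \<le> n" and card: "card I = n * card I'"
  shows "(\<Sum>x\<in>I. F (N x)) = of_nat n * (\<Sum>y\<in>I'. F y)"
proof -
  have "card I = (\<Sum>y\<in>I'. card {x \<in> I. N x = y})"
    unfolding card_eq_sum using fin N by (subst sum.group) auto
  then have "(\<Sum>y\<in>I'. n - card {x \<in> I. N x = y}) = 0"
    using le card by (subst sum_subtractf_nat) (auto simp: mult.commute)
  then have fibre: "card {x \<in> I. N x = y} = n" if "y \<in> I'" for y
    using that le[of y] fin(2) by (simp add: order_antisym)
  have "(\<Sum>x\<in>I. F (N x)) = (\<Sum>y\<in>I'. \<Sum>x\<in>{x \<in> I. N x = y}. F (N x))"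
    using fin N by (subst sum.group) auto
  also have "\<dots> = (\<Sum>y\<in>I'. of_nat n * F y)" by (intro sum.cong) (simp_all add: fibre)
  finally show ?thesis by (simp add: sum_distrib_left)
qed

text \<open>Adding a multiple of p permutes the monic polynomials of degree d, so the sum may be
  averaged over all multiples.\<close>

lemma sum_monics_eq_0:
  fixes p :: "'a::{field,finite} poly"
  assumes "degree p < d" and "\<And>f. (\<Sum>c\<in>UNIV. F (f + smult c p)) = (0 :: complex)"
  shows "(\<Sum>f\<in>monics d. F f) = 0"
proof -
  have shift: "(\<Sum>f\<in>monics d. F f) = (\<Sum>f\<in>monics d. F (f + smult c p))" for c
  proof (rule sum.reindex_bij_witness[of _ "\<lambda>f. f + smult c p" "\<lambda>f. f - smult c p"])
    have deg: "degree (smult c p) < d" for c using assms(1) degree_smult_le le_less_trans by blast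
    fix f :: "'a poly" assume "f \<in> monics d"
    then have f: "degree f = d" "coeff f d = 1" by (auto simp: monics_def)
    show "f + smult c p \<in> monics d" "f - smult c p \<in> monics d"
      using f deg[of c] deg[of "-c"] coeff_eq_0[OF deg[of c]]
      by (simp_all add: monics_def degree_add_eq_left diff_conv_add_uminus del: add_uminus_conv_diff)
  qed auto
  have "of_nat CARD('a) * (\<Sum>f\<in>monics d. F f) = (\<Sum>c\<in>(UNIV :: 'a set). \<Sum>f\<in>monics d. F f)"
    by simp
  also have "\<dots> = (\<Sum>c\<in>UNIV. \<Sum>f\<in>monics d. F (f + smult c p))"
    by (intro sum.cong refl shift)
  also have "\<dots> = 0" by (subst sum.swap) (simp add: assms(2))
  finally show ?thesis by simp
qed

context quintic_char
begin

text \<open>The L-function of f \<mapsto> \<psi>(f(0))^i is 1, because shifting f by constants kills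
  every positive degree. So its logarithmic coefficients vanish. In the one of degree d, the proper
  divisors of d contribute 0 by induction, since their exponents stay prime to 5 as long as d < 5;
  the primes of degree d remain.\<close>

lemma sum_irreds_psi_eq_0:
  assumes "\<not> 5 dvd i" "1 \<le> d" "d < 5"
  shows "(\<Sum>P\<in>irreds d. \<psi> (poly P 0) ^ i) = 0"
  using assms
proof (induction d arbitrary: i rule: less_induct)
  case (less d)
  define \<Lambda> where "\<Lambda> f = \<psi> (poly f 0) ^ i" for f
  have "L_coeff \<Lambda> n = 0" if "n \<ge> 1" for n
    unfolding L_coeff_def
  proof (rule sum_monics_eq_0[of 1])
    fix f :: "'a poly"
    have "(\<Sum>c\<in>UNIV. \<Lambda> (f + smult c 1)) = (\<Sum>c\<in>UNIV. \<psi> c ^ i)"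
      by (rule sum.reindex_bij_witness[of _ "\<lambda>c. c - poly f 0" "\<lambda>c. poly f 0 + c"]) (auto simp: \<Lambda>_def)
    then show "(\<Sum>c\<in>UNIV. \<Lambda> (f + smult c 1)) = 0" using sum_psi_pow less.prems(1) by simp
  qed (use that in simp)
  moreover have "L_coeff \<Lambda> 0 = 1" by (simp add: L_coeff_def monics_0 \<Lambda>_def mult_char_1[OF psi])
  moreover have "of_nat d * L_coeff \<Lambda> d = (\<Sum>k=1..d. L_log \<Lambda> k * L_coeff \<Lambda> (d - k))"
    by (rule L_coeff_Newton) (simp_all add: \<Lambda>_def mult_char_mult[OF psi] power_mult_distrib mult_char_1[OF psi])
  moreover have "(\<Sum>k=1..d. L_log \<Lambda> k * L_coeff \<Lambda> (d - k)) = (\<Sum>k\<in>{d}. L_log \<Lambda> k * L_coeff \<Lambda> (d - k))"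
    by (rule sum.mono_neutral_right) (use calculation(1) less.prems in auto)
  ultimately have "L_log \<Lambda> d = 0" using less.prems by simp
  moreover have "L_log \<Lambda> d = (\<Sum>d'\<in>{d}. of_nat d' * (\<Sum>P\<in>irreds d'. \<Lambda> P ^ (d div d')))"
    unfolding L_log_def
  proof (rule sum.mono_neutral_right)
    show "\<forall>d'\<in>{d'. d' dvd d} - {d}. of_nat d' * (\<Sum>P\<in>irreds d'. \<Lambda> P ^ (d div d')) = 0"
    proof
      fix d' assume d': "d' \<in> {d'. d' dvd d} - {d}"
      then obtain j where j: "d = d' * j" by blast
      have "1 \<le> d'" "d' < d" "j \<noteq> 0" "j \<le> d" using d' j less.prems
        by (auto simp: Suc_le_eq dest: dvd_imp_le intro!: Nat.gr0I order.not_eq_order_implies_strict)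
      then have "\<not> 5 dvd j" using less.prems(3) by (auto dest: dvd_imp_le)
      then have "\<not> 5 dvd i * j" using less.prems(1) prime_dvd_mult_iff[of "5 :: nat"] by simp
      then have "(\<Sum>P\<in>irreds d'. \<psi> (poly P 0) ^ (i * j)) = 0"
        using less.IH \<open>1 \<le> d'\<close> \<open>d' < d\<close> less.prems(3) by simp
      then show "of_nat d' * (\<Sum>P\<in>irreds d'. \<Lambda> P ^ (d div d')) = 0"
        using j \<open>1 \<le> d'\<close> by (simp add: \<Lambda>_def power_mult[symmetric])
    qed
  qed (use less.prems in auto)
  ultimately show ?case using less.prems by (simp add: \<Lambda>_def)
qed

text \<open>Fibres of the norm are orbits under five twists, hence have at most 5 elements. Exactly
  one fifth of the primes other than x satisfy the condition on the constant term, by orthogonality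
  over the powers of \<psi>. So \<open>sum_fibres\<close> applies, and it also shows that every such
  prime is a norm.\<close>

lemma sum_irreds_kummer_norm:
  assumes d: "1 \<le> d" "d < 5"
  shows "(\<Sum>P\<in>irreds d - {[:0, 1:]}. F (kummer_norm P)) =
    (5 :: complex) * (\<Sum>Q\<in>{Q \<in> irreds d - {[:0, 1:]}. \<psi> (poly Q 0) = 1}. F Q)"
proof -
  define I where "I = irreds d - {[:0, 1 :: 'a:]}"
  define I' where "I' = {Q \<in> I. \<psi> (poly Q 0) = 1}"
  have fin: "finite I" "finite I'" by (simp_all add: I_def I'_def)
  have P0: "poly P 0 \<noteq> 0" if "P \<in> I" for P
    using that irreds_poly_0 by (auto simp: I_def)
  have norm: "kummer_norm P \<in> I'" if P: "P \<in> I" for P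
  proof -
    have m: "P \<in> monics d" using P by (simp add: I_def irreds_def)
    have "kummer_norm P \<in> irreds d" using P d kummer_norm_irreds by (simp add: I_def)
    moreover have "poly (kummer_norm P) 0 \<noteq> 0" using poly_kummer_norm_0[OF m] P0[OF P] by simp
    moreover have "\<psi> (poly (kummer_norm P) 0) = 1"
      using psi5[OF P0[OF P]] by (simp add: poly_kummer_norm_0[OF m] mult_char_power[OF psi])
    ultimately show ?thesis by (auto simp: I'_def I_def)
  qed
  have le: "card {P \<in> I. kummer_norm P = Q} \<le> 5" for Q
  proof (cases "{P \<in> I. kummer_norm P = Q} = {}")
    case False
    then obtain P where P: "P \<in> I" "kummer_norm P = Q" by blast
    have "{P \<in> I. kummer_norm P = Q} \<subseteq> (\<lambda>i. twist i P) ` {..<5}"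
      using P kummer_norm_fibre[of P d] by (auto simp: I_def)
    then have "card {P \<in> I. kummer_norm P = Q} \<le> card ((\<lambda>i. twist i P) ` {..<5})"
      by (intro card_mono) auto
    also have "\<dots> \<le> 5" using card_image_le[of "{..<5}" "\<lambda>i. twist i P"] by simp
    finally show ?thesis .
  qed (simp only: card.empty)
  have "(of_nat (5 * card I') :: complex) = (\<Sum>Q\<in>I'. 5)" by simp
  also have "\<dots> = (\<Sum>Q\<in>I. if \<psi> (poly Q 0) = 1 then 5 else 0)"
    unfolding I'_def by (rule sum.inter_filter[OF fin(1)])
  also have "\<dots> = (\<Sum>Q\<in>I. \<Sum>i<5. \<psi> (poly Q 0) ^ (i * 1))"
    by (intro sum.cong) (use sum_psi_powers[of 1] P0 in auto)
  also have "\<dots> = (\<Sum>i<5. \<Sum>Q\<in>I. \<psi> (poly Q 0) ^ i)" by (subst sum.swap) simp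
  also have "\<dots> = (\<Sum>i\<in>{0}. \<Sum>Q\<in>I. \<psi> (poly Q 0) ^ i)"
  proof (rule sum.mono_neutral_right)
    show "\<forall>i\<in>{..<5} - {0}. (\<Sum>Q\<in>I. \<psi> (poly Q 0) ^ i) = 0"
    proof
      fix i :: nat assume i: "i \<in> {..<5} - {0}"
      then have i5: "\<not> 5 dvd i" by (auto dest: dvd_imp_le)
      have "(\<Sum>Q\<in>I. \<psi> (poly Q 0) ^ i) = (\<Sum>Q\<in>irreds d. \<psi> (poly Q 0) ^ i)"
        unfolding I_def by (rule sum.mono_neutral_left) (use i in \<open>auto simp: mult_char_0[OF psi]\<close>)
      then show "(\<Sum>Q\<in>I. \<psi> (poly Q 0) ^ i) = 0" using sum_irreds_psi_eq_0[OF i5 d] by simp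
    qed
  qed auto
  finally have "of_nat (card I) = (of_nat (5 * card I') :: complex)" by simp
  then have "card I = 5 * card I'" by (simp only: of_nat_eq_iff)
  from sum_fibres[OF fin norm le this, of F] show ?thesis by (simp add: I_def I'_def)
qed

text \<open>The comparison of Euler factors along the covering: the sum over the powers of \<psi> is
  5 times the indicator of the norms, which matches the five primes above each of them.\<close>

lemma sum_irreds_Kummer:
  fixes \<eta> :: "'a \<Rightarrow> complex"
  assumes \<eta>: "mult_char \<eta>" and d: "1 \<le> d" "d < 5" and j: "\<not> 5 dvd j"
  shows "(\<Sum>P\<in>irreds d. \<eta> (\<Prod>i<5. poly P (\<zeta> ^ i)) ^ j) =
    (\<Sum>i<5. \<Sum>Q\<in>irreds d. (\<psi> (poly Q 0) ^ i * \<eta> (poly Q 1)) ^ j)"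
proof -
  define I where "I = irreds d - {[:0, 1 :: 'a:]}"
  \<comment> \<open>This isolates the ramified prime x. It counts once on both sides: on the left
    the product of the fifth roots of unity is 1, on the right only i = 0 contributes, through 0 ^ 0
    = 1.\<close>
  define e :: complex where "e = (if [:0, 1 :: 'a:] \<in> irreds d then 1 else 0)"
  have split: "(\<Sum>P\<in>irreds d. f P) = e * f [:0, 1:] + (\<Sum>P\<in>I. f P)" for f :: "'a poly \<Rightarrow> complex"
    by (auto simp: e_def I_def sum.remove)
  have j0: "j > 0" using j by (auto intro!: Nat.gr0I)
  have "(\<Prod>i<5. \<zeta> ^ i) = \<zeta> ^ 10" by (simp add: numeral_eq_Suc lessThan_Suc)
  then have z: "(\<Prod>i<5. \<zeta> ^ i) = 1" by (simp add: zeta_pow_eq_1_iff)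
  have Q0: "poly Q 0 \<noteq> 0" if "Q \<in> I" for Q
    using that irreds_poly_0 by (auto simp: I_def)
  have "(\<Sum>P\<in>irreds d. \<eta> (\<Prod>i<5. poly P (\<zeta> ^ i)) ^ j) =
      e + (\<Sum>P\<in>I. \<eta> (\<Prod>i<5. poly P (\<zeta> ^ i)) ^ j)"
    unfolding split using z by (simp add: mult_char_1[OF \<eta>])
  also have "(\<Sum>P\<in>I. \<eta> (\<Prod>i<5. poly P (\<zeta> ^ i)) ^ j) = (\<Sum>P\<in>I. \<eta> (poly (kummer_norm P) 1) ^ j)"
    by (intro sum.cong) (auto simp: I_def irreds_def poly_kummer_norm_1[of _ d])
  also have "\<dots> = 5 * (\<Sum>Q\<in>{Q \<in> I. \<psi> (poly Q 0) = 1}. \<eta> (poly Q 1) ^ j)"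
    unfolding I_def by (rule sum_irreds_kummer_norm[OF d])
  also have "\<dots> = (\<Sum>Q\<in>I. (\<Sum>i<5. \<psi> (poly Q 0) ^ (i * j)) * \<eta> (poly Q 1) ^ j)"
    unfolding sum_distrib_left
    by (rule sum.mono_neutral_cong_left) (use Q0 sum_psi_powers[OF j] in \<open>auto simp: I_def\<close>)
  also have "e + \<dots> = (\<Sum>Q\<in>irreds d. (\<Sum>i<5. \<psi> (poly Q 0) ^ (i * j)) * \<eta> (poly Q 1) ^ j)"
    unfolding split using sum_psi_powers[OF j, of 0] by (simp add: mult_char_1[OF \<eta>])
  also have "\<dots> = (\<Sum>i<5. \<Sum>Q\<in>irreds d. (\<psi> (poly Q 0) ^ i * \<eta> (poly Q 1)) ^ j)"
    unfolding sum_distrib_right by (subst sum.swap) (simp add: power_mult_distrib power_mult)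
  finally show ?thesis .
qed

text \<open>Both sides are the coefficient of degree 4 of an \<open>L\<close>-function: the one of \<open>\<eta>(x\<^sup>5 - 1)\<close> on the
  line, which factors into those of \<open>\<psi>\<^sup>i(u) \<eta>(u - 1)\<close> along the Kummer covering \<open>u = x\<^sup>5\<close>.\<close>

lemma prod_jacobi_sum_eq:
  fixes \<eta> :: "'a \<Rightarrow> complex"
  assumes \<eta>: "mult_char \<eta>" and nontriv: "\<eta> \<noteq> trivial_char"
  shows "(\<Prod>i=1..4. jacobi_sum (\<lambda>x. \<psi> x ^ i) \<eta>) = (\<Sum>f\<in>monics 4. \<eta> (\<Prod>i<5. poly f (\<zeta> ^ i)))"
proof -
  define \<Lambda> where "\<Lambda> i f = \<psi> (poly f 0) ^ i * \<eta> (poly f 1)" for i f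
  define M where "M f = \<eta> (\<Prod>i<5. poly f (\<zeta> ^ i))" for f
  \<comment> \<open>The L-function for i = 0 is constant 1, so its linear coefficient is 0; the
    other four are 1 + J(i) u.\<close>
  define J where "J i = (if i = 0 then 0 else jacobi_sum (\<lambda>x. \<psi> x ^ i) \<eta>)" for i
  note psi_simps = mult_char_1[OF psi] mult_char_1[OF \<eta>] mult_char_mult[OF psi] mult_char_mult[OF \<eta>]
  have sum_eta: "(\<Sum>c\<in>UNIV. \<eta> (a + c)) = 0" for a
  proof -
    have "(\<Sum>c\<in>UNIV. \<eta> (a + c)) = (\<Sum>c\<in>UNIV. \<eta> c)"
      by (rule sum.reindex_bij_witness[of _ "\<lambda>c. c - a" "\<lambda>c. a + c"]) auto
    then show ?thesis using sum_mult_char[OF \<eta> nontriv] by simp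
  qed
  have c0: "L_coeff (\<Lambda> i) 0 = 1" for i
    by (simp add: L_coeff_def monics_0 \<Lambda>_def psi_simps)
  have i0: "L_coeff (\<Lambda> 0) n = 0" if "n \<ge> 1" for n
    unfolding L_coeff_def
    by (rule sum_monics_eq_0[of 1]) (use that in \<open>simp_all add: \<Lambda>_def sum_eta\<close>)
  have c1: "L_coeff (\<Lambda> i) 1 = J i" if i: "i < 5" for i
  proof (cases "i = 0")
    case True
    then show ?thesis using i0[of 1] by (simp add: J_def)
  next
    case False
    have "\<exists>y :: 'a. -1 = y ^ 5" by (intro exI[of _ "-1"]) simp
    then have "\<psi> (-1) = 1" using psi_eq_1_iff[of "-1"] by simp
    then have minus: "\<psi> (- x) = \<psi> x" for x
      using mult_char_mult[OF psi, of "-1" x] by simp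
    have "L_coeff (\<Lambda> i) 1 = (\<Sum>c\<in>UNIV. \<psi> c ^ i * \<eta> (c + 1))"
      unfolding L_coeff_def monics_1 by (subst sum.reindex) (auto simp: inj_on_def \<Lambda>_def)
    also have "\<dots> = (\<Sum>x\<in>UNIV. \<psi> x ^ i * \<eta> (1 - x))"
      by (rule sum.reindex_bij_witness[of _ uminus uminus]) (auto simp: minus add.commute)
    finally show ?thesis using False by (simp add: J_def jacobi_sum_def)
  qed
  \<comment> \<open>Adding multiples of x - 1 leaves the value at 1 unchanged, while the value at 0
    runs through the whole field.\<close>
  have c2: "L_coeff (\<Lambda> i) n = 0" if i: "i < 5" and n: "n \<ge> 2" for i n
  proof (cases "i = 0")
    case True
    then show ?thesis using i0 n by simp
  next
    case False
    then have i5: "\<not> 5 dvd i" using i by (auto dest: dvd_imp_le)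
    show ?thesis
      unfolding L_coeff_def
    proof (rule sum_monics_eq_0[of "[:-1, 1:]"])
      fix f :: "'a poly"
      have "(\<Sum>c\<in>UNIV. \<Lambda> i (f + smult c [:-1, 1:])) = (\<Sum>c\<in>UNIV. \<psi> c ^ i * \<eta> (poly f 1))"
        by (rule sum.reindex_bij_witness[of _ "\<lambda>c. poly f 0 - c" "\<lambda>c. poly f 0 - c"]) (auto simp: \<Lambda>_def)
      then show "(\<Sum>c\<in>UNIV. \<Lambda> i (f + smult c [:-1, 1:])) = 0"
        by (simp add: sum_distrib_right[symmetric] sum_psi_pow[OF i5])
    qed (use n in simp)
  qed
  have newton: "of_nat n * L_coeff (\<Lambda> i) n = (\<Sum>k=1..n. L_log (\<Lambda> i) k * L_coeff (\<Lambda> i) (n - k))" for i n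
    by (rule L_coeff_Newton) (simp_all add: \<Lambda>_def psi_simps power_mult_distrib mult_ac)
  \<comment> \<open>These are the first coefficients of u L'/L for L = 1 + J u.\<close>
  have log: "L_log (\<Lambda> i) 1 = J i" "L_log (\<Lambda> i) 2 = - (J i ^ 2)" "L_log (\<Lambda> i) 3 = J i ^ 3"
    "L_log (\<Lambda> i) 4 = - (J i ^ 4)" if i: "i < 5" for i
  proof -
    have sets: "{1..1} = {1::nat}" "{1..2} = {1, 2::nat}" "{1..3} = {1, 2, 3::nat}"
      "{1..4} = {1, 2, 3, 4::nat}" by auto
    note n = newton[of 1 i] newton[of 2 i] newton[of 3 i] newton[of 4 i]
    note n' = n[unfolded sets]
    show l1: "L_log (\<Lambda> i) 1 = J i" using n'(1) c0 c1[OF i] by simp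
    show l2: "L_log (\<Lambda> i) 2 = - (J i ^ 2)"
      using n'(2) c0 c1[OF i] c2[OF i] l1 by (simp add: power2_eq_square eq_neg_iff_add_eq_0 add.commute)
    show l3: "L_log (\<Lambda> i) 3 = J i ^ 3"
      using n'(3) c0 c1[OF i] c2[OF i] l1 l2 by (simp add: power2_eq_square power3_eq_cube eq_neg_iff_add_eq_0 add.commute)
    show "L_log (\<Lambda> i) 4 = - (J i ^ 4)"
      using n'(4) c0 c1[OF i] c2[OF i] l1 l2 l3 by (simp add: eq_neg_iff_add_eq_0 add.commute power4_eq_xxxx power3_eq_cube mult_ac)
  qed
  have logM: "L_log M k = (\<Sum>i<5. L_log (\<Lambda> i) k)" if k: "1 \<le> k" "k < 5" for k
  proof -
    have "L_log M k = (\<Sum>d | d dvd k. of_nat d * (\<Sum>i<5. \<Sum>P\<in>irreds d. \<Lambda> i P ^ (k div d)))"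
      unfolding L_log_def M_def \<Lambda>_def
    proof (intro sum.cong refl arg_cong2[where f = "(*)"] sum_irreds_Kummer[OF \<eta>])
      fix d assume "d \<in> {d. d dvd k}"
      then obtain j where j: "k = d * j" by blast
      then have dj: "0 < d" "0 < j" using k by (auto intro!: Nat.gr0I)
      then have "d \<le> k" "j \<le> k" using j by simp_all
      then have "d < 5" "j < 5" using k(2) by linarith+
      then show "1 \<le> d" "d < 5" "\<not> 5 dvd k div d"
        using dj j by (auto dest: dvd_imp_le)
    qed
    then show ?thesis
      unfolding L_log_def by (subst sum.swap) (simp add: sum_distrib_left)
  qed
  have newtonM: "of_nat n * L_coeff M n = (\<Sum>k=1..n. L_log M k * L_coeff M (n - k))" for n
    by (rule L_coeff_Newton) (simp_all add: M_def psi_simps prod.distrib)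
  have five: "{..<5} = {0, 1, 2, 3, 4::nat}" by auto
  have m0: "L_coeff M 0 = 1" by (simp add: L_coeff_def monics_0 M_def psi_simps)
  have sets: "{1..1} = {1::nat}" "{1..2} = {1, 2::nat}" "{1..3} = {1, 2, 3::nat}"
    "{1..4} = {1, 2, 3, 4::nat}" by auto
  have J0: "J 0 = 0" by (simp add: J_def)
  \<comment> \<open>The logarithmic coefficients of M are, up to sign, the power sums of the four
    Jacobi sums. Newton's identities turn them into the elementary symmetric functions, and the one
    of degree 4 is the product.\<close>
  define a b c e where abce: "a = J 1" "b = J 2" "c = J 3" "e = J 4"
  have s: "L_log M 1 = a + b + c + e" "L_log M 2 = - (a ^ 2 + b ^ 2 + c ^ 2 + e ^ 2)"
    "L_log M 3 = a ^ 3 + b ^ 3 + c ^ 3 + e ^ 3" "L_log M 4 = - (a ^ 4 + b ^ 4 + c ^ 4 + e ^ 4)"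
    using logM[of 1] logM[of 2] logM[of 3] logM[of 4]
    by (simp_all add: five log J0 abce del: One_nat_def)
  note N = newtonM[of 1, unfolded sets] newtonM[of 2, unfolded sets]
    newtonM[of 3, unfolded sets] newtonM[of 4, unfolded sets]
  have e1: "L_coeff M 1 = a + b + c + e" using N(1) s m0 by (simp del: One_nat_def)
  have "2 * L_coeff M 2 = (a + b + c + e) ^ 2 - (a ^ 2 + b ^ 2 + c ^ 2 + e ^ 2)"
    using N(2) s m0 e1 e1[unfolded One_nat_def] by (simp add: power2_eq_square del: One_nat_def)
  then have "2 * L_coeff M 2 = 2 * (a * b + a * c + a * e + b * c + b * e + c * e)"
    by (simp add: power2_eq_square algebra_simps)
  then have e2: "L_coeff M 2 = a * b + a * c + a * e + b * c + b * e + c * e"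
    by (subst (asm) mult_cancel_left) simp
  have "3 * L_coeff M 3 = (a + b + c + e) * L_coeff M 2 - (a ^ 2 + b ^ 2 + c ^ 2 + e ^ 2) * (a + b + c + e)
      + (a ^ 3 + b ^ 3 + c ^ 3 + e ^ 3)"
    using N(3) s m0 e1 e1[unfolded One_nat_def] by (simp add: algebra_simps del: One_nat_def)
  then have "3 * L_coeff M 3 = 3 * (a * b * c + a * b * e + a * c * e + b * c * e)"
    unfolding e2 by (simp add: power2_eq_square power3_eq_cube algebra_simps)
  then have e3: "L_coeff M 3 = a * b * c + a * b * e + a * c * e + b * c * e"
    by (subst (asm) mult_cancel_left) simp
  have "4 * L_coeff M 4 = (a + b + c + e) * L_coeff M 3 - (a ^ 2 + b ^ 2 + c ^ 2 + e ^ 2) * L_coeff M 2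
      + (a ^ 3 + b ^ 3 + c ^ 3 + e ^ 3) * (a + b + c + e) - (a ^ 4 + b ^ 4 + c ^ 4 + e ^ 4)"
    using N(4) s m0 e1 e1[unfolded One_nat_def] by (simp add: algebra_simps del: One_nat_def)
  then have "4 * L_coeff M 4 = 4 * (a * b * c * e)"
    unfolding e2 e3 by (simp add: power2_eq_square power3_eq_cube power4_eq_xxxx algebra_simps)
  then have "L_coeff M 4 = a * b * c * e" by (subst (asm) mult_cancel_left) simp
  then show ?thesis
    unfolding sets by (simp add: abce J_def L_coeff_def M_def mult_ac)
qed

end

section \<open>The Hasse-Davenport product formula\<close>

context fifth_root
begin

text \<open>In characteristic 5 the fifth power of \<zeta> - 1 would be 0, and \<zeta> would be
  1.\<close>

lemma five_nonzero: "(5 :: 'a) \<noteq> 0"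
proof
  assume "(5 :: 'a) = 0"
  have "(\<zeta> - 1) ^ 5 = \<zeta> ^ 5 - 1 - 5 * (\<zeta> ^ 4 - 2 * \<zeta> ^ 3 + 2 * \<zeta> ^ 2 - \<zeta>)"
    by (simp add: numeral_eq_Suc algebra_simps)
  then have "\<zeta> = 1" using \<open>5 = 0\<close> by (simp add: zeta5)
  then show False using zeta_neq_1 by contradiction
qed

lemma inj_zeta_pow: "inj_on (\<lambda>i. \<zeta> ^ i) {..<5}"
  by (auto simp: inj_on_def zeta_pow_eq_iff)

lemma sum_zeta_pow: "(\<Sum>k<5. (\<zeta> ^ m) ^ k) = (if 5 dvd m then 5 else 0)"
proof (cases "5 dvd m")
  case True
  then have "\<zeta> ^ m = 1" by (simp add: zeta_pow_eq_1_iff)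
  with True show ?thesis by simp
next
  case False
  then have "\<zeta> ^ m \<noteq> 1" by (simp add: zeta_pow_eq_1_iff)
  moreover have "(\<zeta> ^ m) ^ 5 = 1" by (simp add: power_mult[symmetric] zeta_pow_eq_1_iff)
  ultimately show ?thesis using False by (simp add: geometric_sum)
qed

text \<open>Lagrange interpolation at the fifth roots of unity, normalised so that the coefficient of degree 4
  is the sum of the data.\<close>

definition interpolate :: "(nat \<Rightarrow> 'a) \<Rightarrow> 'a poly" where
  "interpolate w = (\<Sum>k<5. monom (\<Sum>i<5. w i * \<zeta> ^ ((4 - k) * i)) k)"

lemma coeff_interpolate_4: "coeff (interpolate w) 4 = (\<Sum>i<5. w i)"
  by (simp add: interpolate_def coeff_sum)

lemma degree_interpolate: "degree (interpolate w) < 5"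
proof -
  have "degree (interpolate w) \<le> 4"
    unfolding interpolate_def by (intro degree_sum_le) (auto intro: order_trans[OF degree_monom_le])
  then show ?thesis by simp
qed

lemma poly_interpolate:
  assumes j: "j < 5"
  shows "poly (interpolate w) (\<zeta> ^ j) = 5 * (w j * \<zeta> ^ (4 * j))"
proof -
  have "poly (interpolate w) (\<zeta> ^ j) = (\<Sum>k<5. \<Sum>i<5. w i * (\<zeta> ^ ((4 - k) * i) * (\<zeta> ^ j) ^ k))"
    by (simp add: interpolate_def poly_sum poly_monom sum_distrib_left mult_ac)
  \<comment> \<open>Modulo 5 the number 4 acts as -1, so the exponent \<open>4 * i + j\<close>
    stands for j - i, and the geometric sum over k selects i = j.\<close>
  also have "\<dots> = (\<Sum>k<5. \<Sum>i<5. w i * \<zeta> ^ (4 * i) * (\<zeta> ^ (4 * i + j)) ^ k)"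
  proof (intro sum.cong refl)
    fix k i :: nat assume "k \<in> {..<5}"
    then obtain l where l: "4 = k + l" using le_Suc_ex[of k 4] by auto
    have "\<zeta> ^ ((4 - k) * i) * (\<zeta> ^ j) ^ k = \<zeta> ^ (l * i + j * k)"
      by (simp add: l power_mult[symmetric] power_add[symmetric])
    also have "\<dots> = \<zeta> ^ (4 * i + (4 * i + j) * k)"
    proof -
      have "4 * i = k * i + l * i" by (metis l distrib_right)
      then have "4 * i + (4 * i + j) * k = (k * i + l * i) + (4 * i + j) * k"
        by (rule arg_cong)
      also have "\<dots> = (l * i + j * k) + 5 * (i * k)" by (simp add: algebra_simps)
      finally have "4 * i + (4 * i + j) * k = (l * i + j * k) + 5 * (i * k)" .
      then show ?thesis by (simp only: zeta_pow_eq_iff) simp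
    qed
    finally show "w i * (\<zeta> ^ ((4 - k) * i) * (\<zeta> ^ j) ^ k) = w i * \<zeta> ^ (4 * i) * (\<zeta> ^ (4 * i + j)) ^ k"
      by (simp add: power_mult[symmetric] power_add[symmetric])
  qed
  also have "\<dots> = (\<Sum>i<5. w i * \<zeta> ^ (4 * i) * (\<Sum>k<5. (\<zeta> ^ (4 * i + j)) ^ k))"
    by (subst sum.swap) (simp add: sum_distrib_left)
  also have "\<dots> = (\<Sum>i<5. if i = j then 5 * (w j * \<zeta> ^ (4 * j)) else 0)"
  proof (intro sum.cong refl)
    fix i :: nat assume "i \<in> {..<5}"
    then have "i < 5" by simp
    with j have "i = 0 \<or> i = 1 \<or> i = 2 \<or> i = 3 \<or> i = 4" "j = 0 \<or> j = 1 \<or> j = 2 \<or> j = 3 \<or> j = 4"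
      by linarith+
    then have "5 dvd 4 * i + j \<longleftrightarrow> i = j" by (elim disjE) (simp_all add: numeral_2_eq_2[symmetric])
    then show "w i * \<zeta> ^ (4 * i) * (\<Sum>k<5. (\<zeta> ^ (4 * i + j)) ^ k) = (if i = j then 5 * (w j * \<zeta> ^ (4 * j)) else 0)"
      by (simp add: sum_zeta_pow)
  qed
  finally show ?thesis using j by simp
qed

lemma bij_interpolate: "bij_betw interpolate ({..<5} \<rightarrow>\<^sub>E UNIV) {h. degree h < 5}"
proof (rule bij_betw_imageI)
  show "inj_on interpolate ({..<5} \<rightarrow>\<^sub>E UNIV)"
  proof (rule inj_onI)
    fix v w assume vw: "v \<in> {..<5} \<rightarrow>\<^sub>E UNIV" "w \<in> {..<5} \<rightarrow>\<^sub>E UNIV" "interpolate v = interpolate w"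
    show "v = w"
    proof (rule PiE_ext[OF vw(1,2)])
      fix j :: nat assume "j \<in> {..<5}"
      then show "v j = w j"
        using poly_interpolate[of j v] poly_interpolate[of j w] vw(3) five_nonzero zeta_nonzero by simp
    qed
  qed
  show "interpolate ` ({..<5} \<rightarrow>\<^sub>E UNIV) = {h. degree h < 5}"
  proof (intro equalityI subsetI)
    fix h :: "'a poly" assume h: "h \<in> {h. degree h < 5}"
    \<comment> \<open>Solves \<open>5 * (w j * \<zeta> ^ (4 * j)) = poly h (\<zeta> ^ j)\<close> for
      the data, using that \<zeta>^j and \<zeta>^(4 j) are inverse. Agreement at five points then
      determines a polynomial of degree below 5.\<close>
    define w where "w = restrict (\<lambda>j. poly h (\<zeta> ^ j) * \<zeta> ^ j / 5) {..<5}"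
    have "interpolate w = h"
    proof (rule poly_eqI_degree)
      show "card ((\<lambda>j. \<zeta> ^ j) ` {..<5}) > degree (interpolate w)" "card ((\<lambda>j. \<zeta> ^ j) ` {..<5}) > degree h"
        using h degree_interpolate by (simp_all add: card_image[OF inj_zeta_pow])
      fix x assume "x \<in> (\<lambda>j. \<zeta> ^ j) ` {..<5}"
      then obtain j where j: "j < 5" "x = \<zeta> ^ j" by auto
      have "\<zeta> ^ j * \<zeta> ^ (4 * j) = 1" by (simp add: power_add[symmetric] zeta_pow_eq_1_iff)
      then show "poly (interpolate w) x = poly h x"
        using five_nonzero j by (simp add: poly_interpolate w_def mult.assoc)
    qed
    then show "h \<in> interpolate ` ({..<5} \<rightarrow>\<^sub>E UNIV)"
      by (intro image_eqI[of _ _ w]) (auto simp: w_def)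
  next
    fix h assume "h \<in> interpolate ` ({..<5} \<rightarrow>\<^sub>E UNIV)"
    then obtain w where "h = interpolate w" by blast
    then show "h \<in> {h. degree h < 5}" using degree_interpolate by blast
  qed
qed

end

section \<open>Gauss sums of the twists by powers of \<psi>\<close>

locale quintic_gauss = quintic_char \<zeta> \<psi> + additive_char \<theta> q
  for \<zeta> :: "'a::{field,finite}" and \<psi> and \<theta> :: "'a \<Rightarrow> complex" and q
begin

definition tw :: "('a \<Rightarrow> complex) \<Rightarrow> nat \<Rightarrow> 'a \<Rightarrow> complex" where
  "tw \<eta> j = (\<lambda>x. \<eta> x * \<psi> x ^ j)"

lemma mult_char_tw:
  assumes \<eta>: "mult_char \<eta>"
  shows "mult_char (tw \<eta> j)"
  unfolding mult_char_def tw_def mult_char_mult[OF \<eta>] mult_char_mult[OF psi] power_mult_distrib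
  by (simp add: mult_char_0[OF \<eta>] mult_char_eq_0_iff[OF \<eta>] mult_char_eq_0_iff[OF psi] mult_ac)

lemma tw_0 [simp]: "tw \<eta> 0 = \<eta>"
  by (simp add: tw_def)

lemma tw_trivial: "j > 0 \<Longrightarrow> tw trivial_char j = (\<lambda>x. \<psi> x ^ j)"
  by (rule ext) (simp add: tw_def trivial_char_def mult_char_0[OF psi])

lemma tw_mod:
  assumes "mult_char \<eta>"
  shows "tw \<eta> (j mod 5) = tw \<eta> j"
proof
  fix x show "tw \<eta> (j mod 5) x = tw \<eta> j x"
    using mult_char_0[OF assms] psi_pow_mod[of x] by (cases "x = 0") (simp_all add: tw_def)
qed

lemma tw_tw: "tw (tw \<eta> i) j = tw \<eta> (i + j)"
  by (rule ext) (simp add: tw_def power_add)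

lemma psi_minus_1: "\<psi> (-1) = 1"
proof -
  have "\<exists>y :: 'a. -1 = y ^ 5" by (intro exI[of _ "-1"]) simp
  then show ?thesis using psi_eq_1_iff[of "-1"] by simp
qed

lemma cnj_psi: "x \<noteq> 0 \<Longrightarrow> cnj (\<psi> x) = \<psi> x ^ 4"
proof -
  assume x: "x \<noteq> 0"
  have "\<psi> x * \<psi> x ^ 4 = \<psi> x * cnj (\<psi> x)"
    using psi5[OF x] mult_char_cnj_self[OF psi x] by (simp add: numeral_eq_Suc)
  then show ?thesis using x by (simp add: mult_char_eq_0_iff[OF psi])
qed

text \<open>Take y with \<psi>(y) different from 1. The powers of \<psi>(y) are all fifth roots of
  unity, so \<eta>(y) is one of them. Every unit is a power of y times a fifth power, on which
  \<eta> is trivial, so this single value determines \<eta>.\<close>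

lemma fifth_torsion:
  assumes \<eta>: "mult_char \<eta>" and tors: "\<And>x. x \<noteq> 0 \<Longrightarrow> \<eta> x ^ 5 = 1"
  obtains m where "m < 5" "\<eta> = tw trivial_char m"
proof -
  obtain y where y: "y \<noteq> 0" "\<psi> y \<noteq> 1"
    using psi psi_nontrivial by (auto simp: fun_eq_iff trivial_char_def mult_char_0 split: if_splits)
  have inj: "inj_on (\<lambda>m. \<psi> y ^ m) {..<5}"
  proof (rule inj_onI)
    fix i j :: nat assume ij: "i \<in> {..<5}" "j \<in> {..<5}" "\<psi> y ^ i = \<psi> y ^ j"
    have *: False if lt: "i < j" "j < 5" "\<psi> y ^ i = \<psi> y ^ j" for i j
    proof -
      have "\<psi> y ^ i * \<psi> y ^ (j - i) = \<psi> y ^ i * 1"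
        unfolding power_add[symmetric] using lt by simp
      then have "\<psi> y ^ (j - i) = 1" using y by (simp add: mult_char_eq_0_iff[OF psi])
      moreover have "\<not> 5 dvd j - i" using lt by (auto dest: dvd_imp_le)
      ultimately show False using psi_pow_eq_1 y by blast
    qed
    show "i = j" using *[of i j] *[of j i] ij by (cases i j rule: linorder_cases) auto
  qed
  have roots: "(\<lambda>m. \<psi> y ^ m) ` {..<5} = {z. z ^ 5 = 1}"
  proof (rule card_subset_eq)
    show "finite {z :: complex. z ^ 5 = 1}" by (rule finite_roots_unity) simp
    show "(\<lambda>m. \<psi> y ^ m) ` {..<5} \<subseteq> {z. z ^ 5 = 1}"
    proof clarify
      fix m :: nat
      have "(\<psi> y ^ m) ^ 5 = (\<psi> y ^ 5) ^ m" by (simp add: power_mult[symmetric] mult.commute)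
      then show "(\<psi> y ^ m) ^ 5 = 1" by (simp add: psi5[OF y(1)])
    qed
    show "card ((\<lambda>m. \<psi> y ^ m) ` {..<5}) = card {z :: complex. z ^ 5 = 1}"
      by (simp add: card_image[OF inj] card_roots_unity_eq)
  qed
  have "\<eta> y \<in> {z. z ^ 5 = 1}" using tors y(1) by simp
  then obtain m where m: "m < 5" "\<eta> y = \<psi> y ^ m" unfolding roots[symmetric] by blast
  have "\<eta> x = tw trivial_char m x" for x
  proof (cases "x = 0")
    case True
    then show ?thesis by (simp add: mult_char_0[OF \<eta>] tw_def trivial_char_def)
  next
    case False
    have "\<psi> x \<in> {z. z ^ 5 = 1}" using psi5[OF False] by simp
    then obtain i where i: "\<psi> x = \<psi> y ^ i" unfolding roots[symmetric] by blast
    have "\<psi> (x / y ^ i) = 1"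
      using y by (simp add: mult_char_divide[OF psi] mult_char_power[OF psi] i[symmetric] mult_char_cnj_self[OF psi False]
        flip: complex_cnj_power)
    then obtain z where "x / y ^ i = z ^ 5" using psi_eq_1_iff[of "x / y ^ i"] y False by auto
    then have x: "x = y ^ i * z ^ 5" using y by (simp add: field_simps)
    then have "z \<noteq> 0" using False by auto
    then have "\<eta> x = \<eta> y ^ i" by (simp add: x mult_char_mult[OF \<eta>] mult_char_power[OF \<eta>] tors)
    then show ?thesis using False by (simp add: tw_def trivial_char_def m i power_mult[symmetric] mult.commute)
  qed
  then show ?thesis using that[OF m(1)] by blast
qed

lemma tw_eq_trivialD:
  assumes \<eta>: "mult_char \<eta>" and eq: "tw \<eta> j = trivial_char" and x: "x \<noteq> 0"
  shows "\<eta> x ^ 5 = 1"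
proof -
  have "\<eta> x * \<psi> x ^ j = 1" using fun_cong[OF eq, of x] x by (simp add: tw_def trivial_char_def)
  then have "(\<eta> x * \<psi> x ^ j) ^ 5 = 1" by (simp only: power_one)
  moreover have "(\<psi> x ^ j) ^ 5 = 1"
    using psi5[OF x] by (simp add: power_mult[symmetric] mult.commute[of j]) (simp add: power_mult)
  ultimately show ?thesis by (simp add: power_mult_distrib)
qed

lemma gauss_psi_mult: "g (tw trivial_char 1) * g (tw trivial_char 4) = q"
  "g (tw trivial_char 2) * g (tw trivial_char 3) = q"
proof -
  have *: "g (tw trivial_char i) * g (tw trivial_char j) = q"
    if "i + j = 5" "\<not> 5 dvd i" "i > 0" for i j
  proof -
    have "tw trivial_char j x = cnj (tw trivial_char i x)" for x
    proof (cases "x = 0")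
      case False
      have "\<psi> x ^ i * \<psi> x ^ j = \<psi> x ^ i * cnj (\<psi> x ^ i)"
        using False psi5 that(1) mult_char_cnj_self[OF mult_char_psi_pow[OF that(3)] False]
        by (simp flip: power_add)
      then show ?thesis using False by (simp add: tw_def trivial_char_def mult_char_eq_0_iff[OF psi])
    qed (simp add: tw_def trivial_char_def)
    then have "tw trivial_char j = (\<lambda>x. cnj (tw trivial_char i x))" by blast
    then show ?thesis
      using gauss_mult_cnj[of "tw trivial_char i"] psi_pow_nontrivial[OF that(2)] mult_char_tw[OF mult_char_trivial, of i] that(3)
      by (simp add: tw_trivial psi_minus_1)
  qed
  show "g (tw trivial_char 1) * g (tw trivial_char 4) = q" by (rule *) simp_all
  show "g (tw trivial_char 2) * g (tw trivial_char 3) = q" by (rule *) simp_all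
qed

lemma prod5: "(\<Prod>j<5. f j) = f 0 * f 1 * f 2 * f 3 * f (4 :: nat)"
proof -
  have "{..<5} = {0, 1, 2, 3, 4 :: nat}" by auto
  then show ?thesis by (simp add: mult.assoc)
qed

lemma prod_gauss_psi: "(\<Prod>j<5. g (tw trivial_char j)) = - (q ^ 2)"
proof -
  have "(\<Prod>j<5. g (tw trivial_char j)) = - ((g (tw trivial_char 1) * g (tw trivial_char 4)) *
      (g (tw trivial_char 2) * g (tw trivial_char 3)))"
    by (simp add: prod5 gauss_trivial mult_ac)
  then show ?thesis by (simp only: gauss_psi_mult power2_eq_square)
qed

text \<open>The fifth power of the Gauss sum is a sum over quintuples, which interpolation
  identifies with polynomials of degree below 5; \<theta> then sees only the coefficient of degree
  4. Polynomials of lower degree cancel under scaling by an element where \<eta>^5 is not 1. The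
  others are a scalar times a monic polynomial, and the scalars produce the Gauss sum of
  \<eta>^5.\<close>

lemma monics_4_gauss:
  fixes \<eta> :: "'a \<Rightarrow> complex"
  assumes \<eta>: "mult_char \<eta>" and nontriv: "(\<lambda>x. \<eta> x ^ 5) \<noteq> trivial_char"
  shows "\<eta> (5 ^ 5) * g \<eta> ^ 5 = (\<Sum>f\<in>monics 4. \<eta> (\<Prod>i<5. poly f (\<zeta> ^ i))) * g (\<lambda>x. \<eta> x ^ 5)"
proof -
  define M where "M h = \<eta> (\<Prod>i<5. poly h (\<zeta> ^ i))" for h
  have \<theta>_sum: "\<theta> (\<Sum>i\<in>A. w i) = (\<Prod>i\<in>A. \<theta> (w i))" for w :: "nat \<Rightarrow> 'a" and A
    by (induction A rule: infinite_finite_induct) (auto simp: zero add)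
  have M_smult: "M (smult s h) = \<eta> s ^ 5 * M h" for s h
    by (simp add: M_def prod.distrib mult_char_mult[OF \<eta>] mult_char_power[OF \<eta>])
  have lead: "coeff h 4 \<noteq> 0" if "degree h = 4" for h :: "'a poly"
    using that by (metis degree_0 leading_coeff_0_iff zero_neq_numeral)
  have "g \<eta> ^ 5 = (\<Prod>i<5::nat. \<Sum>y\<in>UNIV. \<eta> y * \<theta> y)" by (simp add: gauss_sum_def)
  also have "\<dots> = (\<Sum>w\<in>{..<5::nat} \<rightarrow>\<^sub>E UNIV. \<Prod>i<5. \<eta> (w i) * \<theta> (w i))"
    by (rule prod_sum_PiE) auto
  finally have g5: "g \<eta> ^ 5 = (\<Sum>w\<in>{..<5::nat} \<rightarrow>\<^sub>E UNIV. \<Prod>i<5. \<eta> (w i) * \<theta> (w i))" .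
  have "\<eta> (5 ^ 5) * g \<eta> ^ 5 = (\<Sum>w\<in>{..<5::nat} \<rightarrow>\<^sub>E UNIV. M (interpolate w) * \<theta> (coeff (interpolate w) 4))"
  proof -
    have "M (interpolate w) = \<eta> (5 ^ 5) * (\<Prod>i<5. \<eta> (w i))" for w
    proof -
      have "(\<Prod>i<5. poly (interpolate w) (\<zeta> ^ i)) = (\<Prod>i<5. 5 * (w i * \<zeta> ^ (4 * i)))"
        by (intro prod.cong) (auto simp: poly_interpolate)
      also have "\<dots> = 5 ^ 5 * (\<Prod>i<5. w i) * (\<Prod>i<5. \<zeta> ^ (4 * i))"
        by (simp add: prod.distrib)
      \<comment> \<open>The exponent is 4 (0 + 1 + 2 + 3 + 4).\<close>
      also have "(\<Prod>i<5. \<zeta> ^ (4 * i)) = \<zeta> ^ 40" by (simp add: prod5 power_add[symmetric])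
      also have "\<zeta> ^ 40 = 1" by (simp add: zeta_pow_eq_1_iff)
      finally show ?thesis unfolding M_def by (simp only: mult_char_mult[OF \<eta>] mult_char_prod[OF \<eta>] mult_1_right)
    qed
    then show ?thesis
      unfolding g5 sum_distrib_left coeff_interpolate_4 \<theta>_sum
      by (intro sum.cong) (simp_all add: prod.distrib mult.assoc)
  qed
  also have "\<dots> = (\<Sum>h | degree h < 5. M h * \<theta> (coeff h 4))"
    by (rule sum.reindex_bij_betw[OF bij_interpolate])
  also have "{h :: 'a poly. degree h < 5} = {h. degree h < 4} \<union> {h. degree h = 4}" by auto
  also have "(\<Sum>h\<in>{h. degree h < 4} \<union> {h. degree h = 4}. M h * \<theta> (coeff h 4)) =
      (\<Sum>h | degree h < 4. M h * \<theta> (coeff h 4)) + (\<Sum>h | degree h = 4. M h * \<theta> (coeff h 4))"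
    by (rule sum.union_disjoint) (auto intro: finite_subset[OF _ finite_polys_le[of 4]])
  also have "(\<Sum>h | degree h < 4. M h * \<theta> (coeff h 4)) = (\<Sum>h | degree h < 4. M h)"
    by (intro sum.cong) (auto simp: coeff_eq_0 zero)
  also have "(\<Sum>h | degree h < 4. M h) = 0"
  proof -
    obtain a where a: "a \<noteq> 0" "\<eta> a ^ 5 \<noteq> 1"
      using nontriv by (auto simp: fun_eq_iff trivial_char_def mult_char_0[OF \<eta>] split: if_splits)
    have "(\<Sum>h | degree h < 4. M h) = (\<Sum>h | degree h < 4. M (smult a h))"
      by (rule sum.reindex_bij_witness[of _ "smult a" "smult (inverse a)"]) (use a in auto)
    also have "\<dots> = \<eta> a ^ 5 * (\<Sum>h | degree h < 4. M h)" by (simp add: M_smult sum_distrib_left)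
    finally have "(1 - \<eta> a ^ 5) * (\<Sum>h | degree h < 4. M h) = 0" by (simp add: algebra_simps)
    with a show ?thesis by simp
  qed
  also have "(\<Sum>h | degree h = 4. M h * \<theta> (coeff h 4)) =
      (\<Sum>(s, f)\<in>(UNIV - {0}) \<times> monics 4. M (smult s f) * \<theta> s)"
    by (rule sum.reindex_bij_witness[of _ "\<lambda>(s, f). smult s f" "\<lambda>h. (coeff h 4, smult (inverse (coeff h 4)) h)"])
       (auto simp: monics_def lead split: if_splits)
  also have "\<dots> = (\<Sum>s\<in>UNIV - {0}. \<Sum>f\<in>monics 4. \<eta> s ^ 5 * \<theta> s * M f)"
    by (subst sum.cartesian_product[symmetric]) (simp add: M_smult mult_ac)
  also have "\<dots> = (\<Sum>s\<in>UNIV - {0}. \<eta> s ^ 5 * \<theta> s) * (\<Sum>f\<in>monics 4. M f)"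
    by (simp add: sum_product)
  also have "(\<Sum>s\<in>UNIV - {0}. \<eta> s ^ 5 * \<theta> s) = g (\<lambda>x. \<eta> x ^ 5)"
    unfolding gauss_sum_def by (rule sum.mono_neutral_left) (auto simp: mult_char_0[OF \<eta>])
  finally show ?thesis by (simp add: M_def mult.commute)
qed

text \<open>If \<eta>^5 is trivial, \<eta> is a power of \<psi>, the twists permute these powers,
  and both sides are -q^2. Otherwise the product of the Jacobi sums, written in Gauss sums, and the
  interpolation formula both contain the same coefficient c of degree 4, which cancels.\<close>

lemma Hasse_Davenport:
  fixes \<eta> :: "'a \<Rightarrow> complex"
  assumes \<eta>: "mult_char \<eta>"
  shows "(\<Prod>j<5. g (tw \<eta> j)) = q ^ 2 * cnj (\<eta> (5 ^ 5)) * g (\<lambda>x. \<eta> x ^ 5)"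
proof (cases "(\<lambda>x. \<eta> x ^ 5) = trivial_char")
  case True
  have tors: "\<eta> x ^ 5 = 1" if "x \<noteq> 0" for x
    using fun_cong[OF True, of x] that by (simp add: trivial_char_def)
  then obtain m where m: "m < 5" "\<eta> = tw trivial_char m" using fifth_torsion[OF \<eta>] by blast
  have "tw \<eta> j = tw trivial_char ((m + j) mod 5)" for j
    by (simp add: m tw_tw tw_mod)
  then have "(\<Prod>j<5. g (tw \<eta> j)) = (\<Prod>j<5. g (tw trivial_char ((m + j) mod 5)))" by simp
  also have "\<dots> = (\<Prod>j<5. g (tw trivial_char j))"
  proof -
    have "m = 0 \<or> m = 1 \<or> m = 2 \<or> m = 3 \<or> m = 4" using m(1) by linarith
    then show ?thesis by (elim disjE) (simp_all add: prod5 mult_ac numeral_2_eq_2[symmetric])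
  qed
  finally show ?thesis
    using tors[OF five_nonzero] unfolding mult_char_power[OF \<eta>]
    by (simp add: prod_gauss_psi True gauss_trivial)
next
  case False
  have ntw: "tw \<eta> j \<noteq> trivial_char" for j
  proof
    assume eq: "tw \<eta> j = trivial_char"
    have "\<eta> x ^ 5 = trivial_char x" for x
      using tw_eq_trivialD[OF \<eta> eq, of x]
      by (cases "x = 0") (simp_all add: trivial_char_def mult_char_0[OF \<eta>])
    then show False using False by blast
  qed
  have nt: "\<eta> \<noteq> trivial_char" using ntw[of 0] by simp
  define c where "c = (\<Sum>f\<in>monics 4. \<eta> (\<Prod>i<5. poly f (\<zeta> ^ i)))"
  have J: "g (tw trivial_char i) * g \<eta> = jacobi_sum (\<lambda>x. \<psi> x ^ i) \<eta> * g (tw \<eta> i)" if "i \<in> {1..4}" for i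
  proof -
    have "(\<lambda>x. \<psi> x ^ i * \<eta> x) = tw \<eta> i" by (simp add: tw_def mult.commute)
    moreover have "(\<Sum>x\<in>UNIV. \<psi> x ^ i * \<eta> x) = 0"
      using sum_mult_char[OF mult_char_tw[OF \<eta>] ntw, of i] by (simp add: tw_def mult.commute)
    ultimately show ?thesis
      using gauss_mult[OF mult_char_psi_pow \<eta>, of i] that
      by (simp add: tw_trivial)
  qed
  have split: "(\<Prod>j<5. f j) = f 0 * (\<Prod>i=1..4. f i)" for f :: "nat \<Rightarrow> complex"
  proof -
    have set: "{1..4} = {1, 2, 3, 4 :: nat}" by auto
    show ?thesis unfolding prod5 set by simp
  qed
  have "(\<Prod>i=1..4. g (tw trivial_char i) * g \<eta>) = c * (\<Prod>i=1..4. g (tw \<eta> i))"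
    using J prod_jacobi_sum_eq[OF \<eta> nt] by (simp add: prod.distrib c_def)
  then have "(\<Prod>i=1..4. g (tw trivial_char i)) * g \<eta> ^ 4 = c * (\<Prod>i=1..4. g (tw \<eta> i))"
    by (simp add: prod.distrib)
  moreover have "(\<Prod>i=1..4. g (tw trivial_char i)) = q ^ 2"
    using prod_gauss_psi by (simp add: split gauss_trivial)
  moreover have "g \<eta> ^ 5 = g \<eta> * g \<eta> ^ 4" by (simp add: numeral_eq_Suc)
  ultimately have main: "q ^ 2 * g \<eta> ^ 5 = c * (\<Prod>j<5. g (tw \<eta> j))"
    by (simp add: split mult.left_commute)
  define F :: 'a where "F = 5 ^ 5"
  have hd: "\<eta> F * g \<eta> ^ 5 = c * g (\<lambda>x. \<eta> x ^ 5)"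
    unfolding c_def F_def by (rule monics_4_gauss[OF \<eta> False])
  have F: "F \<noteq> 0" unfolding F_def by (rule power_not_zero[OF five_nonzero])
  \<comment> \<open>A vanishing c would make g \<eta> vanish, whereas its product with the Gauss sum
    of the inverse character is q up to a sign.\<close>
  have "c \<noteq> 0"
  proof
    assume "c = 0"
    then have "g \<eta> = 0" using hd F by (simp add: mult_char_eq_0_iff[OF \<eta>])
    then show False using gauss_mult_cnj[OF \<eta> nt] q_neq_0 mult_char_eq_0_iff[OF \<eta>, of "-1"] by simp
  qed
  have "g \<eta> ^ 5 = (cnj (\<eta> F) * \<eta> F) * g \<eta> ^ 5"
    using mult_char_cnj_self[OF \<eta> F] by (simp add: mult.commute)
  also have "\<dots> = cnj (\<eta> F) * (c * g (\<lambda>x. \<eta> x ^ 5))" unfolding hd[symmetric] by (rule mult.assoc)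
  finally have "g \<eta> ^ 5 = cnj (\<eta> F) * (c * g (\<lambda>x. \<eta> x ^ 5))" .
  with main have "c * (\<Prod>j<5. g (tw \<eta> j)) = c * (q ^ 2 * cnj (\<eta> F) * g (\<lambda>x. \<eta> x ^ 5))"
    by (auto simp: mult_ac)
  then have "(\<Prod>j<5. g (tw \<eta> j)) = q ^ 2 * cnj (\<eta> F) * g (\<lambda>x. \<eta> x ^ 5)"
    using \<open>c \<noteq> 0\<close> by simp
  then show ?thesis unfolding F_def .
qed

end

section \<open>Sums over fifth powers\<close>

text \<open>The sum of the products \<open>x\<^sub>i x\<^sub>j x\<^sub>k x\<^sub>l x\<^sub>m\<close> over all \<open>(i, j, k, l, m)\<close> in \<open>(\<int>/5)\<^sup>5\<close> with sum \<open>0\<close>, where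
  \<open>(x\<^sub>0, \<dots>, x\<^sub>4) = (a, \<dots>, e)\<close>.\<close>

definition zero_sum_quintic :: "complex \<Rightarrow> complex \<Rightarrow> complex \<Rightarrow> complex \<Rightarrow> complex \<Rightarrow> complex" where
  "zero_sum_quintic a b c d e =
     a ^ 5 + b ^ 5 + c ^ 5 + d ^ 5 + e ^ 5 + 120 * a * b * c * d * e
     + 20 * (a ^ 3 * (b * e + c * d) + b ^ 3 * (c * a + d * e) + c ^ 3 * (d * b + e * a)
       + d ^ 3 * (e * c + a * b) + e ^ 3 * (a * d + b * c))
     + 30 * (a ^ 2 * b ^ 2 * d + b ^ 2 * c ^ 2 * e + c ^ 2 * d ^ 2 * a + d ^ 2 * e ^ 2 * b + e ^ 2 * a ^ 2 * c)
     + 30 * (a ^ 2 * c ^ 2 * b + b ^ 2 * d ^ 2 * c + c ^ 2 * e ^ 2 * d + d ^ 2 * a ^ 2 * e + e ^ 2 * b ^ 2 * a)"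

text \<open>Multiplication in the group ring of the integers modulo 5: the two sides differ by an
  explicit multiple of \<open>w ^ 5 - 1\<close>.\<close>

lemma cyclic_convolution:
  fixes w :: complex
  assumes "w ^ 5 = 1"
  shows "(a + w * b + w ^ 2 * c + w ^ 3 * d + w ^ 4 * e) * (a' + w * b' + w ^ 2 * c' + w ^ 3 * d' + w ^ 4 * e') =
    (a * a' + b * e' + c * d' + d * c' + e * b') + w * (a * b' + b * a' + c * e' + d * d' + e * c')
    + w ^ 2 * (a * c' + b * b' + c * a' + d * e' + e * d') + w ^ 3 * (a * d' + b * c' + c * b' + d * a' + e * e')
    + w ^ 4 * (a * e' + b * d' + c * c' + d * b' + e * a')" (is "?l = ?r")
proof -
  have "?l = ?r + (w ^ 5 - 1) * ((b * e' + c * d' + d * c' + e * b') + w * (c * e' + d * d' + e * c')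
      + w ^ 2 * (d * e' + e * d') + w ^ 3 * (e * e'))"
    by (simp add: algebra_simps numeral_eq_Suc)
  with assms show ?thesis by simp
qed

text \<open>Only the component of w^0 survives the later average over fifth roots of unity, so the
  other four stay unnamed. Squaring twice keeps the intermediate expressions small.\<close>

lemma quintic_power_expansion:
  obtains z1 z2 z3 z4 where
    "\<And>w. w ^ 5 = 1 \<Longrightarrow> (a + w * b + w ^ 2 * c + w ^ 3 * d + w ^ 4 * e) ^ 5 =
      zero_sum_quintic a b c d e + w * z1 + w ^ 2 * z2 + w ^ 3 * z3 + w ^ 4 * z4"
proof -
  define A0 A1 A2 A3 A4 where A: "A0 = a * a + b * e + c * d + d * c + e * b"
    "A1 = a * b + b * a + c * e + d * d + e * c" "A2 = a * c + b * b + c * a + d * e + e * d"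
    "A3 = a * d + b * c + c * b + d * a + e * e" "A4 = a * e + b * d + c * c + d * b + e * a"
  define B0 B1 B2 B3 B4 where B: "B0 = A0 * A0 + A1 * A4 + A2 * A3 + A3 * A2 + A4 * A1"
    "B1 = A0 * A1 + A1 * A0 + A2 * A4 + A3 * A3 + A4 * A2" "B2 = A0 * A2 + A1 * A1 + A2 * A0 + A3 * A4 + A4 * A3"
    "B3 = A0 * A3 + A1 * A2 + A2 * A1 + A3 * A0 + A4 * A4" "B4 = A0 * A4 + A1 * A3 + A2 * A2 + A3 * A1 + A4 * A0"
  have eq: "(a + w * b + w ^ 2 * c + w ^ 3 * d + w ^ 4 * e) ^ 5 =
      (a * B0 + b * B4 + c * B3 + d * B2 + e * B1) + w * (a * B1 + b * B0 + c * B4 + d * B3 + e * B2)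
      + w ^ 2 * (a * B2 + b * B1 + c * B0 + d * B4 + e * B3) + w ^ 3 * (a * B3 + b * B2 + c * B1 + d * B0 + e * B4)
      + w ^ 4 * (a * B4 + b * B3 + c * B2 + d * B1 + e * B0)" if w: "w ^ 5 = 1" for w :: complex
  proof -
    define p where "p = a + w * b + w ^ 2 * c + w ^ 3 * d + w ^ 4 * e"
    have "p * p = A0 + w * A1 + w ^ 2 * A2 + w ^ 3 * A3 + w ^ 4 * A4"
      unfolding p_def A by (rule cyclic_convolution[OF w])
    then have "(p * p) * (p * p) = B0 + w * B1 + w ^ 2 * B2 + w ^ 3 * B3 + w ^ 4 * B4"
      unfolding B by (simp only: cyclic_convolution[OF w])
    then have "p * ((p * p) * (p * p)) = (a + w * b + w ^ 2 * c + w ^ 3 * d + w ^ 4 * e)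
        * (B0 + w * B1 + w ^ 2 * B2 + w ^ 3 * B3 + w ^ 4 * B4)"
      by (simp only: p_def)
    moreover have "p ^ 5 = p * ((p * p) * (p * p))" by (simp add: numeral_eq_Suc)
    ultimately show ?thesis unfolding p_def by (simp only: cyclic_convolution[OF w])
  qed
  have "a * B0 + b * B4 + c * B3 + d * B2 + e * B1 = zero_sum_quintic a b c d e"
    unfolding zero_sum_quintic_def B A by (simp add: algebra_simps numeral_eq_Suc)
  with eq show ?thesis using that by simp
qed

context quintic_gauss
begin

lemma sum5: "(\<Sum>j<5. f j) = f 0 + f 1 + f 2 + f 3 + f (4 :: nat)"
proof -
  have "{..<5} = {0, 1, 2, 3, 4 :: nat}" by auto
  then show ?thesis by (simp add: add.assoc)
qed

lemma fifth_roots: "x ^ 5 = 1 \<longleftrightarrow> x \<in> (\<lambda>i. \<zeta> ^ i) ` {..<5}"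
proof -
  define P :: "'a poly" where "P = monom 1 5 - 1"
  have "coeff P 5 = 1" by (simp add: P_def)
  then have nz: "P \<noteq> 0" by auto
  have "degree P \<le> 5" unfolding P_def by (rule degree_diff_le) (simp_all add: degree_monom_le)
  then have "card {x. poly P x = 0} \<le> 5" using card_poly_roots_bound[OF nz] by simp
  then have le: "card {x :: 'a. x ^ 5 = 1} \<le> card ((\<lambda>i. \<zeta> ^ i) ` {..<5})"
    by (simp add: P_def poly_monom card_image[OF inj_zeta_pow])
  have "(\<lambda>i. \<zeta> ^ i) ` {..<5} \<subseteq> {x. x ^ 5 = 1}"
    by (auto simp: power_mult[symmetric] zeta_pow_eq_1_iff)
  then have "(\<lambda>i. \<zeta> ^ i) ` {..<5} = {x. x ^ 5 = 1}" using le by (intro card_seteq) auto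
  then show ?thesis by blast
qed

lemma card_fifth_roots:
  assumes u: "u \<noteq> 0"
  shows "of_nat (card {x. x ^ 5 = u}) = (\<Sum>j<5. \<psi> u ^ j)"
proof (cases "\<psi> u = 1")
  case True
  then obtain y where y: "u = y ^ 5" using psi_eq_1_iff[OF u] by blast
  then have y0: "y \<noteq> 0" using u by auto
  have "{x. x ^ 5 = u} = (\<lambda>i. \<zeta> ^ i * y) ` {..<5}"
  proof (intro equalityI subsetI)
    fix x assume "x \<in> {x. x ^ 5 = u}"
    then have "(x / y) ^ 5 = 1" using y y0 by (simp add: power_divide)
    then obtain i where "i < 5" "x / y = \<zeta> ^ i" using fifth_roots by auto
    then show "x \<in> (\<lambda>i. \<zeta> ^ i * y) ` {..<5}" using y0 by (auto simp: field_simps)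
  next
    fix x assume "x \<in> (\<lambda>i. \<zeta> ^ i * y) ` {..<5}"
    then obtain i where "x = \<zeta> ^ i * y" by blast
    then show "x \<in> {x. x ^ 5 = u}"
      by (simp add: y power_mult_distrib power_mult[symmetric] zeta_pow_eq_1_iff)
  qed
  moreover have "inj_on (\<lambda>i. \<zeta> ^ i * y) {..<5}" using inj_zeta_pow y0 by (auto simp: inj_on_def)
  ultimately have "card {x. x ^ 5 = u} = 5" by (simp add: card_image)
  then show ?thesis using True by simp
next
  case False
  then have "{x. x ^ 5 = u} = {}" using psi_eq_1_iff[OF u] by auto
  then show ?thesis using sum_psi_powers[of 1 u] False u by simp
qed

lemma sum_fifth_powers:
  fixes F :: "'a \<Rightarrow> complex"
  assumes "F 0 = 0"
  shows "(\<Sum>x\<in>UNIV. F (x ^ 5)) = (\<Sum>j<5. \<Sum>u\<in>UNIV. \<psi> u ^ j * F u)"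
proof -
  have "(\<Sum>x\<in>UNIV. F (x ^ 5)) = (\<Sum>u\<in>UNIV. \<Sum>x\<in>{x \<in> UNIV. x ^ 5 = u}. F (x ^ 5))"
    by (rule sum.group[symmetric]) auto
  also have "\<dots> = (\<Sum>u\<in>UNIV. (\<Sum>j<5. \<psi> u ^ j) * F u)"
  proof (rule sum.cong[OF refl])
    fix u
    have "(\<Sum>x\<in>{x \<in> UNIV. x ^ 5 = u}. F (x ^ 5)) = of_nat (card {x. x ^ 5 = u}) * F u" by simp
    then show "(\<Sum>x\<in>{x \<in> UNIV. x ^ 5 = u}. F (x ^ 5)) = (\<Sum>j<5. \<psi> u ^ j) * F u"
      using card_fifth_roots[of u] assms by (cases "u = 0") auto
  qed
  also have "\<dots> = (\<Sum>j<5. \<Sum>u\<in>UNIV. \<psi> u ^ j * F u)"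
    unfolding sum_distrib_right by (rule sum.swap)
  finally show ?thesis .
qed

text \<open>The exponential sum over fifth powers with its factor \<open>cnj (\<eta> z)\<close>
  removed. It depends on z only through the fifth root of unity \<open>cnj (\<psi> z)\<close>, which
  makes averages over z computable.\<close>

definition gsum :: "('a \<Rightarrow> complex) \<Rightarrow> 'a \<Rightarrow> complex" where
  "gsum \<eta> z = (\<Sum>j<5. cnj (\<psi> z) ^ j * g (tw \<eta> j))"

lemma sum_char_fifth_power:
  assumes \<eta>: "mult_char \<eta>" and z: "z \<noteq> 0"
  shows "(\<Sum>x\<in>UNIV. \<eta> x ^ 5 * \<theta> (z * x ^ 5)) = cnj (\<eta> z) * gsum \<eta> z"
proof -
  have "(\<Sum>x\<in>UNIV. \<eta> x ^ 5 * \<theta> (z * x ^ 5)) = (\<Sum>x\<in>UNIV. \<eta> (x ^ 5) * \<theta> (z * x ^ 5))"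
    by (simp only: mult_char_power[OF \<eta>])
  also have "\<dots> = (\<Sum>j<5. \<Sum>u\<in>UNIV. \<psi> u ^ j * (\<eta> u * \<theta> (z * u)))"
    by (rule sum_fifth_powers) (simp add: mult_char_0[OF \<eta>])
  also have "\<dots> = (\<Sum>j<5. \<Sum>u\<in>UNIV. tw \<eta> j u * \<theta> (z * u))"
    by (simp add: tw_def mult_ac)
  also have "\<dots> = (\<Sum>j<5. cnj (tw \<eta> j z) * g (tw \<eta> j))"
    by (simp only: gauss_scale[OF mult_char_tw[OF \<eta>] z])
  finally show ?thesis by (simp add: gsum_def tw_def sum_distrib_left mult_ac)
qed

lemma sum_fifth_power:
  assumes z: "z \<noteq> 0"
  shows "(\<Sum>x\<in>UNIV. \<theta> (z * x ^ 5)) = 1 + gsum trivial_char z"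
proof -
  have "(\<Sum>x\<in>UNIV. \<theta> (z * x ^ 5)) = \<theta> (z * 0 ^ 5) + (\<Sum>x\<in>UNIV - {0}. \<theta> (z * x ^ 5))"
    by (rule sum.remove) auto
  also have "(\<Sum>x\<in>UNIV - {0}. \<theta> (z * x ^ 5)) = (\<Sum>x\<in>UNIV. trivial_char x ^ 5 * \<theta> (z * x ^ 5))"
    by (rule sum.mono_neutral_cong_left) (auto simp: trivial_char_def)
  also have "\<dots> = gsum trivial_char z"
    using sum_char_fifth_power[OF mult_char_trivial z] z by (simp add: trivial_char_def)
  finally show ?thesis by (simp add: zero)
qed

lemma sum_cnj_psi: "i \<in> {1, 2, 3, 4} \<Longrightarrow> (\<Sum>z\<in>UNIV. cnj (\<psi> z) ^ i) = 0"
proof -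
  assume i: "i \<in> {1, 2, 3, 4 :: nat}"
  have "(\<Sum>z\<in>UNIV. cnj (\<psi> z) ^ i) = cnj (\<Sum>z\<in>UNIV. \<psi> z ^ i)" by simp
  also have "\<dots> = 0" using i by (subst sum_psi_pow) (auto dest: dvd_imp_le)
  finally show ?thesis .
qed

text \<open>Expand in powers of \<open>cnj (\<psi> z)\<close>, a fifth root of unity: the exponents
  1 to 4 sum to 0 over z, so only index vectors with sum 0 modulo 5 remain.\<close>

lemma sum_gsum_power:
  assumes S: "\<And>z. z \<noteq> 0 \<Longrightarrow> S z = a + cnj (\<psi> z) * b + cnj (\<psi> z) ^ 2 * c + cnj (\<psi> z) ^ 3 * d + cnj (\<psi> z) ^ 4 * e"
  shows "(\<Sum>z\<in>UNIV - {0}. S z ^ 5) = (q - 1) * zero_sum_quintic a b c d e"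
proof -
  obtain z1 z2 z3 z4 where Z: "\<And>w. w ^ 5 = 1 \<Longrightarrow> (a + w * b + w ^ 2 * c + w ^ 3 * d + w ^ 4 * e) ^ 5 =
      zero_sum_quintic a b c d e + w * z1 + w ^ 2 * z2 + w ^ 3 * z3 + w ^ 4 * z4"
    using quintic_power_expansion by blast
  define K where "K = zero_sum_quintic a b c d e"
  have "(\<Sum>z\<in>UNIV - {0}. S z ^ 5) = (\<Sum>z\<in>UNIV - {0}. K + cnj (\<psi> z) ^ 1 * z1 + cnj (\<psi> z) ^ 2 * z2
      + cnj (\<psi> z) ^ 3 * z3 + cnj (\<psi> z) ^ 4 * z4)"
  proof (rule sum.cong[OF refl])
    fix z :: 'a assume z: "z \<in> UNIV - {0}"
    then have "cnj (\<psi> z) ^ 5 = 1" using psi5[of z] by (simp flip: complex_cnj_power)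
    then show "S z ^ 5 = K + cnj (\<psi> z) ^ 1 * z1 + cnj (\<psi> z) ^ 2 * z2 + cnj (\<psi> z) ^ 3 * z3 + cnj (\<psi> z) ^ 4 * z4"
      using Z[of "cnj (\<psi> z)"] S z by (simp add: K_def)
  qed
  also have "\<dots> = of_nat (card (UNIV - {0 :: 'a})) * K + (\<Sum>z\<in>UNIV - {0}. cnj (\<psi> z) ^ 1) * z1
      + (\<Sum>z\<in>UNIV - {0}. cnj (\<psi> z) ^ 2) * z2 + (\<Sum>z\<in>UNIV - {0}. cnj (\<psi> z) ^ 3) * z3
      + (\<Sum>z\<in>UNIV - {0}. cnj (\<psi> z) ^ 4) * z4"
    by (simp only: sum.distrib sum_distrib_right sum_constant)
  also have "(\<Sum>z\<in>UNIV - {0}. cnj (\<psi> z) ^ i) = 0" if i: "i \<in> {1, 2, 3, 4}" for i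
  proof -
    have "(\<Sum>z\<in>UNIV - {0}. cnj (\<psi> z) ^ i) = (\<Sum>z\<in>UNIV. cnj (\<psi> z) ^ i)"
      by (rule sum.mono_neutral_left) (use i in \<open>auto simp: mult_char_0[OF psi]\<close>)
    then show ?thesis using sum_cnj_psi[OF i] by simp
  qed
  then have "of_nat (card (UNIV - {0 :: 'a})) * K + (\<Sum>z\<in>UNIV - {0}. cnj (\<psi> z) ^ 1) * z1
      + (\<Sum>z\<in>UNIV - {0}. cnj (\<psi> z) ^ 2) * z2 + (\<Sum>z\<in>UNIV - {0}. cnj (\<psi> z) ^ 3) * z3
      + (\<Sum>z\<in>UNIV - {0}. cnj (\<psi> z) ^ 4) * z4 = of_nat (card (UNIV - {0 :: 'a})) * K"
    by (simp del: power_one_right One_nat_def)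
  also have "of_nat (card (UNIV - {0 :: 'a})) = q - 1"
    using card_field_ge_2[where 'a = 'a] by (simp add: q_eq card_Diff_subset of_nat_diff)
  finally show ?thesis by (simp add: K_def)
qed

text \<open>Two characters with the same fifth power differ by a power of \<psi>, so fibres have at
  most 5 elements; with the right total count, \<open>sum_fibres\<close> applies once more.\<close>

lemma sum_over_fifth_powers:
  fixes \<Phi> :: "('a \<Rightarrow> complex) \<Rightarrow> complex"
  shows "(\<Sum>\<eta> | mult_char \<eta>. \<Phi> (\<lambda>x. \<eta> x ^ 5)) = 5 * (\<Sum>\<beta> | mult_char \<beta> \<and> \<beta> \<zeta> = 1. \<Phi> \<beta>)"
proof -
  have mc5: "mult_char (\<lambda>x. \<eta> x ^ 5)" if "mult_char \<eta>" for \<eta> :: "'a \<Rightarrow> complex"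
    by (simp add: mult_char_def power_mult_distrib mult_char_0[OF that] mult_char_eq_0_iff[OF that] mult_char_mult[OF that])
  have "(\<Sum>\<eta> | mult_char \<eta>. \<Phi> (\<lambda>x. \<eta> x ^ 5)) = of_nat 5 * (\<Sum>\<beta> | mult_char \<beta> \<and> \<beta> \<zeta> = 1. \<Phi> \<beta>)"
  proof (rule sum_fibres)
    show fin: "finite {\<eta> :: 'a \<Rightarrow> complex. mult_char \<eta>}" "finite {\<beta>. mult_char \<beta> \<and> \<beta> \<zeta> = 1}"
      using finite_mult_chars by (auto intro: finite_subset[OF _ finite_mult_chars])
    show "(\<lambda>x. \<eta> x ^ 5) \<in> {\<beta>. mult_char \<beta> \<and> \<beta> \<zeta> = 1}" if "\<eta> \<in> {\<eta>. mult_char \<eta>}" for \<eta>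
      using that mc5[of \<eta>] zeta5 mult_char_power[of \<eta> \<zeta> 5] mult_char_1[of \<eta>] by simp
    show "card {\<eta> \<in> {\<eta>. mult_char \<eta>}. (\<lambda>x. \<eta> x ^ 5) = \<beta>} \<le> 5" for \<beta> :: "'a \<Rightarrow> complex"
    proof (cases "{\<eta> \<in> {\<eta>. mult_char \<eta>}. (\<lambda>x. \<eta> x ^ 5) = \<beta>} = {}")
      case False
      then obtain \<eta> where \<eta>: "mult_char \<eta>" "(\<lambda>x. \<eta> x ^ 5) = \<beta>" by blast
      have "{\<eta> \<in> {\<eta>. mult_char \<eta>}. (\<lambda>x. \<eta> x ^ 5) = \<beta>} \<subseteq> (\<lambda>m. tw \<eta> m) ` {..<5}"
      proof
        fix \<eta>' assume "\<eta>' \<in> {\<eta> \<in> {\<eta>. mult_char \<eta>}. (\<lambda>x. \<eta> x ^ 5) = \<beta>}"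
        then have \<eta>': "mult_char \<eta>'" "(\<lambda>x. \<eta>' x ^ 5) = \<beta>" by auto
        define \<rho> where "\<rho> = (\<lambda>x. \<eta>' x * cnj (\<eta> x))"
        have \<rho>: "mult_char \<rho>" unfolding \<rho>_def by (intro mult_char_times mult_char_cnj \<eta> \<eta>')
        have "\<rho> x ^ 5 = 1" if "x \<noteq> 0" for x
        proof -
          have "\<eta>' x ^ 5 = \<eta> x ^ 5" using \<eta>(2) \<eta>'(2) by (metis)
          then have "\<rho> x ^ 5 = (\<eta> x * cnj (\<eta> x)) ^ 5" by (simp only: \<rho>_def power_mult_distrib)
          then show ?thesis using mult_char_cnj_self[OF \<eta>(1) that] by simp
        qed
        then obtain m where m: "m < 5" "\<rho> = tw trivial_char m" using fifth_torsion[OF \<rho>] by blast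
        have "\<eta>' x = tw \<eta> m x" for x
        proof (cases "x = 0")
          case False
          have "\<eta>' x = (\<eta>' x * cnj (\<eta> x)) * \<eta> x"
            using mult_char_cnj_self[OF \<eta>(1) False] by (simp add: mult.assoc mult.commute[of "cnj _"])
          also have "\<eta>' x * cnj (\<eta> x) = \<psi> x ^ m"
            using fun_cong[OF m(2), of x] False by (simp add: \<rho>_def tw_def trivial_char_def)
          finally show ?thesis by (simp add: tw_def)
        qed (simp add: tw_def mult_char_0[OF \<eta>(1)] mult_char_0[OF \<eta>'(1)])
        then show "\<eta>' \<in> (\<lambda>m. tw \<eta> m) ` {..<5}" using m(1) by blast
      qed
      then have "card {\<eta> \<in> {\<eta>. mult_char \<eta>}. (\<lambda>x. \<eta> x ^ 5) = \<beta>} \<le> card ((\<lambda>m. tw \<eta> m) ` {..<5})"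
        by (intro card_mono) auto
      also have "\<dots> \<le> 5" using card_image_le[of "{..<5}" "\<lambda>m. tw \<eta> m"] by simp
      finally show ?thesis .
    qed (simp only: card.empty)
    \<comment> \<open>Five times the indicator of \<beta>(\<zeta>) = 1 is the sum of \<beta> over
      the powers of \<zeta>; summing over \<beta> leaves only the power 1.\<close>
    show "card {\<eta> :: 'a \<Rightarrow> complex. mult_char \<eta>} = 5 * card {\<beta> :: 'a \<Rightarrow> complex. mult_char \<beta> \<and> \<beta> \<zeta> = 1}"
    proof -
      have "(of_nat (5 * card {\<beta> :: 'a \<Rightarrow> complex. mult_char \<beta> \<and> \<beta> \<zeta> = 1}) :: complex)
          = (\<Sum>\<beta>\<in>{\<beta> \<in> {\<beta>. mult_char \<beta>}. \<beta> \<zeta> = 1}. 5)" by simp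
      also have "\<dots> = (\<Sum>\<beta> | mult_char \<beta>. if \<beta> \<zeta> = 1 then 5 else 0)"
        by (rule sum.inter_filter[OF finite_mult_chars])
      also have "\<dots> = (\<Sum>\<beta> | mult_char \<beta>. \<Sum>k<5. \<beta> (\<zeta> ^ k))"
      proof (rule sum.cong[OF refl])
        fix \<beta> :: "'a \<Rightarrow> complex" assume "\<beta> \<in> {\<beta>. mult_char \<beta>}"
        then have \<beta>: "mult_char \<beta>" by simp
        have "\<beta> \<zeta> ^ 5 = 1" using mult_char_power[OF \<beta>, of \<zeta> 5] mult_char_1[OF \<beta>] zeta5 by simp
        then show "(if \<beta> \<zeta> = 1 then 5 else 0) = (\<Sum>k<5. \<beta> (\<zeta> ^ k))"
          by (simp add: mult_char_power[OF \<beta>] geometric_sum)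
      qed
      also have "\<dots> = (\<Sum>k<5. \<Sum>\<beta> | mult_char \<beta>. \<beta> (\<zeta> ^ k))" by (rule sum.swap)
      also have "\<dots> = (\<Sum>k<5::nat. if k = 0 then of_nat CARD('a) - 1 else 0)"
        by (intro sum.cong) (auto simp: sum_over_mult_chars zeta_pow_eq_1_iff dest: dvd_imp_le)
      also have "\<dots> = (\<Sum>\<beta> | mult_char \<beta>. \<beta> (1 :: 'a))" by (simp add: sum_over_mult_chars)
      also have "\<dots> = of_nat (card {\<eta> :: 'a \<Rightarrow> complex. mult_char \<eta>})" by (simp add: mult_char_1)
      finally show ?thesis by (simp only: of_nat_eq_iff)
    qed
  qed
  then show ?thesis by simp
qed

text \<open>Replacing x by \<zeta> x preserves x^5 and multiplies the sum by \<beta>(\<zeta>). Only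
  characters trivial on \<zeta>, that is fifth powers, contribute to the count.\<close>

lemma sum_char_fifth_power_eq_0:
  assumes \<beta>: "mult_char \<beta>" and "\<beta> \<zeta> \<noteq> 1"
  shows "(\<Sum>x\<in>UNIV. \<beta> x * \<theta> (z * x ^ 5)) = 0"
proof -
  have "(\<Sum>x\<in>UNIV. \<beta> x * \<theta> (z * x ^ 5)) = (\<Sum>x\<in>UNIV. \<beta> (\<zeta> * x) * \<theta> (z * (\<zeta> * x) ^ 5))"
    by (rule sum.reindex_bij_witness[of _ "\<lambda>x. \<zeta> * x" "\<lambda>x. x / \<zeta>"]) (use zeta_nonzero in auto)
  also have "\<dots> = \<beta> \<zeta> * (\<Sum>x\<in>UNIV. \<beta> x * \<theta> (z * x ^ 5))"
    by (simp add: mult_char_mult[OF \<beta>] power_mult_distrib zeta5 sum_distrib_left mult.assoc)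
  finally have "(1 - \<beta> \<zeta>) * (\<Sum>x\<in>UNIV. \<beta> x * \<theta> (z * x ^ 5)) = 0" by (simp add: algebra_simps)
  with assms show ?thesis by simp
qed

end

section \<open>The number of affine points\<close>

lemma prod_sum_vec:
  fixes h :: "'n::finite \<Rightarrow> 'a::finite \<Rightarrow> 'c::comm_semiring_1"
  shows "(\<Prod>i\<in>UNIV. \<Sum>y\<in>UNIV. h i y) = (\<Sum>v\<in>(UNIV :: ('a ^ 'n) set). \<Prod>i\<in>UNIV. h i (v $ i))"
proof -
  have "(\<Prod>i\<in>UNIV. \<Sum>y\<in>UNIV. h i y) = (\<Sum>f\<in>UNIV. \<Prod>i\<in>UNIV. h i (f i))"
    by (subst prod_sum_PiE) (simp_all add: PiE_UNIV_domain)
  also have "\<dots> = (\<Sum>v\<in>(UNIV :: ('a ^ 'n) set). \<Prod>i\<in>UNIV. h i (v $ i))"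
    by (rule sum.reindex_bij_witness[of _ vec_nth vec_lambda]) auto
  finally show ?thesis .
qed

lemma UNIV_5: "(UNIV :: 5 set) = {1, 2, 3, 4, 5}"
proof -
  have "x \<in> {1, 2, 3, 4, 5}" for x :: 5
  proof (cases x)
    case (of_int z)
    then have "z = 0 \<or> z = 1 \<or> z = 2 \<or> z = 3 \<or> z = 4" by fastforce
    then show ?thesis using of_int by auto
  qed
  then show ?thesis by blast
qed

lemma sum_UNIV_5: "(\<Sum>i\<in>(UNIV :: 5 set). f i) = f 1 + f 2 + f 3 + f 4 + f 5"
  unfolding UNIV_5 by (simp add: add.assoc)

lemma prod_UNIV_5: "(\<Prod>i\<in>(UNIV :: 5 set). f i) = f 1 * f 2 * f 3 * f 4 * f 5"
  unfolding UNIV_5 by (simp add: mult.assoc)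

definition dwork_form :: "'a::field \<Rightarrow> 'a ^ 5 \<Rightarrow> 'a" where
  "dwork_form lam v = (\<Sum>i\<in>UNIV. (v $ i) ^ 5) - 5 * lam * (\<Prod>i\<in>UNIV. v $ i)"

context quintic_gauss
begin

lemma additive_sum: "\<theta> (\<Sum>i\<in>A. f i) = (\<Prod>i\<in>A. \<theta> (f i))"
  by (induction A rule: infinite_finite_induct) (auto simp: zero add)

text \<open>The expansion in multiplicative characters covers only vectors with all coordinates
  nonzero. The first two terms supply the others, as all vectors minus those without a zero
  coordinate.\<close>

lemma sum_dwork_form:
  assumes lam: "lam \<noteq> 0" and z: "z \<noteq> 0"
  shows "(\<Sum>v\<in>UNIV. \<theta> (z * dwork_form lam v)) = (1 + gsum trivial_char z) ^ 5 - gsum trivial_char z ^ 5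
    + 1 / (q - 1) * (\<Sum>\<beta> | mult_char \<beta>. g (\<lambda>x. cnj (\<beta> x)) * \<beta> (- 5 * lam * z) *
        (\<Sum>x\<in>UNIV. \<beta> x * \<theta> (z * x ^ 5)) ^ 5)"
proof -
  define c where "c = - 5 * lam * z"
  have c: "c \<noteq> 0" using lam z five_nonzero by (simp add: c_def)
  have pw: "(\<Sum>y\<in>UNIV. h y) ^ 5 = (\<Sum>v\<in>(UNIV :: ('a ^ 5) set). \<Prod>i\<in>UNIV. h (v $ i))" for h :: "'a \<Rightarrow> complex"
    using prod_sum_vec[of "\<lambda>(_ :: 5). h"] by simp
  \<comment> \<open>Every multiplicative character vanishes at 0, so
    \<open>1 - trivial_char P\<close> restores the value 1 of \<theta> at P = 0.\<close>
  have expand: "\<theta> (c * P) = 1 - trivial_char P + 1 / (q - 1) * (\<Sum>\<beta> | mult_char \<beta>. g (\<lambda>x. cnj (\<beta> x)) * \<beta> (c * P))" for P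
  proof (cases "P = 0")
    case True
    then show ?thesis by (simp add: trivial_char_def zero mult_char_0)
  next
    case False
    then have "(q - 1) * \<theta> (c * P) = (\<Sum>\<beta> | mult_char \<beta>. g (\<lambda>x. cnj (\<beta> x)) * \<beta> (c * P))"
      using c by (intro additive_char_expansion) simp
    then show ?thesis using q_neq_1 False by (simp add: trivial_char_def field_simps)
  qed
  define Th where "Th v = (\<Prod>i\<in>UNIV. \<theta> (z * (v $ i) ^ 5))" for v :: "'a ^ 5"
  have "\<theta> (z * dwork_form lam v) = Th v - trivial_char (\<Prod>i\<in>UNIV. v $ i) * Th v
      + (\<Sum>\<beta> | mult_char \<beta>. 1 / (q - 1) * (g (\<lambda>x. cnj (\<beta> x)) * \<beta> (c * (\<Prod>i\<in>UNIV. v $ i)) * Th v))" for v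
  proof -
    have "z * dwork_form lam v = (\<Sum>i\<in>UNIV. z * (v $ i) ^ 5) + c * (\<Prod>i\<in>UNIV. v $ i)"
      by (simp add: dwork_form_def c_def right_diff_distrib sum_distrib_left mult_ac)
    then have "\<theta> (z * dwork_form lam v) = Th v * \<theta> (c * (\<Prod>i\<in>UNIV. v $ i))"
      by (simp only: add additive_sum Th_def)
    then show ?thesis
      unfolding expand by (simp add: algebra_simps sum_distrib_left)
  qed
  then have "(\<Sum>v\<in>UNIV. \<theta> (z * dwork_form lam v)) = (\<Sum>v\<in>UNIV. Th v)
      - (\<Sum>v\<in>UNIV. trivial_char (\<Prod>i\<in>UNIV. v $ i) * Th v)
      + 1 / (q - 1) * (\<Sum>v\<in>UNIV. \<Sum>\<beta> | mult_char \<beta>. g (\<lambda>x. cnj (\<beta> x)) * \<beta> (c * (\<Prod>i\<in>UNIV. v $ i)) * Th v)"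
    by (simp only: sum.distrib sum_subtractf sum_distrib_left)
  also have "(\<Sum>v\<in>UNIV. Th v) = (1 + gsum trivial_char z) ^ 5"
    unfolding sum_fifth_power[OF z, symmetric] Th_def by (rule pw[symmetric])
  also have char: "(\<Sum>v\<in>UNIV. \<beta> (\<Prod>i\<in>UNIV. v $ i) * Th v) = (\<Sum>x\<in>UNIV. \<beta> x * \<theta> (z * x ^ 5)) ^ 5"
    if "mult_char \<beta>" for \<beta>
    unfolding pw Th_def mult_char_prod[OF that] prod.distrib ..
  have "(\<Sum>v\<in>UNIV. trivial_char (\<Prod>i\<in>UNIV. v $ i) * Th v) = gsum trivial_char z ^ 5"
  proof -
    have "(\<Sum>x\<in>UNIV. trivial_char x * \<theta> (z * x ^ 5)) = (\<Sum>x\<in>UNIV. trivial_char x ^ 5 * \<theta> (z * x ^ 5))"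
      by (rule sum.cong) (auto simp: trivial_char_def)
    also have "\<dots> = gsum trivial_char z"
      using sum_char_fifth_power[OF mult_char_trivial z] z by (simp add: trivial_char_def)
    finally show ?thesis using char[OF mult_char_trivial] by simp
  qed
  also have "(\<Sum>v\<in>UNIV. \<Sum>\<beta> | mult_char \<beta>. g (\<lambda>x. cnj (\<beta> x)) * \<beta> (c * (\<Prod>i\<in>UNIV. v $ i)) * Th v) =
      (\<Sum>\<beta> | mult_char \<beta>. g (\<lambda>x. cnj (\<beta> x)) * \<beta> c * (\<Sum>v\<in>UNIV. \<beta> (\<Prod>i\<in>UNIV. v $ i) * Th v))"
    by (subst sum.swap, intro sum.cong) (auto simp: mult_char_mult sum_distrib_left mult_ac)
  also have "\<dots> = (\<Sum>\<beta> | mult_char \<beta>. g (\<lambda>x. cnj (\<beta> x)) * \<beta> c * (\<Sum>x\<in>UNIV. \<beta> x * \<theta> (z * x ^ 5)) ^ 5)"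
    by (intro sum.cong) (auto simp: char)
  finally show ?thesis unfolding c_def .
qed

definition GG :: "('a \<Rightarrow> complex) \<Rightarrow> nat \<Rightarrow> complex" where
  "GG \<eta> j = g (tw \<eta> j)"

definition HH :: "('a \<Rightarrow> complex) \<Rightarrow> nat \<Rightarrow> complex" where
  "HH \<eta> j = g (\<lambda>x. cnj (tw \<eta> j x))"

abbreviation quintic_sum :: "('a \<Rightarrow> complex) \<Rightarrow> complex" where
  "quintic_sum \<eta> \<equiv> zero_sum_quintic (GG \<eta> 0) (GG \<eta> 1) (GG \<eta> 2) (GG \<eta> 3) (GG \<eta> 4)"

abbreviation G_psi :: "nat \<Rightarrow> complex" where
  "G_psi \<equiv> GG trivial_char"

abbreviation quintic_sum_psi :: "complex \<Rightarrow> complex" where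
  "quintic_sum_psi a \<equiv> zero_sum_quintic a (G_psi 1) (G_psi 2) (G_psi 3) (G_psi 4)"

text \<open>Summing \<theta>(z F) over z detects F = 0. The term z = 0 gives q^5, and the average
  over nonzero z extracts the index vectors with sum 0 modulo 5.\<close>

lemma affine_count_raw:
  assumes lam: "lam \<noteq> 0"
  shows "q * of_nat (card {v. dwork_form lam v = 0}) = q ^ 5
    + (q - 1) * (quintic_sum_psi 0
      - quintic_sum_psi (- 1))
    + 1 / 5 * (\<Sum>\<eta> | mult_char \<eta>. g (\<lambda>x. cnj (\<eta> x ^ 5)) * \<eta> ((- 5 * lam) ^ 5)
        * quintic_sum \<eta>)"
proof -
  have gsum_eq: "gsum \<eta> z = GG \<eta> 0 + cnj (\<psi> z) * GG \<eta> 1 + cnj (\<psi> z) ^ 2 * GG \<eta> 2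
      + cnj (\<psi> z) ^ 3 * GG \<eta> 3 + cnj (\<psi> z) ^ 4 * GG \<eta> 4" for \<eta> z
    by (simp add: gsum_def sum5 GG_def)
  have triv0: "G_psi 0 = - 1" by (simp add: GG_def gauss_trivial)
  \<comment> \<open>The first argument is 0 because the trivial character has Gauss sum -1, which
    the summand 1 cancels.\<close>
  have z1: "(\<Sum>z\<in>UNIV - {0}. (1 + gsum trivial_char z) ^ 5) = (q - 1) *
      quintic_sum_psi 0"
    by (rule sum_gsum_power) (simp add: gsum_eq triv0)
  have z2: "(\<Sum>z\<in>UNIV - {0}. gsum \<eta> z ^ 5) = (q - 1) *
      quintic_sum \<eta>" for \<eta>
    by (rule sum_gsum_power) (simp add: gsum_eq)
  define \<Phi> where "\<Phi> \<beta> = (\<Sum>z\<in>UNIV - {0}. g (\<lambda>x. cnj (\<beta> x)) * \<beta> (- 5 * lam * z) *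
        (\<Sum>x\<in>UNIV. \<beta> x * \<theta> (z * x ^ 5)) ^ 5)" for \<beta>
  have "(\<Sum>\<beta> | mult_char \<beta>. \<Phi> \<beta>) = (\<Sum>\<beta> | mult_char \<beta> \<and> \<beta> \<zeta> = 1. \<Phi> \<beta>)"
    by (rule sum.mono_neutral_right)
       (auto simp: finite_mult_chars \<Phi>_def sum_char_fifth_power_eq_0)
  then have \<Phi>_sum: "(\<Sum>\<beta> | mult_char \<beta>. \<Phi> \<beta>) = 1 / 5 * (\<Sum>\<eta> | mult_char \<eta>. \<Phi> (\<lambda>x. \<eta> x ^ 5))"
    unfolding sum_over_fifth_powers by simp
  have \<Phi>_eq: "\<Phi> (\<lambda>x. \<eta> x ^ 5) = (q - 1) * (g (\<lambda>x. cnj (\<eta> x ^ 5)) * \<eta> ((- 5 * lam) ^ 5)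
        * quintic_sum \<eta>)" if \<eta>: "mult_char \<eta>" for \<eta>
  proof -
    have "\<Phi> (\<lambda>x. \<eta> x ^ 5) = (\<Sum>z\<in>UNIV - {0}. g (\<lambda>x. cnj (\<eta> x ^ 5)) * \<eta> ((- 5 * lam) ^ 5) * gsum \<eta> z ^ 5)"
      unfolding \<Phi>_def
    proof (rule sum.cong[OF refl])
      fix z :: 'a assume "z \<in> UNIV - {0}"
      then have z: "z \<noteq> 0" by simp
      \<comment> \<open>The factor \<eta>(z)^5 from the mixed monomial cancels the conjugates from
        the five sums, and only \<open>gsum\<close> still depends on z.\<close>
      have "\<eta> (- 5 * lam * z) ^ 5 * (cnj (\<eta> z) * gsum \<eta> z) ^ 5 =
          \<eta> (- 5 * lam) ^ 5 * (\<eta> z * cnj (\<eta> z)) ^ 5 * gsum \<eta> z ^ 5"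
        unfolding mult_char_mult[OF \<eta>, of "- 5 * lam"] by (simp add: power_mult_distrib mult_ac)
      then show "g (\<lambda>x. cnj (\<eta> x ^ 5)) * \<eta> (- 5 * lam * z) ^ 5 * (\<Sum>x\<in>UNIV. \<eta> x ^ 5 * \<theta> (z * x ^ 5)) ^ 5 =
          g (\<lambda>x. cnj (\<eta> x ^ 5)) * \<eta> ((- 5 * lam) ^ 5) * gsum \<eta> z ^ 5"
        unfolding sum_char_fifth_power[OF \<eta> z] mult_char_power[OF \<eta>] mult_char_cnj_self[OF \<eta> z]
        by (simp only: mult.assoc power_one mult_1_left)
    qed
    then show ?thesis by (simp add: sum_distrib_left[symmetric] z2)
  qed
  have "q * of_nat (card {v. dwork_form lam v = 0}) = (\<Sum>v\<in>{v \<in> UNIV. dwork_form lam v = 0}. q)"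
    by simp
  also have "\<dots> = (\<Sum>v\<in>UNIV. if dwork_form lam v = 0 then q else 0)"
    by (rule sum.inter_filter) simp
  also have "\<dots> = (\<Sum>v\<in>UNIV. \<Sum>z\<in>UNIV. \<theta> (dwork_form lam v * z))"
    by (simp only: sum_additive)
  also have "\<dots> = (\<Sum>z\<in>UNIV. \<Sum>v\<in>UNIV. \<theta> (z * dwork_form lam v))"
    by (subst sum.swap) (simp add: mult.commute)
  also have "\<dots> = (\<Sum>v\<in>(UNIV :: ('a ^ 5) set). \<theta> (0 * dwork_form lam v))
      + (\<Sum>z\<in>UNIV - {0}. \<Sum>v\<in>UNIV. \<theta> (z * dwork_form lam v))"
    by (rule sum.remove) auto
  also have "(\<Sum>v\<in>(UNIV :: ('a ^ 5) set). \<theta> (0 * dwork_form lam v)) = q ^ 5"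
    using prod_sum_vec[of "\<lambda>(_ :: 5) (_ :: 'a). 1 :: complex"] by (simp add: zero q_eq)
  also have "(\<Sum>z\<in>UNIV - {0}. \<Sum>v\<in>UNIV. \<theta> (z * dwork_form lam v)) =
      (\<Sum>z\<in>UNIV - {0}. (1 + gsum trivial_char z) ^ 5) - (\<Sum>z\<in>UNIV - {0}. gsum trivial_char z ^ 5)
      + 1 / (q - 1) * (\<Sum>\<beta> | mult_char \<beta>. \<Phi> \<beta>)"
  proof -
    have "(\<Sum>z\<in>UNIV - {0}. \<Sum>v\<in>UNIV. \<theta> (z * dwork_form lam v)) = (\<Sum>z\<in>UNIV - {0}.
        (1 + gsum trivial_char z) ^ 5 - gsum trivial_char z ^ 5
        + 1 / (q - 1) * (\<Sum>\<beta> | mult_char \<beta>. g (\<lambda>x. cnj (\<beta> x)) * \<beta> (- 5 * lam * z) *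
        (\<Sum>x\<in>UNIV. \<beta> x * \<theta> (z * x ^ 5)) ^ 5))"
      by (intro sum.cong refl sum_dwork_form[OF lam]) simp
    also have "\<dots> = (\<Sum>z\<in>UNIV - {0}. (1 + gsum trivial_char z) ^ 5) - (\<Sum>z\<in>UNIV - {0}. gsum trivial_char z ^ 5)
        + 1 / (q - 1) * (\<Sum>z\<in>UNIV - {0}. \<Sum>\<beta> | mult_char \<beta>. g (\<lambda>x. cnj (\<beta> x)) * \<beta> (- 5 * lam * z) *
        (\<Sum>x\<in>UNIV. \<beta> x * \<theta> (z * x ^ 5)) ^ 5)"
      by (simp only: sum.distrib sum_subtractf sum_distrib_left)
    also have "(\<Sum>z\<in>UNIV - {0}. \<Sum>\<beta> | mult_char \<beta>. g (\<lambda>x. cnj (\<beta> x)) * \<beta> (- 5 * lam * z) *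
        (\<Sum>x\<in>UNIV. \<beta> x * \<theta> (z * x ^ 5)) ^ 5) = (\<Sum>\<beta> | mult_char \<beta>. \<Phi> \<beta>)"
      unfolding \<Phi>_def by (rule sum.swap)
    finally show ?thesis .
  qed
  also have "(\<Sum>\<beta> | mult_char \<beta>. \<Phi> \<beta>) = (q - 1) * (1 / 5 * (\<Sum>\<eta> | mult_char \<eta>. g (\<lambda>x. cnj (\<eta> x ^ 5)) * \<eta> ((- 5 * lam) ^ 5)
        * quintic_sum \<eta>))"
    unfolding \<Phi>_sum by (simp add: sum_distrib_left \<Phi>_eq)
  finally show ?thesis
    unfolding z1 z2 triv0 using q_neq_1 by (simp add: right_diff_distrib)
qed

text \<open>The product formula for the inverse of \<eta>: conjugation sends the index j to 4 j,
  that is to -j modulo 5, which only permutes the factors.\<close>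

lemma prod_HH:
  fixes \<eta> :: "'a \<Rightarrow> complex"
  assumes \<eta>: "mult_char \<eta>"
  shows "HH \<eta> 0 * HH \<eta> 1 * HH \<eta> 2 * HH \<eta> 3 * HH \<eta> 4 = q ^ 2 * \<eta> (5 ^ 5) * g (\<lambda>x. cnj (\<eta> x ^ 5))"
proof -
  define \<eta>' where "\<eta>' = (\<lambda>x. cnj (\<eta> x))"
  have \<eta>': "mult_char \<eta>'" unfolding \<eta>'_def by (rule mult_char_cnj[OF \<eta>])
  have H: "HH \<eta> j = g (tw \<eta>' ((4 * j) mod 5))" for j
  proof -
    have "cnj (tw \<eta> j x) = tw \<eta>' (4 * j) x" for x
    proof (cases "x = 0")
      case False
      then show ?thesis by (simp add: tw_def \<eta>'_def cnj_psi power_mult)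
    qed (simp add: tw_def \<eta>'_def mult_char_0[OF \<eta>])
    then show ?thesis unfolding HH_def tw_mod[OF \<eta>'] by simp
  qed
  have "HH \<eta> 0 * HH \<eta> 1 * HH \<eta> 2 * HH \<eta> 3 * HH \<eta> 4 = (\<Prod>j<5. g (tw \<eta>' j))"
    unfolding H prod5 by (simp add: mult_ac)
  then show ?thesis
    using Hasse_Davenport[OF \<eta>'] by (simp add: \<eta>'_def)
qed

text \<open>The factor \<eta>(5^5) contained in \<eta>((-5 \<lambda>)^5) is exactly the one in the
  product formula. This is why the coefficient 5 in the equation leaves the pure argument
  \<lambda>^5.\<close>

lemma affine_count:
  assumes lam: "lam \<noteq> 0"
  shows "q * of_nat (card {v. dwork_form lam v = 0}) = q ^ 5
    + (q - 1) * (quintic_sum_psi 0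
      - quintic_sum_psi (- 1))
    + 1 / (5 * q ^ 2) * (\<Sum>\<eta> | mult_char \<eta>. \<eta> (-1) * \<eta> (lam ^ 5)
        * quintic_sum \<eta>
        * (HH \<eta> 0 * HH \<eta> 1 * HH \<eta> 2 * HH \<eta> 3 * HH \<eta> 4))"
proof -
  have "(\<Sum>\<eta> | mult_char \<eta>. \<eta> (-1) * \<eta> (lam ^ 5)
        * quintic_sum \<eta>
        * (HH \<eta> 0 * HH \<eta> 1 * HH \<eta> 2 * HH \<eta> 3 * HH \<eta> 4)) =
      (\<Sum>\<eta> | mult_char \<eta>. q ^ 2 * (g (\<lambda>x. cnj (\<eta> x ^ 5)) * \<eta> ((- 5 * lam) ^ 5)
        * quintic_sum \<eta>))"
  proof (rule sum.cong[OF refl])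
    fix \<eta> :: "'a \<Rightarrow> complex" assume "\<eta> \<in> {\<eta>. mult_char \<eta>}"
    then have \<eta>: "mult_char \<eta>" by simp
    have "(- 5 * lam) ^ 5 = (- 1) * (lam ^ 5 * 5 ^ 5)" by (simp add: power_mult_distrib)
    then have "\<eta> ((- 5 * lam) ^ 5) = \<eta> (-1) * \<eta> (lam ^ 5) * \<eta> (5 ^ 5)"
      by (simp only: mult_char_mult[OF \<eta>] mult.assoc)
    then show "\<eta> (-1) * \<eta> (lam ^ 5)
        * quintic_sum \<eta>
        * (HH \<eta> 0 * HH \<eta> 1 * HH \<eta> 2 * HH \<eta> 3 * HH \<eta> 4) = q ^ 2 * (g (\<lambda>x. cnj (\<eta> x ^ 5)) * \<eta> ((- 5 * lam) ^ 5)
        * quintic_sum \<eta>)"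
      unfolding prod_HH[OF \<eta>] by (simp only: mult_ac)
  qed
  then show ?thesis
    unfolding affine_count_raw[OF lam] using q_neq_0 by (simp add: sum_distrib_left[symmetric])
qed

end

text \<open>One representative of each rotation class of the monomials in
  \<open>zero_sum_quintic\<close>, with its multiplicity. The monomial
  \<open>a * b * c * d * e\<close> is fixed by rotation, so its coefficient 120 is divided among the
  five rotations.\<close>

definition rotation_term :: "complex \<Rightarrow> complex \<Rightarrow> complex \<Rightarrow> complex \<Rightarrow> complex \<Rightarrow> complex" where
  "rotation_term a b c d e = a ^ 5 + 20 * (a ^ 3 * (b * e + c * d)) + 30 * (a ^ 2 * b ^ 2 * d)
     + 30 * (a ^ 2 * c ^ 2 * b) + 24 * (a * b * c * d * e)"

lemma zero_sum_quintic_rotations: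
  "zero_sum_quintic a b c d e = rotation_term a b c d e + rotation_term b c d e a + rotation_term c d e a b
     + rotation_term d e a b c + rotation_term e a b c d"
  unfolding zero_sum_quintic_def rotation_term_def by (simp add: algebra_simps)

text \<open>With \<open>G\<^sub>i\<close> for \<open>a, b, c, \<dots>\<close> and \<open>H\<^sub>i\<close> for \<open>A, \<dots>, E\<close>, this is, up to sign,
  \<open>rotation_term\<close> times \<open>H\<^sub>0 \<dots> H\<^sub>4 / q\<^sup>2\<close> as soon as \<open>G\<^sub>i H\<^sub>i = \<plusminus>q\<close> for all \<open>i\<close>.\<close>

definition generic_polynomial where
  "generic_polynomial (q :: complex) a b c A B C D E = a ^ 4 * (B * C * D * E) / q + 20 * q * (a ^ 2 * (C * D)) + 20 * q * (a ^ 2 * (B * E))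
     + 30 * q * (a * b * (C * E)) + 30 * q * (a * c * (D * E)) + 24 * q ^ 3"

lemma rotation_term_times:
  "rotation_term a b c d e * (A * B * C * D * E) = (a * A) * (a ^ 4 * (B * C * D * E))
     + 20 * ((a * A) * (b * B) * (e * E)) * (a ^ 2 * (C * D)) + 20 * ((a * A) * (c * C) * (d * D)) * (a ^ 2 * (B * E))
     + 30 * ((a * A) * (b * B) * (d * D)) * (a * b * (C * E)) + 30 * ((a * A) * (b * B) * (c * C)) * (a * c * (D * E))
     + 24 * ((a * A) * (b * B) * (c * C) * (d * D) * (e * E))"
  unfolding rotation_term_def by (simp add: algebra_simps numeral_eq_Suc)

text \<open>The variables are named so that the normal form of a product has the factors of each of the two
  relations next to each other.\<close>

lemma generic_polynomial_exceptional:
  assumes q: "q \<noteq> 0" and r: "x1 * x2 = q" "x3 * x4 = (q :: complex)"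
  shows "generic_polynomial q (- 1) x1 x3 (- 1) x2 x4 x3 x1 + generic_polynomial q x1 x3 x4 x2 x4 x3 x1 (- 1)
    + generic_polynomial q x3 x4 x2 x4 x3 x1 (- 1) x2 + generic_polynomial q x4 x2 (- 1) x3 x1 (- 1) x2 x4
    + generic_polynomial q x2 (- 1) x1 x1 (- 1) x2 x4 x3 =
    (q - 1) * zero_sum_quintic 0 x1 x3 x4 x2 - q * zero_sum_quintic (- 1) x1 x3 x4 x2"
proof -
  have r': "x1 * (x2 * y) = q * y" "x3 * (x4 * y) = q * y" for y
    using r by (simp_all add: mult.assoc[symmetric])
  \<comment> \<open>Each numerator contains a pair with product q, so the divisions can be carried
    out before the expansion.\<close>
  have d: "(- 1) ^ 4 * (x2 * x4 * x3 * x1) / q = q" "x1 ^ 4 * (x4 * x3 * x1 * (- 1)) / q = - (x1 ^ 5)"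
    "x3 ^ 4 * (x3 * x1 * (- 1) * x2) / q = - (x3 ^ 5)" "x4 ^ 4 * (x1 * (- 1) * x2 * x4) / q = - (x4 ^ 5)"
    "x2 ^ 4 * ((- 1) * x2 * x4 * x3) / q = - (x2 ^ 5)"
    using q by (simp_all add: numeral_eq_Suc mult_ac r r' divide_eq_eq)
  show ?thesis
    unfolding generic_polynomial_def zero_sum_quintic_def d
    by (simp add: algebra_simps numeral_eq_Suc r r')
qed

context quintic_gauss
begin

lemma GG_tw: "mult_char \<eta> \<Longrightarrow> GG (tw \<eta> i) j = GG \<eta> ((i + j) mod 5)"
  and HH_tw: "mult_char \<eta> \<Longrightarrow> HH (tw \<eta> i) j = HH \<eta> ((i + j) mod 5)"
  by (simp_all add: GG_def HH_def tw_tw tw_mod)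

lemma sum_over_tw:
  fixes F :: "('a \<Rightarrow> complex) \<Rightarrow> complex"
  shows "(\<Sum>\<eta> | mult_char \<eta>. F (tw \<eta> i)) = (\<Sum>\<eta> | mult_char \<eta>. F \<eta>)"
proof (cases "i = 0")
  case False
  then show ?thesis
    unfolding tw_def by (intro sum_over_mult_chars_times mult_char_psi_pow) simp
qed simp

text \<open>The sign does not depend on j, because \<psi>(-1) = 1.\<close>

lemma GG_HH:
  assumes "mult_char \<eta>" "tw \<eta> j \<noteq> trivial_char"
  shows "GG \<eta> j * HH \<eta> j = \<eta> (-1) * q"
  using gauss_mult_cnj[OF mult_char_tw[OF assms(1)] assms(2)]
  by (simp add: GG_def HH_def tw_def psi_minus_1)

lemma HH_trivial: "HH trivial_char j = G_psi ((4 * j) mod 5)"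
proof -
  have "(\<lambda>x. cnj (tw trivial_char j x)) = tw trivial_char (4 * j)"
    by (rule ext) (simp add: tw_def trivial_char_def cnj_psi power_mult)
  then show ?thesis by (simp add: HH_def GG_def tw_mod)
qed

lemma tw_trivial_inj: "inj_on (tw trivial_char) {..<5}"
proof (rule inj_onI)
  have *: False if lt: "i < j" "j < 5" "tw trivial_char i = tw trivial_char j" for i j :: nat
  proof -
    have "\<psi> x ^ (j - i) = trivial_char x" for x
    proof (cases "x = 0")
      case True
      then show ?thesis using lt by (simp add: mult_char_0[OF psi] trivial_char_def)
    next
      case False
      have "\<psi> x ^ i = \<psi> x ^ j" using fun_cong[OF lt(3), of x] False by (simp add: tw_def trivial_char_def)
      then have "\<psi> x ^ i * \<psi> x ^ (j - i) = \<psi> x ^ i * 1"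
        unfolding power_add[symmetric] using lt(1) by simp
      then show ?thesis using False by (simp add: mult_char_eq_0_iff[OF psi] trivial_char_def)
    qed
    moreover have "\<not> 5 dvd j - i" using lt by (auto dest: dvd_imp_le)
    ultimately show False using psi_pow_nontrivial by blast
  qed
  fix i j :: nat assume "i \<in> {..<5}" "j \<in> {..<5}" "tw trivial_char i = tw trivial_char j"
  then show "i = j" using *[of i j] *[of j i] by (cases i j rule: linorder_cases) auto
qed

definition generic_term :: "('a \<Rightarrow> complex) \<Rightarrow> complex" where
  "generic_term \<eta> = generic_polynomial q (GG \<eta> 0) (GG \<eta> 1) (GG \<eta> 2) (HH \<eta> 0) (HH \<eta> 1) (HH \<eta> 2) (HH \<eta> 3) (HH \<eta> 4)"

text \<open>For the powers of \<open>\<psi>\<close> the products \<open>G\<^sub>i H\<^sub>i\<close> degenerate to \<open>1\<close> for one \<open>i\<close>; the resulting corrections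
  cancel the contribution of the points on the coordinate hyperplanes.\<close>

lemma affine_count_main:
  assumes lam: "lam \<noteq> 0"
  shows "q * of_nat (card {v. dwork_form lam v = 0}) = q ^ 5 + (\<Sum>\<eta> | mult_char \<eta>. \<eta> (lam ^ 5) * generic_term \<eta>)"
proof -
  define R where "R \<eta> = rotation_term (GG \<eta> 0) (GG \<eta> 1) (GG \<eta> 2) (GG \<eta> 3) (GG \<eta> 4)" for \<eta>
  define PH where "PH \<eta> = HH \<eta> 0 * HH \<eta> 1 * HH \<eta> 2 * HH \<eta> 3 * HH \<eta> 4" for \<eta>
  define Z where "Z \<eta> = quintic_sum \<eta>" for \<eta>
  define K where "K \<eta> = \<eta> (-1) * \<eta> (lam ^ 5) * R \<eta> * PH \<eta>" for \<eta>
  have psi_lam: "\<psi> (lam ^ 5) = 1" using psi5[OF lam] by (simp add: mult_char_power[OF psi])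
  have s_tw: "tw \<eta> i (-1) * tw \<eta> i (lam ^ 5) = \<eta> (-1) * \<eta> (lam ^ 5)" for \<eta> i
    by (simp add: tw_def psi_minus_1 psi_lam)
  have PH_tw: "PH (tw \<eta> i) = PH \<eta>" if "mult_char \<eta>" "i < 5" for \<eta> i
  proof -
    have "i = 0 \<or> i = 1 \<or> i = 2 \<or> i = 3 \<or> i = 4" using that(2) by linarith
    then show ?thesis
      unfolding PH_def HH_tw[OF that(1)] by (elim disjE) (simp_all add: mult_ac numeral_2_eq_2[symmetric])
  qed
  \<comment> \<open>A rotation of the indices is a twist of \<eta>. The other factors of the summand
    are invariant under twists, so all five rotations have the same sum over \<eta>, and this factor
    5 cancels the 1/5 in \<open>affine_count\<close>.\<close>
  have Z_R: "Z \<eta> = (\<Sum>i<5. R (tw \<eta> i))" if "mult_char \<eta>" for \<eta>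
    unfolding Z_def zero_sum_quintic_rotations R_def sum5 GG_tw[OF that]
    by (simp add: numeral_2_eq_2[symmetric])
  have "(\<Sum>\<eta> | mult_char \<eta>. \<eta> (-1) * \<eta> (lam ^ 5) * Z \<eta> * PH \<eta>) = (\<Sum>\<eta> | mult_char \<eta>. \<Sum>i<5. K (tw \<eta> i))"
    by (intro sum.cong) (auto simp: Z_R K_def s_tw PH_tw sum_distrib_left sum_distrib_right)
  also have "\<dots> = (\<Sum>i<5::nat. \<Sum>\<eta> | mult_char \<eta>. K (tw \<eta> i))" by (rule sum.swap)
  also have "\<dots> = 5 * (\<Sum>\<eta> | mult_char \<eta>. K \<eta>)" unfolding sum_over_tw by simp
  finally have Z_sum: "(\<Sum>\<eta> | mult_char \<eta>. \<eta> (-1) * \<eta> (lam ^ 5) * Z \<eta> * PH \<eta>) = 5 * (\<Sum>\<eta> | mult_char \<eta>. K \<eta>)" .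
  \<comment> \<open>The defect of the cancellation of Gauss sums; it is supported on the five powers
    of \<psi>.\<close>
  define D where "D \<eta> = K \<eta> - q ^ 2 * (\<eta> (lam ^ 5) * generic_term \<eta>)" for \<eta>
  have D0: "D \<eta> = 0" if \<eta>: "mult_char \<eta>" "\<eta> \<notin> tw trivial_char ` {..<5}" for \<eta>
  proof -
    have "tw \<eta> j \<noteq> trivial_char" for j
      using fifth_torsion[OF \<eta>(1)] tw_eq_trivialD[OF \<eta>(1)] \<eta>(2) by (metis image_eqI lessThan_iff)
    note u = GG_HH[OF \<eta>(1) this]
    define m where "m = \<eta> (-1)"
    have m: "m * m = 1" "m * (m * y) = y" for y
      using mult_char_minus1_square[OF \<eta>(1)] by (simp_all add: m_def mult.assoc[symmetric])
    \<comment> \<open>Every class contains 1, 3 or 5 of the pairs, an odd number, so their signs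
      cancel against the factor m = \<eta>(-1) in front.\<close>
    have "m * (R \<eta> * PH \<eta>) = q ^ 2 * generic_term \<eta>"
      unfolding R_def PH_def rotation_term_times u generic_term_def generic_polynomial_def m_def[symmetric]
      using q_neq_0 by (simp add: field_simps numeral_eq_Suc m)
    then have "\<eta> (lam ^ 5) * (m * (R \<eta> * PH \<eta>)) = \<eta> (lam ^ 5) * (q ^ 2 * generic_term \<eta>)" by simp
    then show ?thesis unfolding D_def K_def m_def by (simp add: mult_ac)
  qed
  define zg where "zg = quintic_sum_psi (- 1)"
  define z0 where "z0 = quintic_sum_psi 0"
  define x1 x3 x4 x2 where x: "x1 = G_psi 1" "x3 = G_psi 2" "x4 = G_psi 3" "x2 = G_psi 4"
  have rel: "x1 * x2 = q" "x3 * x4 = q" using gauss_psi_mult by (simp_all add: x GG_def)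
  have G0: "G_psi 0 = -1" by (simp add: GG_def gauss_trivial)
  note mc = mult_char_trivial[where 'a = 'a]
  \<comment> \<open>Twisting the trivial character rotates the indices, and its conjugate Gauss sums
    are again Gauss sums of powers of \<psi>. Everything is thus a polynomial in four numbers with
    the two relations \<open>rel\<close>.\<close>
  have main_sum: "(\<Sum>j<5. generic_term (tw trivial_char j)) = (q - 1) * z0 - q * zg"
    unfolding sum5 generic_term_def GG_tw[OF mc] HH_tw[OF mc] HH_trivial z0_def zg_def
    using generic_polynomial_exceptional[OF q_neq_0 rel] by (simp add: x G0 numeral_2_eq_2[symmetric])
  have PH1: "PH (tw trivial_char j) = - (q ^ 2)" if "j < 5" for j
  proof -
    have "PH trivial_char = - ((x1 * x2) * (x3 * x4))"
      unfolding PH_def HH_trivial by (simp add: x G0 numeral_2_eq_2[symmetric] mult_ac)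
    then show ?thesis using PH_tw[OF mc that] rel by (simp add: power2_eq_square)
  qed
  have "(\<Sum>j<5. R (tw trivial_char j)) = zg"
    using Z_R[OF mc] by (simp add: Z_def zg_def G0)
  moreover have "K (tw trivial_char j) = - (q ^ 2) * R (tw trivial_char j)" if "j < 5" for j
    unfolding K_def s_tw PH1[OF that] using lam by (simp add: trivial_char_def)
  ultimately have K_sum: "(\<Sum>j<5. K (tw trivial_char j)) = - (q ^ 2) * zg"
    by (simp add: sum_distrib_left[symmetric] del: mult_minus_left)
  have "(\<Sum>\<eta> | mult_char \<eta>. D \<eta>) = (\<Sum>\<eta>\<in>tw trivial_char ` {..<5}. D \<eta>)"
    by (rule sum.mono_neutral_right) (auto simp: finite_mult_chars D0 mult_char_tw)
  also have "\<dots> = (\<Sum>j<5. D (tw trivial_char j))" by (simp add: sum.reindex[OF tw_trivial_inj])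
  also have "\<dots> = (\<Sum>j<5. K (tw trivial_char j)) - q ^ 2 * (\<Sum>j<5. generic_term (tw trivial_char j))"
  proof -
    have "tw trivial_char j (lam ^ 5) = 1" for j using lam by (simp add: tw_def trivial_char_def psi_lam)
    then show ?thesis by (simp add: D_def sum_subtractf sum_distrib_left)
  qed
  also have "\<dots> = q ^ 2 * ((q - 1) * (zg - z0))" unfolding K_sum main_sum by (simp add: algebra_simps)
  finally have "(\<Sum>\<eta> | mult_char \<eta>. K \<eta>) = q ^ 2 * (\<Sum>\<eta> | mult_char \<eta>. \<eta> (lam ^ 5) * generic_term \<eta>) + q ^ 2 * ((q - 1) * (zg - z0))"
    by (simp add: D_def sum_subtractf sum_distrib_left algebra_simps)
  then show ?thesis
    unfolding affine_count[OF lam] Z_def[symmetric] PH_def[symmetric] Z_sum zg_def[symmetric] z0_def[symmetric]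
    using q_neq_0 by (simp add: field_simps)
qed

section \<open>Hypergeometric sums\<close>


abbreviation tw_binom :: "('a \<Rightarrow> complex) \<Rightarrow> nat \<Rightarrow> nat \<Rightarrow> complex" where
  "tw_binom \<alpha> i j \<equiv> char_binom (tw \<alpha> i) (tw \<alpha> j)"

text \<open>The binomial is a normalised Jacobi sum, and \<open>jacobi_gauss\<close> applies because
  distinct indices exclude that both characters are trivial. The third Gauss sum no longer involves
  \<alpha>: only a power of \<psi> is left, with exponent \<open>4 * i + j\<close>, that is j - i
  modulo 5.\<close>

lemma char_binom_tw:
  assumes \<alpha>: "mult_char \<alpha>" and ij: "i < 5" "j < 5" "i \<noteq> j"
  shows "tw_binom \<alpha> i j = \<alpha> (-1) * GG \<alpha> i * HH \<alpha> j * G_psi ((4 * i + j) mod 5) / q ^ 2"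
proof -
  note A = mult_char_tw[OF \<alpha>, of i] and B = mult_char_cnj[OF mult_char_tw[OF \<alpha>, of j]]
  have prod_eq: "cnj (tw \<alpha> i x * cnj (tw \<alpha> j x)) = tw trivial_char (4 * i + j) x" for x
  proof (cases "x = 0")
    case False
    have "cnj (tw \<alpha> i x * cnj (tw \<alpha> j x)) = (\<alpha> x * cnj (\<alpha> x)) * (cnj (\<psi> x) ^ i * \<psi> x ^ j)"
      by (simp add: tw_def)
    then show ?thesis
      using False by (simp add: mult_char_cnj_self[OF \<alpha>] cnj_psi tw_def trivial_char_def power_mult power_add)
  qed (simp add: tw_def trivial_char_def mult_char_0[OF \<alpha>])
  have minus: "tw \<alpha> k (-1) = \<alpha> (-1)" for k by (simp add: tw_def psi_minus_1)
  have "tw \<alpha> i \<noteq> trivial_char \<or> (\<lambda>x. cnj (tw \<alpha> j x)) \<noteq> trivial_char"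
  proof (rule ccontr)
    assume "\<not> ?thesis"
    then have 1: "tw \<alpha> i = trivial_char" and 2: "(\<lambda>x. cnj (tw \<alpha> j x)) = trivial_char" by auto
    have "tw trivial_char (4 * i + j) x = trivial_char x" for x
      unfolding prod_eq[symmetric] fun_cong[OF 1] fun_cong[OF 2] by (simp add: trivial_char_def)
    then have "tw trivial_char (4 * i + j) = trivial_char" by blast
    then have "tw trivial_char ((4 * i + j) mod 5) = tw trivial_char 0" by (simp add: tw_mod)
    then have "(4 * i + j) mod 5 = 0" using tw_trivial_inj by (auto simp: inj_on_def)
    moreover have "i = 0 \<or> i = 1 \<or> i = 2 \<or> i = 3 \<or> i = 4" "j = 0 \<or> j = 1 \<or> j = 2 \<or> j = 3 \<or> j = 4"
      using ij(1,2) by linarith+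
    ultimately show False using ij(3) by (elim disjE) simp_all
  qed
  from jacobi_gauss[OF A B this]
  have "q * jacobi_sum (tw \<alpha> i) (\<lambda>x. cnj (tw \<alpha> j x)) = GG \<alpha> i * HH \<alpha> j * G_psi ((4 * i + j) mod 5)"
    unfolding prod_eq minus using mult_char_minus1_square[OF \<alpha>]
    by (simp add: GG_def HH_def tw_mod mult_char_minus1_cnj[OF \<alpha>])
  moreover have "tw_binom \<alpha> i j = \<alpha> (-1) / q * jacobi_sum (tw \<alpha> i) (\<lambda>x. cnj (tw \<alpha> j x))"
    by (simp add: char_binom_def jacobi_sum_def minus q_eq)
  ultimately show ?thesis using q_neq_0 by (simp add: power2_eq_square field_simps)
qed

lemma GG_cnj: "mult_char \<alpha> \<Longrightarrow> GG (\<lambda>x. cnj (\<alpha> x)) i = HH \<alpha> ((4 * i) mod 5)"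
  and HH_cnj: "mult_char \<alpha> \<Longrightarrow> HH (\<lambda>x. cnj (\<alpha> x)) i = GG \<alpha> ((4 * i) mod 5)"
proof -
  assume \<alpha>: "mult_char \<alpha>"
  have "tw (\<lambda>x. cnj (\<alpha> x)) i x = cnj (tw \<alpha> (4 * i) x)" for x
  proof (cases "x = 0")
    case False
    then show ?thesis by (simp add: tw_def power_mult flip: cnj_psi)
  qed (simp add: tw_def mult_char_0[OF \<alpha>])
  then have "tw (\<lambda>x. cnj (\<alpha> x)) i = (\<lambda>x. cnj (tw \<alpha> (4 * i) x))" by blast
  then show "GG (\<lambda>x. cnj (\<alpha> x)) i = HH \<alpha> ((4 * i) mod 5)" unfolding GG_def HH_def tw_mod[OF \<alpha>] by simp
  have "cnj (tw (\<lambda>x. cnj (\<alpha> x)) i x) = tw \<alpha> (4 * i) x" for x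
  proof (cases "x = 0")
    case False
    then show ?thesis by (simp add: tw_def power_mult cnj_psi)
  qed (simp add: tw_def mult_char_0[OF \<alpha>])
  then have "(\<lambda>x. cnj (tw (\<lambda>x. cnj (\<alpha> x)) i x)) = tw \<alpha> (4 * i)" by blast
  then show "HH (\<lambda>x. cnj (\<alpha> x)) i = GG \<alpha> ((4 * i) mod 5)" unfolding GG_def HH_def tw_mod[OF \<alpha>] by simp
qed

text \<open>Replacing \<alpha> by its inverse exchanges the Gauss sums \<open>GG\<close> and
  \<open>HH\<close> and moves the argument from y to 1/y. This is where the reciprocal of
  \<lambda>^5 comes from.\<close>

lemma sum_chars_invert:
  assumes "\<And>\<alpha>. mult_char \<alpha> \<Longrightarrow> F \<alpha> = F' \<alpha>" and "\<And>\<alpha>. mult_char \<alpha> \<Longrightarrow> F' (\<lambda>x. cnj (\<alpha> x)) = H \<alpha>"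
  shows "(\<Sum>\<alpha> | mult_char \<alpha>. F \<alpha> * \<alpha> (1 / y)) = (\<Sum>\<alpha> | mult_char \<alpha>. \<alpha> (y :: 'a) * H \<alpha>)"
proof -
  have "(\<Sum>\<alpha> | mult_char \<alpha>. F \<alpha> * \<alpha> (1 / y)) = (\<Sum>\<alpha> | mult_char \<alpha>. F' \<alpha> * \<alpha> (1 / y))"
    using assms(1) by simp
  also have "\<dots> = (\<Sum>\<alpha> | mult_char \<alpha>. F' (\<lambda>x. cnj (\<alpha> x)) * cnj (\<alpha> (1 / y)))"
    by (rule sum_over_mult_chars_cnj[symmetric])
  also have "\<dots> = (\<Sum>\<alpha> | mult_char \<alpha>. \<alpha> y * H \<alpha>)"
    by (intro sum.cong) (auto simp: assms(2) mult_char_divide mult_char_1 mult.commute)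
  finally show ?thesis .
qed

lemma gauss_psi_rel:
  "G_psi 1 * G_psi 4 = q" "G_psi 2 * G_psi 3 = q"
  using gauss_psi_mult by (simp_all add: GG_def)

text \<open>The four Gauss sums that do not involve \<alpha> form two inverse pairs with product
  q^2, against a denominator q^8; the four signs \<alpha>(-1) cancel.\<close>

lemma binom_4F3:
  assumes \<alpha>: "mult_char \<alpha>"
  shows "tw_binom \<alpha> 1 0 * (tw_binom \<alpha> 2 0 * (tw_binom \<alpha> 3 0
    * tw_binom \<alpha> 4 0)) = HH \<alpha> 0 ^ 4 * (GG \<alpha> 1 * GG \<alpha> 2 * GG \<alpha> 3 * GG \<alpha> 4) / q ^ 6"
proof -
  define m where "m = \<alpha> (-1)"
  have m: "m * m = 1" unfolding m_def by (rule mult_char_minus1_square[OF \<alpha>])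
  have "tw_binom \<alpha> 1 0 * (tw_binom \<alpha> 2 0 * (tw_binom \<alpha> 3 0
    * tw_binom \<alpha> 4 0)) = ((m * m) * (m * m)) * HH \<alpha> 0 ^ 4 * (GG \<alpha> 1 * GG \<alpha> 2 * GG \<alpha> 3 * GG \<alpha> 4)
      * ((G_psi 1 * G_psi 4) * (G_psi 2 * G_psi 3)) / (q ^ 2) ^ 4"
    by (simp add: char_binom_tw[OF \<alpha>] m_def[symmetric] power4_eq_xxxx mult_ac numeral_2_eq_2[symmetric] del: tw_0)
  also have "\<dots> = HH \<alpha> 0 ^ 4 * (GG \<alpha> 1 * GG \<alpha> 2 * GG \<alpha> 3 * GG \<alpha> 4) / q ^ 6"
    unfolding m gauss_psi_rel using q_neq_0 by (simp add: field_simps numeral_eq_Suc)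
  finally show ?thesis .
qed

text \<open>The assumption \<open>rel\<close> concerns the two Gauss sums that do not involve
  \<alpha>. Their product q, against a denominator q^4, leaves q^3. It holds for exactly the
  parameter choices made later because these Gauss sums belong to inverse characters.\<close>

lemma binom_2F1:
  assumes \<alpha>: "mult_char \<alpha>" and ij: "i < 5" "0 < i" "k < 5" "l < 5" "k \<noteq> l"
    and rel: "G_psi ((4 * i) mod 5) * G_psi ((4 * k + l) mod 5) = q"
  shows "tw_binom \<alpha> i 0 * tw_binom \<alpha> k l =
    HH \<alpha> 0 * HH \<alpha> l * (GG \<alpha> i * GG \<alpha> k) / q ^ 3"
proof -
  define m where "m = \<alpha> (-1)"
  have m: "m * m = 1" unfolding m_def by (rule mult_char_minus1_square[OF \<alpha>])
  have "tw_binom \<alpha> i 0 * tw_binom \<alpha> k l =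
      (m * m) * (HH \<alpha> 0 * HH \<alpha> l * (GG \<alpha> i * GG \<alpha> k))
      * (G_psi ((4 * i) mod 5) * G_psi ((4 * k + l) mod 5)) / (q ^ 2) ^ 2"
    using ij by (simp add: char_binom_tw[OF \<alpha>] m_def[symmetric] power2_eq_square mult_ac del: tw_0)
  also have "\<dots> = HH \<alpha> 0 * HH \<alpha> l * (GG \<alpha> i * GG \<alpha> k) / q ^ 3"
    unfolding m rel using q_neq_0 by (simp add: field_simps numeral_eq_Suc)
  finally show ?thesis .
qed

lemma sum_4F3:
  "(\<Sum>\<alpha> | mult_char \<alpha>. tw_binom \<alpha> 1 0 * (tw_binom \<alpha> 2 0 * (tw_binom \<alpha> 3 0
    * tw_binom \<alpha> 4 0)) * \<alpha> (1 / y)) =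
   (\<Sum>\<alpha> | mult_char \<alpha>. \<alpha> (y :: 'a) * (GG \<alpha> 0 ^ 4 * (HH \<alpha> 1 * HH \<alpha> 2 * HH \<alpha> 3 * HH \<alpha> 4) / q ^ 6))"
  by (rule sum_chars_invert[OF binom_4F3]) (auto simp: GG_cnj HH_cnj mult_ac numeral_2_eq_2[symmetric])

lemma sum_2F1:
  assumes ij: "i < 5" "0 < i" "k < 5" "l < 5" "k \<noteq> l"
    and rel: "G_psi ((4 * i) mod 5) * G_psi ((4 * k + l) mod 5) = q"
  shows "(\<Sum>\<alpha> | mult_char \<alpha>. tw_binom \<alpha> i 0 * tw_binom \<alpha> k l * \<alpha> (1 / y)) =
   (\<Sum>\<alpha> | mult_char \<alpha>. \<alpha> (y :: 'a) * (GG \<alpha> 0 * GG \<alpha> ((4 * l) mod 5) * (HH \<alpha> ((4 * i) mod 5) * HH \<alpha> ((4 * k) mod 5)) / q ^ 3))"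
  by (rule sum_chars_invert[OF binom_2F1[OF _ ij rel]]) (auto simp: GG_cnj HH_cnj)

lemma dwork_count_hypergeometric:
  assumes lam: "lam \<noteq> (0 :: 'a)"
  defines "S F \<equiv> (\<Sum>\<alpha> | mult_char \<alpha>. F \<alpha> * \<alpha> (1 / lam ^ 5)) :: complex"
  shows "(of_nat (card {v. dwork_form lam v = 0}) - 1) / (q - 1) =
    (q ^ 4 - 1) / (q - 1) + 24 * q ^ 2 * delta (1 - lam ^ 5)
    + q ^ 3 * (q / (q - 1) * S (\<lambda>\<alpha>. tw_binom \<alpha> 1 0 * (tw_binom \<alpha> 2 0
        * (tw_binom \<alpha> 3 0 * tw_binom \<alpha> 4 0))))
    + 20 * q ^ 2 * (q / (q - 1) * S (\<lambda>\<alpha>. tw_binom \<alpha> 2 0 * tw_binom \<alpha> 3 0))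
    + 20 * q ^ 2 * (q / (q - 1) * S (\<lambda>\<alpha>. tw_binom \<alpha> 1 0 * tw_binom \<alpha> 4 0))
    + 30 * q ^ 2 * (q / (q - 1) * S (\<lambda>\<alpha>. tw_binom \<alpha> 1 0 * tw_binom \<alpha> 3 4))
    + 30 * q ^ 2 * (q / (q - 1) * S (\<lambda>\<alpha>. tw_binom \<alpha> 1 0 * tw_binom \<alpha> 2 3))"
proof -
  define M where "M F = (\<Sum>\<alpha> | mult_char \<alpha>. \<alpha> (lam ^ 5) * F \<alpha>)" for F :: "('a \<Rightarrow> complex) \<Rightarrow> complex"
  have M_mult: "M (\<lambda>\<alpha>. c * F \<alpha>) = c * M F" "M (\<lambda>\<alpha>. F \<alpha> / c) = M F / c" for c F
    by (simp_all add: M_def sum_distrib_left sum_divide_distrib mult_ac)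
  \<comment> \<open>One sum per class, with representatives (0,0,0,0,0), (0,0,0,1,4), (0,0,0,2,3),
    (0,0,1,1,3) and (0,0,1,2,2). The factors \<open>HH\<close> are those whose index is missing from
    the vector.\<close>
  define m0 m1 m2 m3 m4 where m:
    "m0 = M (\<lambda>\<alpha>. GG \<alpha> 0 ^ 4 * (HH \<alpha> 1 * HH \<alpha> 2 * HH \<alpha> 3 * HH \<alpha> 4))"
    "m1 = M (\<lambda>\<alpha>. GG \<alpha> 0 ^ 2 * (HH \<alpha> 2 * HH \<alpha> 3))" "m2 = M (\<lambda>\<alpha>. GG \<alpha> 0 ^ 2 * (HH \<alpha> 1 * HH \<alpha> 4))"
    "m3 = M (\<lambda>\<alpha>. GG \<alpha> 0 * GG \<alpha> 1 * (HH \<alpha> 2 * HH \<alpha> 4))" "m4 = M (\<lambda>\<alpha>. GG \<alpha> 0 * GG \<alpha> 2 * (HH \<alpha> 3 * HH \<alpha> 4))"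
  have main: "(\<Sum>\<alpha> | mult_char \<alpha>. \<alpha> (lam ^ 5) * generic_term \<alpha>) = m0 / q + 20 * q * m1 + 20 * q * m2 + 30 * q * m3 + 30 * q * m4
      + 24 * q ^ 3 * ((q - 1) * delta (1 - lam ^ 5))"
  proof -
    define k where "k = 24 * q ^ 3"
    have M_add: "M (\<lambda>\<alpha>. F \<alpha> + F' \<alpha>) = M F + M F'" for F F'
      by (simp add: M_def distrib_left sum.distrib)
    \<comment> \<open>In the class of (0,1,2,3,4) all Gauss sums have cancelled, so orthogonality of
      characters at \<lambda>^5 produces the \<delta> term.\<close>
    have M_const: "M (\<lambda>_. k) = k * ((q - 1) * delta (1 - lam ^ 5))"
      by (simp add: M_def sum_distrib_right[symmetric] sum_over_mult_chars delta_def q_eq)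
    have "(\<Sum>\<alpha> | mult_char \<alpha>. \<alpha> (lam ^ 5) * generic_term \<alpha>) = M generic_term" by (simp add: M_def)
    also have "\<dots> = m0 / q + 20 * q * m1 + 20 * q * m2 + 30 * q * m3 + 30 * q * m4
      + k * ((q - 1) * delta (1 - lam ^ 5))"
      unfolding generic_term_def[abs_def] generic_polynomial_def k_def[symmetric] M_add M_mult m M_const ..
    finally show ?thesis by (simp add: k_def)
  qed
  have s0: "S (\<lambda>\<alpha>. tw_binom \<alpha> 1 0 * (tw_binom \<alpha> 2 0
        * (tw_binom \<alpha> 3 0 * tw_binom \<alpha> 4 0))) = m0 / q ^ 6"
    unfolding S_def sum_4F3 m M_mult[symmetric] by (simp add: M_def)
  note rel = gauss_psi_rel gauss_psi_rel[unfolded mult.commute[of "G_psi 1"] mult.commute[of "G_psi 2"]]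
  have s1: "S (\<lambda>\<alpha>. tw_binom \<alpha> 2 0 * tw_binom \<alpha> 3 0) = m1 / q ^ 3"
    unfolding S_def m M_mult[symmetric]
    by (subst sum_2F1) (use rel in \<open>simp_all add: M_def power2_eq_square mult_ac numeral_2_eq_2[symmetric]\<close>)
  have s2: "S (\<lambda>\<alpha>. tw_binom \<alpha> 1 0 * tw_binom \<alpha> 4 0) = m2 / q ^ 3"
    unfolding S_def m M_mult[symmetric]
    by (subst sum_2F1) (use rel in \<open>simp_all add: M_def power2_eq_square mult_ac numeral_2_eq_2[symmetric]\<close>)
  have s3: "S (\<lambda>\<alpha>. tw_binom \<alpha> 1 0 * tw_binom \<alpha> 3 4) = m3 / q ^ 3"
    unfolding S_def m M_mult[symmetric]
    by (subst sum_2F1) (use rel in \<open>simp_all add: M_def power2_eq_square mult_ac numeral_2_eq_2[symmetric]\<close>)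
  have s4: "S (\<lambda>\<alpha>. tw_binom \<alpha> 1 0 * tw_binom \<alpha> 2 3) = m4 / q ^ 3"
    unfolding S_def m M_mult[symmetric]
    by (subst sum_2F1) (use rel in \<open>simp_all add: M_def power2_eq_square mult_ac numeral_2_eq_2[symmetric]\<close>)
  have N: "of_nat (card {v. dwork_form lam v = 0}) = q ^ 4 + (m0 / q + 20 * q * m1 + 20 * q * m2 + 30 * q * m3 + 30 * q * m4
      + 24 * q ^ 3 * ((q - 1) * delta (1 - lam ^ 5))) / q"
    using affine_count_main[OF lam] q_neq_0 unfolding main by (simp add: field_simps numeral_eq_Suc)
  define r where "r = q - 1"
  have r: "r \<noteq> 0" using q_neq_1 by (simp add: r_def)
  show ?thesis
    unfolding N s0 s1 s2 s3 s4 r_def[symmetric] using r q_neq_0 by (simp add: field_simps numeral_eq_Suc)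
qed

end

section \<open>From affine to projective points, and the choice of \<zeta>, \<psi> and
  \<theta>\<close>

lemma card_projective_points:
  fixes \<Phi> :: "'a::{field,finite} ^ 'n \<Rightarrow> bool"
  assumes hom: "\<And>c v. c \<noteq> 0 \<Longrightarrow> \<Phi> (c *s v) \<longleftrightarrow> \<Phi> v"
  shows "card {v. v \<noteq> 0 \<and> \<Phi> v} = (CARD('a) - 1) * card {P \<in> proj_points. \<forall>x\<in>P. \<Phi> x}"
proof -
  define line where "line v = {c *s v | c. c \<noteq> 0}" for v :: "'a ^ 'n"
  have cls: "proj_rel `` {v} = line v" if "v \<noteq> 0" for v
    using that by (auto simp: proj_rel_def line_def vector_mul_eq_0)
  have pp: "proj_points = line ` {v. v \<noteq> 0}"
    by (auto simp: proj_points_def quotient_def cls)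
  have self: "v \<in> line v" for v
    unfolding line_def by (auto intro!: exI[of _ 1])
  have line_eq: "line w = line v" if w: "w \<in> line v" for v w
  proof -
    obtain c where c: "c \<noteq> 0" "w = c *s v" using w by (auto simp: line_def)
    show ?thesis
    proof (intro equalityI subsetI)
      fix u assume "u \<in> line w"
      then obtain d where "d \<noteq> 0" "u = d *s w" by (auto simp: line_def)
      then show "u \<in> line v" using c by (auto simp: line_def vector_smult_assoc intro!: exI[of _ "d * c"])
    next
      fix u assume "u \<in> line v"
      then obtain d where "d \<noteq> 0" "u = d *s v" by (auto simp: line_def)
      then show "u \<in> line w" using c by (auto simp: line_def vector_smult_assoc intro!: exI[of _ "d / c"])
    qed
  qed
  have card_line: "card (line v) = CARD('a) - 1" if "v \<noteq> 0" for v
  proof -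
    have "inj_on (\<lambda>c. c *s v) (UNIV - {0})"
      using that by (auto simp: inj_on_def vector_mul_rcancel)
    moreover have "line v = (\<lambda>c. c *s v) ` (UNIV - {0})" by (auto simp: line_def)
    ultimately show ?thesis by (simp add: card_image card_Diff_subset)
  qed
  define D where "D = {P \<in> proj_points. \<forall>x\<in>P. \<Phi> x}"
  have D: "D = line ` {v. v \<noteq> 0 \<and> \<Phi> v}"
    unfolding D_def pp using hom self by (auto simp: line_def)
  have "{v. v \<noteq> 0 \<and> \<Phi> v} = \<Union>D"
  proof (intro equalityI subsetI)
    fix v assume "v \<in> \<Union>D"
    then obtain w c where "w \<noteq> 0" "\<Phi> w" "c \<noteq> 0" "v = c *s w" by (auto simp: D line_def)
    then show "v \<in> {v. v \<noteq> 0 \<and> \<Phi> v}" using hom by (simp add: vector_mul_eq_0)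
  qed (use self in \<open>auto simp: D\<close>)
  moreover have "card (\<Union>D) = sum card D"
  proof (rule card_Union_disjoint)
    show "pairwise disjnt D"
      unfolding pairwise_def disjnt_def D using line_eq by (auto simp: disjoint_iff) metis+
  qed simp
  moreover have "sum card D = (CARD('a) - 1) * card D"
    by (subst sum.cong[of D D card "\<lambda>_. CARD('a) - 1"]) (auto simp: D card_line)
  ultimately show ?thesis by (simp add: D_def)
qed

lemma dwork_form_scale: "dwork_form lam (c *s v) = c ^ 5 * dwork_form lam v"
  by (simp add: dwork_form_def power_mult_distrib prod.distrib sum_distrib_left algebra_simps numeral_eq_Suc)

lemma card_dwork_threefold:
  fixes lam :: "'a::{field,finite}"
  shows "card {v. dwork_form lam v = 0} = (CARD('a) - 1) * card (dwork_threefold lam) + 1"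
proof -
  have "dwork_threefold lam = {P \<in> proj_points. \<forall>x\<in>P. dwork_form lam x = 0}"
    by (simp add: dwork_threefold_def dwork_form_def sum_UNIV_5 prod_UNIV_5 mult.assoc)
  then have "(CARD('a) - 1) * card (dwork_threefold lam) = card {v. v \<noteq> 0 \<and> dwork_form lam v = 0}"
    using card_projective_points[of "\<lambda>x. dwork_form lam x = 0"] by (simp add: dwork_form_scale)
  moreover have "{v. dwork_form lam v = 0} = insert 0 {v. v \<noteq> 0 \<and> dwork_form lam v = 0}"
    by (auto simp: dwork_form_def sum_UNIV_5 prod_UNIV_5)
  ultimately show ?thesis by simp
qed

text \<open>Both \<open>\<zeta>\<close> and the fifth powers are obtained by counting roots of \<open>x\<^sup>t - 1\<close>.\<close>

lemma quintic_gauss_exists: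
  fixes T :: "'a::{field,finite} \<Rightarrow> complex"
  assumes p: "prime p" "e \<ge> 1" "CARD('a) = p ^ e" and card: "CARD('a) = 5 * t + 1" and T: "char_generator T"
  obtains \<zeta> \<theta> where "quintic_gauss \<zeta> (\<lambda>x. trivial_char x * T x ^ t) \<theta> (of_nat CARD('a))"
proof -
  define \<psi> where "\<psi> = (\<lambda>x. trivial_char x * T x ^ t)"
  have mcT: "mult_char T" using T by (simp add: char_generator_def)
  have t: "t > 0" using card card_field_ge_2[where 'a = 'a] by simp
  define P :: "'a poly" where "P = monom 1 t - 1"
  have "coeff P t = 1" using t by (simp add: P_def)
  then have P0: "P \<noteq> 0" by auto
  have degP: "degree P \<le> t" unfolding P_def by (rule degree_diff_le) (simp_all add: degree_monom_le)
  have roots: "{x. poly P x = 0} = {x. x ^ t = 1}" by (simp add: P_def poly_monom)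
  have card_le: "card {x :: 'a. x ^ t = 1} \<le> t"
    using card_poly_roots_bound[OF P0] degP by (simp add: roots)
  have pow: "y ^ (5 * t) = 1" if "y \<noteq> 0" for y :: 'a
    using field_power_card_minus_1[OF that] by (simp add: card)
  have \<psi>: "\<psi> x = T (x ^ t)" if "x \<noteq> 0" for x
    using that by (simp add: \<psi>_def trivial_char_def mult_char_power[OF mcT])
  have \<psi>_1: "\<psi> x = 1 \<longleftrightarrow> x ^ t = 1" if "x \<noteq> 0" for x
    using char_generator_faithful[OF T, of "x ^ t"] that by (auto simp: \<psi> mult_char_1[OF mcT])
  have mc\<psi>: "mult_char \<psi>"
    unfolding mult_char_def \<psi>_def
    by (simp add: trivial_char_def mult_char_mult[OF mcT] mult_char_eq_0_iff[OF mcT] power_mult_distrib)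
  \<comment> \<open>At most t of the 5 t units satisfy \<open>y ^ t = 1\<close>. For any other unit
    y, the power \<open>y ^ t\<close> serves as \<zeta>.\<close>
  obtain y :: 'a where y: "y \<noteq> 0" "y ^ t \<noteq> 1"
  proof -
    have "\<not> UNIV - {0 :: 'a} \<subseteq> {x. x ^ t = 1}"
    proof
      assume "UNIV - {0 :: 'a} \<subseteq> {x. x ^ t = 1}"
      then have "card (UNIV - {0 :: 'a}) \<le> t" using card_le by (meson card_mono finite le_trans)
      then show False using t by (simp add: card card_Diff_subset)
    qed
    then show ?thesis using that by blast
  qed
  \<comment> \<open>Each fibre of the fifth power map on units has at most 5 elements, so its image
    has at least t. The image lies among the roots of x^t - 1, at most t in number, hence it is all
    of them.\<close>
  have fifth: "\<psi> x = 1 \<longleftrightarrow> (\<exists>y. x = y ^ 5)" if x: "x \<noteq> 0" for x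
  proof -
    define I where "I = UNIV - {0 :: 'a}"
    have sub: "(\<lambda>y. y ^ 5) ` I \<subseteq> {x. x ^ t = 1}" using pow by (auto simp: I_def power_mult)
    have "card {y \<in> I. y ^ 5 = u} \<le> 5" for u
    proof -
      define Q :: "'a poly" where "Q = monom 1 5 - [:u:]"
      have "coeff Q 5 = 1" by (simp add: Q_def numeral_eq_Suc)
      then have "Q \<noteq> 0" by auto
      moreover have "degree Q \<le> 5" unfolding Q_def by (rule degree_diff_le) (simp_all add: degree_monom_le)
      ultimately have "card {y. poly Q y = 0} \<le> 5" using card_poly_roots_bound[of Q] by simp
      moreover have "{y \<in> I. y ^ 5 = u} \<subseteq> {y. poly Q y = 0}" by (auto simp: Q_def poly_monom)
      ultimately show ?thesis by (meson card_mono finite le_trans)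
    qed
    then have "(\<Sum>u\<in>(\<lambda>y. y ^ 5) ` I. card {y \<in> I. y ^ 5 = u}) \<le> (\<Sum>u\<in>(\<lambda>y. y ^ 5) ` I. 5)"
      by (intro sum_mono)
    moreover have "(\<Sum>u\<in>(\<lambda>y. y ^ 5) ` I. card {y \<in> I. y ^ 5 = u}) = card I"
      unfolding card_eq_sum by (rule sum.group) auto
    ultimately have "5 * t \<le> 5 * card ((\<lambda>y. y ^ 5) ` I)" by (simp add: I_def card card_Diff_subset)
    then have "(\<lambda>y. y ^ 5) ` I = {x. x ^ t = 1}" using sub card_le by (intro card_seteq) auto
    then have "x ^ t = 1 \<longleftrightarrow> x \<in> (\<lambda>y. y ^ 5) ` I" by simp
    also have "\<dots> \<longleftrightarrow> (\<exists>y. x = y ^ 5)" using x by (auto simp: I_def)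
    finally show ?thesis unfolding \<psi>_1[OF x] .
  qed
  obtain \<theta> :: "'a \<Rightarrow> complex" where \<theta>: "additive_char \<theta> (of_nat CARD('a))"
    using additive_char_exists[OF p] by blast
  have "quintic_gauss (y ^ t) \<psi> \<theta> (of_nat CARD('a))"
  proof (intro quintic_gauss.intro quintic_char.intro fifth_root.intro quintic_char_axioms.intro \<theta> mc\<psi> fifth)
    show "(y ^ t) ^ 5 = 1" using pow[OF y(1)] by (simp add: power_mult[symmetric] mult.commute)
    show "y ^ t \<noteq> 1" by (rule y(2))
    show "\<psi> \<noteq> trivial_char"
    proof
      assume "\<psi> = trivial_char"
      then have "\<psi> y = 1" using y(1) by (simp add: trivial_char_def)
      then show False using \<psi>_1[OF y(1)] y(2) by simp
    qed
  qed
  then show ?thesis using that unfolding \<psi>_def by blast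
qed

theorem theorem1p4:
  fixes T :: "'a::{field,finite} \<Rightarrow> complex"
    and lam :: 'a
    and p e q t :: nat
  assumes "prime p" and "odd p" and "e \<ge> 1"
    and "q = p ^ e" and "CARD('a) = q"
    and "[q = 1] (mod 5)"
    and "t = (q - 1) div 5"
    and "char_generator T"
    and "lam \<noteq> 0"
  shows "of_nat (card (dwork_threefold lam)) =
      (of_nat q ^ 4 - 1) / (of_nat q - 1) + 24 * of_nat q ^ 2 * delta (1 - lam ^ 5)
    + of_nat q ^ 3 *
        greene_F (T [^]\<^bsub>char_group\<^esub> t)
          [T [^]\<^bsub>char_group\<^esub> (2 * t), T [^]\<^bsub>char_group\<^esub> (3 * t), T [^]\<^bsub>char_group\<^esub> (4 * t)]
          [trivial_char, trivial_char, trivial_char] (1 / lam ^ 5)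
    + 20 * of_nat q ^ 2 *
        greene_F (T [^]\<^bsub>char_group\<^esub> (2 * t)) [T [^]\<^bsub>char_group\<^esub> (3 * t)]
          [trivial_char] (1 / lam ^ 5)
    + 20 * of_nat q ^ 2 *
        greene_F (T [^]\<^bsub>char_group\<^esub> t) [T [^]\<^bsub>char_group\<^esub> (4 * t)]
          [trivial_char] (1 / lam ^ 5)
    + 30 * of_nat q ^ 2 *
        greene_F (T [^]\<^bsub>char_group\<^esub> t) [T [^]\<^bsub>char_group\<^esub> (3 * t)]
          [T [^]\<^bsub>char_group\<^esub> (4 * t)] (1 / lam ^ 5)
    + 30 * of_nat q ^ 2 *
        greene_F (T [^]\<^bsub>char_group\<^esub> t) [T [^]\<^bsub>char_group\<^esub> (2 * t)]
          [T [^]\<^bsub>char_group\<^esub> (3 * t)] (1 / lam ^ 5)"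
proof -
  define \<psi> where "\<psi> = (\<lambda>x. trivial_char x * T x ^ t)"
  have q_mod: "q = 5 * t + 1"
  proof -
    have "q mod 5 = 1" using assms(6) by (simp add: cong_def)
    then show ?thesis using assms(7) by presburger
  qed
  have mcT: "mult_char T" using assms(8) by (simp add: char_generator_def)
  obtain \<zeta> \<theta> where "quintic_gauss \<zeta> \<psi> \<theta> (of_nat CARD('a))"
    unfolding \<psi>_def
    using quintic_gauss_exists[of p e t T] assms(1,3,4,5,8) q_mod by metis
  then interpret quintic_gauss \<zeta> \<psi> \<theta> "of_nat CARD('a)" .
  have psi_eq: "\<psi> x = trivial_char x * T x ^ t" for x by (simp add: \<psi>_def)
  \<comment> \<open>Multiplication by the power of T with exponent \<open>i * t\<close> is the twist
    with index i, so every binomial in Greene's function becomes one of the binomials evaluated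
    above.\<close>
  have T_tw: "(\<lambda>x. (T [^]\<^bsub>char_group\<^esub> (i * t)) x * \<alpha> x) = tw \<alpha> i" if "mult_char \<alpha>" for \<alpha> i
  proof
    fix x show "(T [^]\<^bsub>char_group\<^esub> (i * t)) x * \<alpha> x = tw \<alpha> i x"
      unfolding tw_def psi_eq char_group_pow[OF mcT] using mult_char_0[OF that]
      by (cases "x = 0") (simp_all add: trivial_char_def power_mult[symmetric] mult.commute)
  qed
  have T1: "(\<lambda>x. (T [^]\<^bsub>char_group\<^esub> t) x * \<alpha> x) = tw \<alpha> 1" if "mult_char \<alpha>" for \<alpha>
    using T_tw[OF that, of 1] by simp
  have triv: "(\<lambda>x. trivial_char x * \<alpha> x) = tw \<alpha> 0" if "mult_char \<alpha>" for \<alpha> :: "'a \<Rightarrow> complex"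
    using mult_char_trivial_absorb[OF that] by auto
  have "q \<ge> 1" using q_mod by simp
  then have card: "of_nat (card {v. dwork_form lam v = 0}) - 1 = (of_nat q - 1) * (of_nat (card (dwork_threefold lam)) :: complex)"
    using card_dwork_threefold[of lam] assms(5) by (simp add: of_nat_diff)
  have "of_nat q - 1 \<noteq> (0 :: complex)" using q_neq_1 assms(5) by simp
  then have "of_nat (card (dwork_threefold lam)) = (of_nat (card {v. dwork_form lam v = 0}) - 1) / (of_nat q - 1 :: complex)"
    unfolding card by simp
  moreover have "greene_F (T [^]\<^bsub>char_group\<^esub> t)
      [T [^]\<^bsub>char_group\<^esub> (2 * t), T [^]\<^bsub>char_group\<^esub> (3 * t), T [^]\<^bsub>char_group\<^esub> (4 * t)]
      [trivial_char, trivial_char, trivial_char] y = of_nat q / (of_nat q - 1) * (\<Sum>\<alpha> | mult_char \<alpha>.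
        tw_binom \<alpha> 1 0 * (tw_binom \<alpha> 2 0
        * (tw_binom \<alpha> 3 0 * tw_binom \<alpha> 4 0)) * \<alpha> y)" for y
    unfolding greene_F_def char_group_simps assms(5)
    by (intro arg_cong2[where f = "(*)"] refl sum.cong) (simp_all add: T_tw T1 triv)
  \<comment> \<open>A single template for all four functions with two upper parameters; the indices
    are fixed by the instances that follow.\<close>
  moreover have "greene_F A [B] [C] y = of_nat q / (of_nat q - 1) * (\<Sum>\<alpha> | mult_char \<alpha>.
        tw_binom \<alpha> i 0 * tw_binom \<alpha> k l * \<alpha> y)"
    if "\<And>\<alpha>. mult_char \<alpha> \<Longrightarrow> (\<lambda>x. A x * \<alpha> x) = tw \<alpha> i" "\<And>\<alpha>. mult_char \<alpha> \<Longrightarrow> (\<lambda>x. B x * \<alpha> x) = tw \<alpha> k"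
      "\<And>\<alpha>. mult_char \<alpha> \<Longrightarrow> (\<lambda>x. C x * \<alpha> x) = tw \<alpha> l" for A B C :: "'a \<Rightarrow> complex" and i k l y
    unfolding greene_F_def char_group_simps assms(5)
    by (intro arg_cong2[where f = "(*)"] refl sum.cong) (simp_all add: that)
  note this[OF T_tw T_tw triv] this[OF T1 T_tw triv] this[OF T1 T_tw T_tw]
  ultimately show ?thesis
    unfolding dwork_count_hypergeometric[OF assms(9), unfolded assms(5)] by (simp only:)
qed

end
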